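(* For every sequence $\{\omega_n\}_{n \in \mathbb{N}}$ of natural numbers satisfying $\omega_n\leq n - 1$ for all $n \in \mathbb{N}$, there exists a family of sets $\{S'_n\}_{n \in \mathbb{N}}$, each $S'_n$ a subset of $\{0,1\}^{d_n}$ with $d_n\le n$ (i.e. with at most $n$ variables), such that \[ tw(S'_n) \leq \omega_n + 1 \quad \text{and} \quad xc_{SDP}(S'_n)\in \Omega \left( \frac{n}{\omega_n + 1}\, 2^{\frac{\omega_n}{4}(1-o(1))}\right). \] Moreover, $tw(S'_n)$ is $\Omega\left(\frac{\omega_n}{4}(1-o(1))\right)$ and $\mathrm{conv}(S'_n)$ is a pyramid.
   Context: A formulation of a set $S\subseteq\{0,1\}^n$ is a representation $S=\{x\in\{0,1\}^n : \phi_i(x)=0,\ i\in[m]\}$ with Boolean functions $\phi_i:\{0,1\}^n\to\{0,1\}$. Its intersection graph has one vertex per variable and an edge between $x_j,x_l$ whenever both appear (explicitly) in some common $\phi_i$. The treewidth of a graph $G$ is the least $\omega$ such that $G$ is a subgraph of a chordal graph on the same vertices with clique number at most $\omega+1$. $tw(S)$ denotes the smallest treewidth of the intersection graph of any formulation of $S$. $xc_{SDP}(S)$ is the semidefinite extension complexity of $\mathrm{conv}(S)$: the minimum $r$ such that there exist vectors $a_i$, matrices $U_i\in\mathbb{S}^r_+$ and scalars $b_i$ ($i\in I$) with $x\in\mathrm{conv}(S)$ iff there is $Y\in\mathbb{S}^r_+$ with $a_i^Tx+\langle U_i,Y\rangle=b_i$ for all $i\in I$. A polytope $Q$ is a pyramid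 with base $B$ and apex $v$ if $Q=\mathrm{conv}(B\cup\{v\})$ and $v\notin\mathrm{aff}(B)$. *)

theory Defs
  imports
    "HOL-Analysis.Analysis"
    "HOL-Analysis.Finite_Function_Topology"
    "HOL-Library.Ramsey"
    "HOL-Library.Landau_Symbols"
    "Jordan_Normal_Form.Matrix"
begin

text \<open>
  The dimension varies with the index of a family, so \<open>\<real>\<^sup>d\<close> is realised inside one real vector
  space, the finitely supported functions \<open>nat \<Rightarrow>\<^sub>0 real\<close>, as the subspace of vectors supported
  on the first \<open>d\<close> coordinates. Convex and affine hulls of subsets of this subspace stay in it,
  so the library notions apply unchanged.
\<close>

definition Rspace :: "nat \<Rightarrow> (nat \<Rightarrow>\<^sub>0 real) set" where
  "Rspace d = {x. Poly_Mapping.keys x \<subseteq> {..<d}}"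

definition cube :: "nat \<Rightarrow> (nat \<Rightarrow>\<^sub>0 real) set" where
  "cube d = {x \<in> Rspace d. \<forall>i<d. Poly_Mapping.lookup x i \<in> {0, 1}}"


subsection \<open>Treewidth of a graph\<close>

text \<open>
  Graphs are finite simple graphs, given by a vertex set \<open>V\<close> and a set \<open>E\<close> of two-element subsets
  of \<open>V\<close>; cliques are those of \<open>HOL-Library.Ramsey\<close>. A cycle is the list of its distinct vertices
  in order; a chord joins two of them that are not consecutive on the cycle.
\<close>

definition is_cycle :: "'a set \<Rightarrow> 'a set set \<Rightarrow> 'a list \<Rightarrow> bool" where
  "is_cycle V E c \<longleftrightarrow> length c \<ge> 3 \<and> distinct c \<and> set c \<subseteq> V \<and>
     (\<forall>i<length c. {c ! i, c ! (Suc i mod length c)} \<in> E)"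

definition has_chord :: "'a set set \<Rightarrow> 'a list \<Rightarrow> bool" where
  "has_chord E c \<longleftrightarrow> (\<exists>i<length c. \<exists>j<length c. i \<noteq> j \<and>
     j \<noteq> Suc i mod length c \<and> i \<noteq> Suc j mod length c \<and> {c ! i, c ! j} \<in> E)"

definition chordal :: "'a set \<Rightarrow> 'a set set \<Rightarrow> bool" where
  "chordal V E \<longleftrightarrow> (\<forall>c. is_cycle V E c \<and> length c \<ge> 4 \<longrightarrow> has_chord E c)"

definition clique_number :: "'a set \<Rightarrow> 'a set set \<Rightarrow> nat" where
  "clique_number V E = Max (card ` {K. K \<subseteq> V \<and> clique K E})"

definition treewidth :: "'a set \<Rightarrow> 'a set set \<Rightarrow> nat" where
  "treewidth V E = (LEAST k. \<exists>E'. E \<subseteq> E' \<and> E' \<subseteq> [V]\<^bsup>2\<^esup> \<and> chordal V E' \<and>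
     clique_number V E' \<le> k + 1)"


subsection \<open>Formulations and treewidth of a set\<close>

text \<open>
  A formulation is a list of pairs \<open>(X, \<phi>)\<close>, where \<open>\<phi>\<close> is a Boolean function (\<open>False\<close> and \<open>True\<close>
  standing for 0 and 1) and \<open>X\<close> is the set of indices of the variables that appear explicitly in
  it. The value of \<open>\<phi>\<close> is determined by the variables in \<open>X\<close>, but it need not actually depend on
  all of them.
\<close>

type_synonym formulation = "(nat set \<times> ((nat \<Rightarrow>\<^sub>0 real) \<Rightarrow> bool)) list"

definition is_formulation :: "nat \<Rightarrow> (nat \<Rightarrow>\<^sub>0 real) set \<Rightarrow> formulation \<Rightarrow> bool" where
  "is_formulation d S F \<longleftrightarrow>
     (\<forall>(X, \<phi>) \<in> set F. X \<subseteq> {..<d} \<and>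
        (\<forall>x\<in>cube d. \<forall>y\<in>cube d.
           (\<forall>i\<in>X. Poly_Mapping.lookup x i = Poly_Mapping.lookup y i) \<longrightarrow> \<phi> x = \<phi> y)) \<and>
     S = {x \<in> cube d. \<forall>(X, \<phi>) \<in> set F. \<phi> x = False}"

definition intersection_edges :: "formulation \<Rightarrow> nat set set" where
  "intersection_edges F = {{j, l} | j l. j \<noteq> l \<and> (\<exists>(X, \<phi>) \<in> set F. j \<in> X \<and> l \<in> X)}"

definition tw :: "nat \<Rightarrow> (nat \<Rightarrow>\<^sub>0 real) set \<Rightarrow> nat" where
  "tw d S = (LEAST k. \<exists>F. is_formulation d S F \<and> k = treewidth {..<d} (intersection_edges F))"


subsection \<open>Semidefinite extension complexity\<close>

definition psd_mats :: "nat \<Rightarrow> real mat set" where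
  "psd_mats r = {Y \<in> carrier_mat r r. transpose_mat Y = Y \<and>
     (\<forall>v \<in> carrier_vec r. scalar_prod v (Y *\<^sub>v v) \<ge> 0)}"

text \<open>
  The indexed family \<open>(a\<^sub>i, U\<^sub>i, b\<^sub>i)\<close>, \<open>i \<in> I\<close>, enters only through the set \<open>L\<close> of its members.
  No finiteness of \<open>L\<close> is imposed: a linear system in finitely many unknowns is always
  equivalent to a finite subsystem.
\<close>

definition is_sdp_extension ::
  "nat \<Rightarrow> (nat \<Rightarrow>\<^sub>0 real) set \<Rightarrow> nat \<Rightarrow> ((nat \<Rightarrow>\<^sub>0 real) \<times> real mat \<times> real) set \<Rightarrow> bool" where
  "is_sdp_extension d P r L \<longleftrightarrow>
     (\<forall>(a, U, b) \<in> L. a \<in> Rspace d \<and> U \<in> psd_mats r) \<and>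
     (\<forall>x \<in> Rspace d. x \<in> P \<longleftrightarrow>
        (\<exists>Y \<in> psd_mats r. \<forall>(a, U, b) \<in> L.
           (\<Sum>j<d. Poly_Mapping.lookup a j * Poly_Mapping.lookup x j) +
           (\<Sum>i<r. \<Sum>j<r. U $$ (i, j) * Y $$ (i, j)) = b))"

definition xc_SDP :: "nat \<Rightarrow> (nat \<Rightarrow>\<^sub>0 real) set \<Rightarrow> nat" where
  "xc_SDP d S = (LEAST r. \<exists>L. is_sdp_extension d (convex hull S) r L)"


subsection \<open>Pyramids\<close>

definition is_pyramid :: "'a::real_vector set \<Rightarrow> bool" where
  "is_pyramid Q \<longleftrightarrow> (\<exists>B v. polytope B \<and> Q = convex hull (B \<union> {v}) \<and> v \<notin> affine hull B)"

end

theory Submission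
  imports Defs "HOL-Real_Asymp.Real_Asymp"
begin

text \<open>
  A semidefinite extension of size \<open>r\<close> attaches to each vertex a semidefinite form such that an
  affine combination of vertices whose forms combine to a semidefinite form stays in the polytope.
  Normalising the sum of the forms to the identity, such data can be rounded, so that only
  \<open>2 ^ (O(k) r\<^sup>4)\<close> subsets of the \<open>k\<close>-cube admit an extension of size \<open>r\<close>, while there are
  \<open>2 ^ 2 ^ (k - 1)\<close> sets containing all odd points; some set \<open>S\<close> of the latter kind thus needs
  size \<open>2 ^ (k / 4 (1 - o(1)))\<close>. It omits an even point all of whose neighbours it contains, and so
  one function of any formulation must mention all \<open>k\<close> variables.

  The free join of \<open>n / (k + 1)\<close> copies of \<open>S\<close> and a point is a pyramid. The vectors annihilated by
  the forms of all blocks but one yield, for different blocks, orthogonal families with respect to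
  the total form, and each family carries an extension of \<open>S\<close>; hence the sizes add up.
\<close>

subsection \<open>Semidefinite bilinear forms\<close>

text \<open>The exponent 1/4 reflects the amount of data to be recorded. A lift of size s, taken
  together with the coordinates, is a table with D = k + 1 + s^2 rows and one column per member of
  S; its rank is at most D, and a rounded D x D array of coefficients determines S. This takes O(k)
  D^2 bits, of order s^4 up to factors polynomial in k, against the 2^(k-1) bits of a free choice
  among the even points. Rounding needs a margin: as the forms sum to the identity, adding a small
  constant to all weights turns a slightly indefinite combination into a positive definite one and
  changes mass and moments only slightly, while distinct 0/1 points are too far apart for this to
  create a new member.

  For the join, the obstacle is to isolate one block. A combination that is positive definite on the
  common null space of the forms of the other blocks (modulo vectors null for all forms) becomes
  semidefinite everywhere once a large multiple of those forms is added. In a free join this only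
  puts weight on vertices of other blocks, which the moments of the given block do not see.\<close>

definition psd_form :: "('v::real_vector \<Rightarrow> 'v \<Rightarrow> real) \<Rightarrow> bool" where
  "psd_form B \<longleftrightarrow> bilinear B \<and> (\<forall>u v. B u v = B v u) \<and> (\<forall>u. 0 \<le> B u u)"

lemma psd_formD:
  assumes "psd_form B"
  shows psd_form_bilinear: "bilinear B"
    and psd_form_sym: "B u v = B v u"
    and psd_form_nonneg: "0 \<le> B u u"
  using assms by (auto simp: psd_form_def)

lemmas bilinear_simps = bilinear_ladd bilinear_radd bilinear_lmul bilinear_rmul
  bilinear_lsub bilinear_rsub bilinear_lzero bilinear_rzero

lemma bilinear_linear_combination:
  assumes "bilinear (B :: 'v::real_vector \<Rightarrow> 'v \<Rightarrow> real)"
  shows "B (\<Sum>a\<in>X. f a *\<^sub>R e a) (\<Sum>a\<in>X. f a *\<^sub>R e a) = (\<Sum>a\<in>X. \<Sum>b\<in>X. f a * f b * B (e a) (e b))"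
  by (simp add: bilinear_sum[OF assms] bilinear_simps assms sum.cartesian_product algebra_simps)

lemma bilinear_left_combination:
  assumes "bilinear (B :: 'v::real_vector \<Rightarrow> 'v \<Rightarrow> real)"
  shows "B (\<Sum>u\<in>V. f u *\<^sub>R u) w = (\<Sum>u\<in>V. f u * B u w)"
proof -
  have "linear (\<lambda>x. B x w)" using assms by (simp add: bilinear_def)
  from linear_sum[OF this, of "\<lambda>u. f u *\<^sub>R u" V] show ?thesis
    by (simp add: bilinear_simps assms)
qed

lemma bilinear_weighted_sum:
  assumes "\<And>z. z \<in> Z \<Longrightarrow> bilinear (B z)"
  shows "bilinear (\<lambda>u v. \<Sum>z\<in>Z. (c z::real) * B z u v)"
  using assms unfolding bilinear_def
  by (auto intro!: linearI simp: linear_iff algebra_simps sum.distrib sum_distrib_left intro: sum.cong)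

lemma psd_form_sum:
  assumes "\<And>z. z \<in> Z \<Longrightarrow> psd_form (B z)"
  shows "psd_form (\<lambda>u v. \<Sum>z\<in>Z. B z u v)"
  using bilinear_weighted_sum[of Z B "\<lambda>_. 1"] assms
  by (auto simp: psd_form_def sum_nonneg cong: sum.cong)

lemma psd_form_quad:
  assumes "psd_form B"
  shows "0 \<le> B u u + 2 * t * B u v + t\<^sup>2 * B v v"
proof -
  have "0 \<le> B (u + t *\<^sub>R v) (u + t *\<^sub>R v)"
    using assms by (rule psd_form_nonneg)
  then show ?thesis
    using psd_form_sym[OF assms, of v u] psd_form_bilinear[OF assms]
    by (simp add: bilinear_simps algebra_simps power2_eq_square)
qed

text \<open>A weighted substitute for Cauchy-Schwarz without square roots: the choice of \<tau>
  decides which of the two arguments bears the cross term.\<close>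

lemma psd_form_young:
  assumes "psd_form B" "\<tau> > 0"
  shows "2 * \<bar>B u v\<bar> \<le> \<tau> * B u u + B v v / \<tau>"
proof -
  have "0 \<le> \<tau> * (B u u + 2 * s / \<tau> * B u v + (s/\<tau>)\<^sup>2 * B v v)" for s
    using psd_form_quad[OF assms(1), of u "s/\<tau>" v] assms(2) by simp
  then have "0 \<le> \<tau> * B u u + 2 * s * B u v + s\<^sup>2 * B v v / \<tau>" for s
    using assms(2) by (simp add: algebra_simps power2_eq_square)
  from this[of 1] this[of "-1"] show ?thesis by (simp add: abs_if)
qed

lemma psd_form_null:
  assumes "psd_form B" "B u u = 0"
  shows "B u v = 0"
proof (rule ccontr)
  assume "B u v \<noteq> 0"
  define b where "b = \<bar>B u v\<bar>"
  have "b > 0" using \<open>B u v \<noteq> 0\<close> by (simp add: b_def)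
  \<comment> \<open>As \<open>B u u = 0\<close>, the Young bound reads 2 b <= B v v / \<tau> for
    every positive \<tau>; this choice makes the right-hand side smaller than b.\<close>
  have "(B v v + 1) / b > 0"
    using psd_form_nonneg[OF assms(1), of v] \<open>b > 0\<close> by simp
  from psd_form_young[OF assms(1) this, of u v]
  have "2 * b \<le> B v v / ((B v v + 1) / b)" using assms(2) by (simp add: b_def)
  then have "2 * b * (B v v + 1) \<le> b * B v v"
    using psd_form_nonneg[OF assms(1), of v] \<open>b > 0\<close> by (simp add: field_simps)
  moreover have "0 \<le> b * B v v" using psd_form_nonneg[OF assms(1), of v] \<open>b > 0\<close> by simp
  ultimately show False using \<open>b > 0\<close> by (simp add: algebra_simps)
qed

lemma psd_form_add_null:
  assumes "psd_form B" "B n n = 0"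
  shows "B (m + n) (m + n) = B m m"
  using psd_form_null[OF assms, of m] assms psd_form_sym[OF assms(1), of m n] psd_form_bilinear[OF assms(1)]
  by (simp add: bilinear_simps)

section \<open>Orthonormal sets for possibly degenerate forms\<close>

definition orthonormal_wrt :: "('v \<Rightarrow> 'v \<Rightarrow> real) \<Rightarrow> 'v set \<Rightarrow> bool" where
  "orthonormal_wrt B V \<longleftrightarrow> finite V \<and> (\<forall>u\<in>V. \<forall>v\<in>V. B u v = of_bool (u = v))"

lemma orthonormal_wrt_coefficient:
  assumes "psd_form B" "orthonormal_wrt B V" "v \<in> V"
  shows "B (\<Sum>u\<in>V. f u *\<^sub>R u) v = f v"
proof -
  have "B (\<Sum>u\<in>V. f u *\<^sub>R u) v = (\<Sum>u\<in>V. f u * B u v)"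
    by (simp add: bilinear_left_combination psd_form_bilinear assms(1))
  also have "\<dots> = (\<Sum>u\<in>V. if u = v then f v else 0)"
    using assms(2,3) by (auto intro!: sum.cong simp: orthonormal_wrt_def)
  also have "\<dots> = f v" using assms(2,3) by (simp add: orthonormal_wrt_def)
  finally show ?thesis .
qed

lemma orthonormal_wrt_norm:
  assumes "psd_form B" "orthonormal_wrt B V"
  shows "B (\<Sum>u\<in>V. f u *\<^sub>R u) (\<Sum>u\<in>V. f u *\<^sub>R u) = (\<Sum>u\<in>V. (f u)\<^sup>2)"
proof -
  have "(\<Sum>u\<in>V. \<Sum>v\<in>V. f u * f v * B u v) = (\<Sum>u\<in>V. \<Sum>v\<in>V. if v = u then (f u)\<^sup>2 else 0)"
    using assms(2) by (auto intro!: sum.cong simp: orthonormal_wrt_def power2_eq_square)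
  also have "\<dots> = (\<Sum>u\<in>V. (f u)\<^sup>2)"
    using assms(2) by (simp add: orthonormal_wrt_def)
  finally show ?thesis
    using bilinear_linear_combination[OF psd_form_bilinear[OF assms(1)], of f "\<lambda>u. u" V] by simp
qed

lemma orthonormal_wrt_independent:
  assumes "psd_form B" "orthonormal_wrt B V"
  shows "independent V"
proof -
  have "f v = 0" if "(\<Sum>u\<in>V. f u *\<^sub>R u) = 0" "v \<in> V" for f v
    using orthonormal_wrt_coefficient[OF assms that(2), of f] that(1)
    by (simp add: bilinear_lzero psd_form_bilinear assms(1))
  then show ?thesis
    using assms(2) by (auto simp: dependent_finite orthonormal_wrt_def)
qed

text \<open>If the residual of w after projection onto V had positive norm, its normalisation could
  be added to V. Degeneracy of B means that a null residual may remain. The bound r takes the place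
  of finite dimension and guarantees that a largest V exists.\<close>

lemma maximal_orthonormal:
  assumes B: "psd_form B" and N: "subspace N"
    and r: "\<And>V. \<lbrakk>V \<subseteq> N; orthonormal_wrt B V\<rbrakk> \<Longrightarrow> card V \<le> r"
  obtains V where "V \<subseteq> N" "orthonormal_wrt B V"
    "\<And>w. w \<in> N \<Longrightarrow> \<exists>n. w = (\<Sum>v\<in>V. B w v *\<^sub>R v) + n \<and> n \<in> N \<and> B n n = 0"
proof -
  let ?P = "\<lambda>V. V \<subseteq> N \<and> orthonormal_wrt B V"
  have "?P {}" by (simp add: orthonormal_wrt_def)
  moreover have "\<forall>V. ?P V \<longrightarrow> card V < Suc r" using r by (simp add: less_Suc_eq_le)
  ultimately obtain V where V: "V \<subseteq> N" "orthonormal_wrt B V"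
    and max: "\<And>V'. ?P V' \<Longrightarrow> card V' \<le> card V"
    using ex_has_greatest_nat[of ?P "{}" card "Suc r"] by (metis less_imp_le_nat)
  show thesis
  proof (rule that[OF V])
    fix w assume w: "w \<in> N"
    let ?m = "\<Sum>v\<in>V. B w v *\<^sub>R v"
    let ?n = "w - ?m"
    have n: "?n \<in> N"
      using N V(1) w by (intro subspace_diff subspace_sum subspace_scale) auto
    have orth: "B ?n v = 0" if "v \<in> V" for v
      using orthonormal_wrt_coefficient[OF B V(2) that]
      by (simp add: bilinear_lsub psd_form_bilinear B)
    have "B ?n ?n = 0"
    proof (rule ccontr)
      assume nz: "B ?n ?n \<noteq> 0"
      then have pos: "B ?n ?n > 0" using psd_form_nonneg[OF B, of ?n] by simp
      define e where "e = (1 / sqrt (B ?n ?n)) *\<^sub>R ?n"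
      have e1: "B e e = 1"
        using pos by (simp add: e_def bilinear_simps psd_form_bilinear B)
      have e0: "B e v = 0" "B v e = 0" if "v \<in> V" for v
        using orth[OF that] psd_form_sym[OF B, of v e]
        by (simp_all add: e_def bilinear_simps psd_form_bilinear B)
      have "e \<notin> V" using e0(1)[of e] e1 by auto
      moreover have "?P (insert e V)"
        using V e0 e1 \<open>e \<notin> V\<close> n N by (auto simp: orthonormal_wrt_def e_def intro: subspace_scale)
      ultimately show False
        using max[of "insert e V"] V(2) by (simp add: orthonormal_wrt_def)
    qed
    then show "\<exists>n. w = ?m + n \<and> n \<in> N \<and> B n n = 0"
      using n by (intro exI[of _ ?n]) simp
  qed
qed

text \<open>A variant of Finsler's lemma. Splitting off a maximal orthonormal set of the second form
  replaces the usual compactness argument.\<close>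

lemma weighted_form_bounded_below:
  fixes B :: "'z \<Rightarrow> 'v::real_vector \<Rightarrow> 'v \<Rightarrow> real"
  assumes Z: "finite Z" and I: "I \<subseteq> Z" and B: "\<And>z. z \<in> Z \<Longrightarrow> psd_form (B z)"
    and W: "subspace W"
    and r: "\<And>V. \<lbrakk>V \<subseteq> W; orthonormal_wrt (\<lambda>u v. \<Sum>z\<in>Z-I. B z u v) V\<rbrakk> \<Longrightarrow> card V \<le> r"
    and eps: "\<epsilon> > 0"
    and Q: "\<And>n. \<lbrakk>n \<in> W; \<And>z. z \<in> Z - I \<Longrightarrow> B z n n = 0\<rbrakk> \<Longrightarrow>
              \<epsilon> * (\<Sum>z\<in>I. B z n n) \<le> (\<Sum>z\<in>I. l z * B z n n)"
  obtains C where "\<And>w c. \<lbrakk>w \<in> W; c \<ge> C\<rbrakk> \<Longrightarrow>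
     0 \<le> (\<Sum>z\<in>I. l z * B z w w) + c * (\<Sum>z\<in>Z-I. B z w w)"
proof -
  define E where "E = (\<lambda>u v. \<Sum>z\<in>Z-I. B z u v)"
  have E: "psd_form E" unfolding E_def using B by (intro psd_form_sum) auto
  have BI: "psd_form (B z)" if "z \<in> I" for z using that B I by auto
  obtain V where V: "V \<subseteq> W" "orthonormal_wrt E V"
    and dec: "\<And>w. w \<in> W \<Longrightarrow> \<exists>n. w = (\<Sum>v\<in>V. E w v *\<^sub>R v) + n \<and> n \<in> W \<and> E n n = 0"
    using maximal_orthonormal[OF E W r] unfolding E_def by blast
  \<comment> \<open>The summand 1 keeps \<Lambda> positive even if all weights vanish. With \<tau> =
    \<epsilon> / \<Lambda> the cross terms cost at most \<epsilon> times the form on the null part,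
    which is exactly what the hypothesis \<open>Q\<close> grants there.\<close>
  define \<Lambda> where "\<Lambda> = (\<Sum>z\<in>I. \<bar>l z\<bar>) + 1"
  define \<tau> where "\<tau> = \<epsilon> / \<Lambda>"
  define K where "K = (\<Sum>z\<in>I. \<Sum>u\<in>V. \<Sum>v\<in>V. \<bar>B z u v\<bar>)"
  have finI: "finite I" using Z I finite_subset by blast
  have \<Lambda>: "\<Lambda> \<ge> 1" unfolding \<Lambda>_def by (simp add: sum_nonneg)
  have \<Lambda>': "\<bar>l z\<bar> \<le> \<Lambda>" if "z \<in> I" for z
    unfolding \<Lambda>_def using member_le_sum[OF that, of "\<lambda>z. \<bar>l z\<bar>"] finI by simp
  have \<tau>: "\<tau> > 0" using \<Lambda> eps by (simp add: \<tau>_def)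
  define C where "C = \<Lambda> * (1 / \<tau> + 1) * K"
  show thesis
  proof (rule that[of C])
    fix w c assume w: "w \<in> W" and c: "C \<le> c"
    define m where "m = (\<Sum>v\<in>V. E w v *\<^sub>R v)"
    obtain n where wn: "w = m + n" and n: "n \<in> W" "E n n = 0"
      using dec[OF w] by (auto simp: m_def)
    have Bn: "B z n n = 0" if "z \<in> Z - I" for z
    proof -
      have "\<forall>z\<in>Z-I. B z n n = 0"
        using n(2) Z B unfolding E_def
        by (subst (asm) sum_nonneg_eq_0_iff) (auto intro: psd_form_nonneg)
      with that show ?thesis by blast
    qed
    have Eww: "E w w = (\<Sum>v\<in>V. (E w v)\<^sup>2)"
      using psd_form_add_null[OF E n(2), of m] orthonormal_wrt_norm[OF E V(2), of "E w"]
      by (simp add: wn[symmetric] m_def[symmetric])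
    \<comment> \<open>The null part n drops out of \<open>E w w\<close>, which is therefore the sum
      of the squared coefficients of m. Each coefficient is thus controlled by \<open>E w w\<close>,
      and K collects the entries of the forms on V.\<close>
    have mm: "(\<Sum>z\<in>I. B z m m) \<le> K * E w w"
    proof -
      have fV: "finite V" using V by (simp add: orthonormal_wrt_def)
      have ent: "E w u * E w v * B z u v \<le> \<bar>B z u v\<bar> * E w w" if "u \<in> V" "v \<in> V" for u v z
      proof -
        have sq: "(E w u)\<^sup>2 \<le> E w w" if "u \<in> V" for u
          unfolding Eww using that fV by (intro member_le_sum) auto
        have "\<bar>E w u * E w v\<bar> \<le> ((E w u)\<^sup>2 + (E w v)\<^sup>2) / 2"
          using sum_squares_bound[of "\<bar>E w u\<bar>" "\<bar>E w v\<bar>"] by (simp add: abs_mult)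
        also have "\<dots> \<le> E w w" using sq[OF that(1)] sq[OF that(2)] by simp
        finally have "\<bar>E w u * E w v\<bar> * \<bar>B z u v\<bar> \<le> E w w * \<bar>B z u v\<bar>"
          by (intro mult_right_mono) auto
        moreover have "E w u * E w v * B z u v \<le> \<bar>E w u * E w v\<bar> * \<bar>B z u v\<bar>"
          using abs_ge_self[of "E w u * E w v * B z u v"] by (simp only: abs_mult)
        ultimately show ?thesis by (simp add: mult.commute)
      qed
      have "(\<Sum>z\<in>I. B z m m) = (\<Sum>z\<in>I. \<Sum>u\<in>V. \<Sum>v\<in>V. E w u * E w v * B z u v)"
        unfolding m_def by (intro sum.cong refl bilinear_linear_combination psd_form_bilinear BI)
      also have "\<dots> \<le> (\<Sum>z\<in>I. \<Sum>u\<in>V. \<Sum>v\<in>V. \<bar>B z u v\<bar> * E w w)"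
        by (intro sum_mono ent)
      finally show ?thesis by (simp add: K_def sum_distrib_right)
    qed
    have summand: "l z * B z n n - \<Lambda> * (\<tau> * B z n n + (1/\<tau> + 1) * B z m m) \<le> l z * B z w w"
      if z: "z \<in> I" for z
    proof -
      have nn: "0 \<le> B z n n" "0 \<le> B z m m" using psd_form_nonneg BI[OF z] by blast+
      have "B z w w = B z n n + 2 * B z n m + B z m m"
        using psd_form_bilinear[OF BI[OF z]] psd_form_sym[OF BI[OF z], of m n]
        by (simp add: wn bilinear_simps)
      then have eq: "l z * B z w w = l z * B z n n + l z * (2 * B z n m + B z m m)"
        by (simp add: algebra_simps)
      have "\<bar>2 * B z n m + B z m m\<bar> \<le> \<tau> * B z n n + (1/\<tau> + 1) * B z m m"
        using psd_form_young[OF BI[OF z] \<tau>, of n m] nn by (simp add: algebra_simps)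
      then have "\<bar>l z\<bar> * \<bar>2 * B z n m + B z m m\<bar> \<le> \<Lambda> * (\<tau> * B z n n + (1/\<tau> + 1) * B z m m)"
        using \<Lambda>'[OF z] by (intro mult_mono) auto
      then have "\<bar>l z * (2 * B z n m + B z m m)\<bar> \<le> \<Lambda> * (\<tau> * B z n n + (1/\<tau> + 1) * B z m m)"
        by (simp only: abs_mult)
      then show ?thesis unfolding eq by linarith
    qed
    have "(\<Sum>z\<in>I. l z * B z n n) - \<epsilon> * (\<Sum>z\<in>I. B z n n) - \<Lambda> * (1/\<tau> + 1) * (\<Sum>z\<in>I. B z m m)
        = (\<Sum>z\<in>I. l z * B z n n - \<Lambda> * (\<tau> * B z n n + (1/\<tau> + 1) * B z m m))"
      using \<Lambda> by (simp add: \<tau>_def sum_subtractf sum.distrib sum_distrib_left algebra_simps)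
    also have "\<dots> \<le> (\<Sum>z\<in>I. l z * B z w w)" by (intro sum_mono summand)
    finally have "- (\<Lambda> * (1/\<tau> + 1) * (\<Sum>z\<in>I. B z m m)) \<le> (\<Sum>z\<in>I. l z * B z w w)"
      using Q[OF n(1) Bn] by linarith
    moreover have "\<Lambda> * (1/\<tau> + 1) * (\<Sum>z\<in>I. B z m m) \<le> C * E w w"
      unfolding C_def using mult_left_mono[OF mm, of "\<Lambda> * (1/\<tau> + 1)"] \<Lambda> \<tau> by (simp add: mult.assoc)
    moreover have "C * E w w \<le> c * E w w"
      using c psd_form_nonneg[OF E] by (intro mult_right_mono) auto
    ultimately show "0 \<le> (\<Sum>z\<in>I. l z * B z w w) + c * (\<Sum>z\<in>Z-I. B z w w)"
      unfolding E_def by linarith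
  qed
qed

subsection \<open>Sets with small lifts are few\<close>

definition quad :: "nat \<Rightarrow> (nat \<Rightarrow> nat \<Rightarrow> real) \<Rightarrow> (nat \<Rightarrow> real) \<Rightarrow> real" where
  "quad s M t = (\<Sum>a<s. \<Sum>b<s. M a b * t a * t b)"

lemma quad_pair:
  assumes "a < s" "b < s"
  shows "quad s M (\<lambda>i. of_bool (i = a) + y * of_bool (i = b)) =
    M a a + y * M a b + y * M b a + y\<^sup>2 * M b b"
proof -
  have *: "(\<Sum>j<s. g j * (of_bool (j = a) + y * of_bool (j = b))) = g a + y * g b" for g :: "nat \<Rightarrow> real"
  proof -
    have "(\<Sum>j<s. g j * (of_bool (j = a) + y * of_bool (j = b)))
        = (\<Sum>j<s. (if j = a then g j else 0) + (if j = b then y * g j else 0))"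
      by (intro sum.cong) (auto simp: distrib_left)
    then show ?thesis using assms by (simp add: sum.distrib sum.delta)
  qed
  let ?t = "\<lambda>i. of_bool (i = a) + y * of_bool (i = b) :: real"
  have "quad s M ?t = (\<Sum>i<s. (M i a + y * M i b) * ?t i)"
    unfolding quad_def
  proof (intro sum.cong refl)
    fix i
    have "(\<Sum>j<s. M i j * ?t i * ?t j) = ?t i * (\<Sum>j<s. M i j * ?t j)"
      by (simp add: sum_distrib_left mult_ac)
    then show "(\<Sum>j<s. M i j * ?t i * ?t j) = (M i a + y * M i b) * ?t i"
      unfolding * by (simp only: mult.commute)
  qed
  then show ?thesis unfolding * by (simp add: algebra_simps power2_eq_square)
qed

lemma quad_add: "quad s (\<lambda>a b. M a b + M' a b) t = quad s M t + quad s M' t"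
  by (simp add: quad_def sum.distrib algebra_simps)

lemma quad_sum: "quad s (\<lambda>a b. \<Sum>x\<in>X. c x * M x a b) t = (\<Sum>x\<in>X. c x * quad s (M x) t)"
proof (cases "finite X")
  case True
  then show ?thesis
  proof (induction X)
    case (insert x X)
    have "quad s (\<lambda>a b. c x * M x a b) t = c x * quad s (M x) t"
      by (simp add: quad_def sum_distrib_left mult.assoc)
    with insert show ?case by (simp add: quad_add)
  qed (simp add: quad_def)
qed (simp add: quad_def)

lemma quad_of_bool: "quad s (\<lambda>a b. of_bool (a = b)) t = (\<Sum>a<s. (t a)\<^sup>2)"
proof -
  have "(\<Sum>b<s. of_bool (a = b) * t a * t b) = (t a)\<^sup>2" if "a < s" for a
  proof -
    have "(\<Sum>b<s. of_bool (a = b) * t a * t b) = (\<Sum>b<s. if b = a then (t a)\<^sup>2 else 0)"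
      by (intro sum.cong) (auto simp: power2_eq_square)
    then show ?thesis using that by simp
  qed
  then show ?thesis by (simp add: quad_def)
qed

lemma quad_cong:
  assumes "\<And>a b. a < s \<Longrightarrow> b < s \<Longrightarrow> M a b = M' a b"
  shows "quad s M t = quad s M' t"
  using assms by (simp add: quad_def)

lemma quad_abs_le:
  assumes "\<And>a b. a < s \<Longrightarrow> b < s \<Longrightarrow> \<bar>M a b\<bar> \<le> e"
  shows "\<bar>quad s M t\<bar> \<le> e * s * (\<Sum>a<s. (t a)\<^sup>2)"
proof -
  have "\<bar>M a b * t a * t b\<bar> \<le> e / 2 * (t a)\<^sup>2 + e / 2 * (t b)\<^sup>2" if "a < s" "b < s" for a b
  proof -
    have "\<bar>M a b * t a * t b\<bar> = \<bar>M a b\<bar> * (\<bar>t a\<bar> * \<bar>t b\<bar>)" by (simp add: abs_mult)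
    also have "\<dots> \<le> e * (((t a)\<^sup>2 + (t b)\<^sup>2) / 2)"
      using sum_squares_bound[of "\<bar>t a\<bar>" "\<bar>t b\<bar>"] assms[OF that]
      by (intro mult_mono) auto
    finally show ?thesis by (simp add: algebra_simps)
  qed
  then have "\<bar>quad s M t\<bar> \<le> (\<Sum>a<s. \<Sum>b<s. e / 2 * (t a)\<^sup>2 + e / 2 * (t b)\<^sup>2)"
    unfolding quad_def by (intro order_trans[OF sum_abs] sum_mono) auto
  also have "\<dots> = e * s * (\<Sum>a<s. (t a)\<^sup>2)"
    by (simp add: sum.distrib sum_distrib_left sum_distrib_right[symmetric] algebra_simps)
  finally show ?thesis .
qed

text \<open>A normalised semidefinite lift of the cone over the indicator vectors of \<open>S\<close>. The property
  is conic and only concerns positive definite combinations, so that no closedness argument is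
  ever needed.\<close>

definition is_psd_lift :: "nat \<Rightarrow> nat set set \<Rightarrow> (nat set \<Rightarrow> nat \<Rightarrow> nat \<Rightarrow> real) \<Rightarrow> bool" where
  "is_psd_lift s S M \<longleftrightarrow>
     (\<forall>A\<in>S. \<forall>t. 0 \<le> quad s (M A) t) \<and>
     (\<forall>A\<in>S. \<forall>a<s. \<forall>b<s. M A a b = M A b a) \<and>
     (\<forall>a<s. \<forall>b<s. (\<Sum>A\<in>S. M A a b) = of_bool (a = b)) \<and>
     (\<forall>l e. e > 0 \<longrightarrow> (\<forall>t. e * (\<Sum>a<s. (t a)\<^sup>2) \<le> (\<Sum>A\<in>S. l A * quad s (M A) t)) \<longrightarrow>
        (\<exists>m. (\<forall>A\<in>S. 0 \<le> m A) \<and> sum m S = sum l S \<and>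
           (\<forall>j. (\<Sum>A\<in>S. of_bool (j \<in> A) * m A) = (\<Sum>A\<in>S. of_bool (j \<in> A) * l A))))"

lemma psd_lift_cone:
  assumes "is_psd_lift s S M" "e > 0"
    "\<And>t. e * (\<Sum>a<s. (t a)\<^sup>2) \<le> (\<Sum>A\<in>S. l A * quad s (M A) t)"
  obtains m where "\<And>A. A \<in> S \<Longrightarrow> 0 \<le> m A" "sum m S = sum l S"
    "\<And>j. (\<Sum>A\<in>S. of_bool (j \<in> A) * m A) = (\<Sum>A\<in>S. of_bool (j \<in> A) * l A)"
proof -
  have "\<exists>m. (\<forall>A\<in>S. 0 \<le> m A) \<and> sum m S = sum l S \<and>
           (\<forall>j. (\<Sum>A\<in>S. of_bool (j \<in> A) * m A) = (\<Sum>A\<in>S. of_bool (j \<in> A) * l A))"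
    using assms(1)[unfolded is_psd_lift_def, THEN conjunct2, THEN conjunct2, THEN conjunct2,
        THEN spec[of _ l], THEN spec[of _ e], THEN mp, OF assms(2), THEN mp] assms(3) by simp
  with that show thesis by blast
qed

text \<open>Semidefinite matrices summing to the identity have diagonal entries between 0 and 1, and
  testing the sum and the difference of two unit vectors bounds the other entries by the mean of two
  diagonal ones. Hence the tables to be rounded are bounded.\<close>

lemma psd_lift_entry:
  assumes "is_psd_lift s S M" "finite S" "A \<in> S" "a < s" "b < s"
  shows "\<bar>M A a b\<bar> \<le> 1"
proof -
  have nn: "0 \<le> quad s (M A') t" if "A' \<in> S" for A' t
    using assms(1) that by (simp add: is_psd_lift_def)
  have diag: "0 \<le> M A' a a" if "A' \<in> S" "a < s" for A' a
    using nn[OF that(1), of "\<lambda>i. of_bool (i = a) + 0 * of_bool (i = a)"]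
    unfolding quad_pair[OF that(2) that(2)] by simp
  have le1: "M A a a \<le> 1" if "a < s" for a
  proof -
    have "M A a a \<le> (\<Sum>A\<in>S. M A a a)"
      using assms(2,3) diag that by (intro member_le_sum) auto
    also have "\<dots> = 1" using assms(1) that by (simp add: is_psd_lift_def)
    finally show ?thesis .
  qed
  have "M A b a = M A a b" using assms by (simp add: is_psd_lift_def)
  then have "0 \<le> M A a a + 2 * y * M A a b + y\<^sup>2 * M A b b" for y
    using nn[OF assms(3), of "\<lambda>i. of_bool (i = a) + y * of_bool (i = b)"]
    unfolding quad_pair[OF assms(4,5)] by simp
  from this[of 1] this[of "-1"] le1[OF assms(4)] le1[OF assms(5)] show ?thesis by simp
qed

text \<open>For s = 0 the positivity condition holds for all weights, so the weights -1 would have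
  to have the same total as nonnegative ones.\<close>

lemma psd_lift_size_pos:
  assumes "is_psd_lift s S M" "finite S" "S \<noteq> {}"
  shows "s > 0"
proof (rule ccontr)
  assume "\<not> 0 < s"
  then have s: "s = 0" by simp
  show False
  proof (rule psd_lift_cone[OF assms(1), of 1 "\<lambda>_. - 1"])
    show "1 * (\<Sum>a<s. (t a)\<^sup>2) \<le> (\<Sum>A\<in>S. - 1 * quad s (M A) t)" for t :: "nat \<Rightarrow> real"
      by (simp add: s quad_def)
  next
    fix m :: "nat set \<Rightarrow> real"
    assume "\<And>A. A \<in> S \<Longrightarrow> 0 \<le> m A" "sum m S = (\<Sum>A\<in>S. - 1)"
    then have "0 \<le> - real (card S)" using sum_nonneg[of S m] by simp
    then show False using assms(2,3) by (simp add: card_gt_0_iff)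
  qed simp
qed

text \<open>An arbitrary rank factorisation may have huge factors. Functions that are orthonormal,
  or zero, have entries bounded by 1, and the coefficients, being inner products with them, are
  bounded by the rows. The zero functions fill the places of dependent rows, so that exactly
  \<open>card I\<close> functions occur.\<close>

lemma gram_schmidt_factorization:
  fixes z :: "'i \<Rightarrow> 'x \<Rightarrow> real"
  assumes "finite S" "finite I"
  shows "\<exists>f :: nat \<Rightarrow> 'x \<Rightarrow> real. (\<forall>k<card I. \<forall>x\<in>S. \<bar>f k x\<bar> \<le> 1) \<and>
     (\<forall>i\<in>I. \<forall>x\<in>S. z i x = (\<Sum>k<card I. (\<Sum>y\<in>S. z i y * f k y) * f k x))"
proof -
  define ip where "ip = (\<lambda>f g. \<Sum>x\<in>S. f x * g x :: real)"
  have ip_comm: "ip f g = ip g f" for f g by (simp add: ip_def mult.commute)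
  have ip_cong: "ip f g = ip f' g" if "\<And>x. x \<in> S \<Longrightarrow> f x = f' x" for f f' g
    using that by (simp add: ip_def)
  have ip_comb: "ip (\<lambda>x. \<Sum>k<D. c k * f k x) g = (\<Sum>k<D. c k * ip (f k) g)" for D :: nat and c f g
    unfolding ip_def sum_distrib_left sum_distrib_right
    by (subst sum.swap) (simp add: mult.assoc)
  have "\<exists>f :: nat \<Rightarrow> 'x \<Rightarrow> real.
     (\<forall>j<card I. \<forall>k<card I. j \<noteq> k \<longrightarrow> ip (f j) (f k) = 0) \<and>
     (\<forall>k<card I. ip (f k) (f k) = 1 \<or> (\<forall>x. f k x = 0)) \<and>
     (\<forall>i\<in>I. \<forall>x\<in>S. z i x = (\<Sum>k<card I. ip (z i) (f k) * f k x))"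
    using assms(2)
  proof (induction I)
    case (insert i I)
    from insert.IH obtain f :: "nat \<Rightarrow> 'x \<Rightarrow> real" where
      f: "(\<forall>j<card I. \<forall>k<card I. j \<noteq> k \<longrightarrow> ip (f j) (f k) = 0) \<and>
       (\<forall>k<card I. ip (f k) (f k) = 1 \<or> (\<forall>x. f k x = 0)) \<and>
       (\<forall>i\<in>I. \<forall>x\<in>S. z i x = (\<Sum>k<card I. ip (z i) (f k) * f k x))" ..
    have orth: "\<And>j k. \<lbrakk>j < card I; k < card I; j \<noteq> k\<rbrakk> \<Longrightarrow> ip (f j) (f k) = 0"
      and unit: "\<And>k. k < card I \<Longrightarrow> ip (f k) (f k) = 1 \<or> (\<forall>x. f k x = 0)"
      and rep: "\<And>i x. \<lbrakk>i \<in> I; x \<in> S\<rbrakk> \<Longrightarrow> z i x = (\<Sum>k<card I. ip (z i) (f k) * f k x)"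
      using f by blast+
    define D where "D = card I"
    define p where "p = (\<lambda>x. \<Sum>k<D. ip (z i) (f k) * f k x)"
    define h where "h = (\<lambda>x. z i x - p x)"
    have ip_h: "ip h g = ip (z i) g - ip p g" for g
      by (simp add: ip_def h_def algebra_simps sum_subtractf)
    have h_orth: "ip h (f k) = 0" if k: "k < D" for k
    proof -
      have "ip p (f k) = (\<Sum>j<D. if j = k then ip (z i) (f k) * ip (f k) (f k) else 0)"
        unfolding p_def ip_comb using orth k by (intro sum.cong) (auto simp: D_def)
      also have "\<dots> = ip (z i) (f k)"
        using unit[of k] k by (auto simp: D_def ip_def)
      finally show ?thesis by (simp add: ip_h)
    qed
    have ph: "ip p h = 0"
      unfolding p_def ip_comb using h_orth by (simp add: ip_comm)
    have zh: "ip (z i) h = ip h h" using ph by (simp add: ip_h)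
    have hh: "ip h h \<ge> 0" by (simp add: ip_def sum_nonneg)
    \<comment> \<open>If h has norm zero, division by \<open>sqrt 0 = 0\<close> yields 0, so that e
      is the zero function permitted in place of a unit one.\<close>
    define e where "e = (\<lambda>x. h x / sqrt (ip h h))"
    have ip_e: "ip g e = ip g h / sqrt (ip h h)" for g
      by (simp add: e_def ip_def sum_divide_distrib)
    have e_unit: "ip e e = 1 \<or> (\<forall>x. e x = 0)"
    proof (cases "ip h h = 0")
      case False
      have "ip e e = ip h h / sqrt (ip h h) / sqrt (ip h h)" by (simp only: ip_e ip_comm[of e h])
      then show ?thesis using hh False by simp
    qed (simp add: e_def)
    have e_rep: "h x = ip (z i) e * e x" if "x \<in> S" for x
    proof (cases "ip h h = 0")
      case True
      then have "\<forall>x\<in>S. h x * h x = 0"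
        unfolding ip_def using assms(1) by (subst (asm) sum_nonneg_eq_0_iff) auto
      with True that show ?thesis by (simp add: e_def)
    next
      case False
      have "ip (z i) e = ip h h / sqrt (ip h h)" by (simp only: ip_e zh)
      then show ?thesis using hh False by (simp only:) (simp add: e_def)
    qed
    have e_orth: "ip (f k) e = 0" "ip e (f k) = 0" if "k < D" for k
    proof -
      show "ip (f k) e = 0" using h_orth[OF that] by (simp only: ip_e ip_comm[of "f k" h])
      then show "ip e (f k) = 0" by (simp only: ip_comm[of e "f k"])
    qed
    have z_orth: "ip (z i') e = 0" if "i' \<in> I" for i'
    proof -
      have "ip (z i') e = ip (\<lambda>x. \<Sum>k<D. ip (z i') (f k) * f k x) e"
        using rep[OF that] by (intro ip_cong) (simp add: D_def)
      then show ?thesis unfolding ip_comb using e_orth by simp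
    qed
    define f' where "f' = (\<lambda>k. if k < D then f k else e)"
    have f': "f' D = e" "\<And>k. k < D \<Longrightarrow> f' k = f k" by (auto simp: f'_def)
    have "card (insert i I) = Suc D" using insert by (simp add: D_def)
    moreover have "(\<Sum>k<D. ip g (f' k) * f' k x) = (\<Sum>k<D. ip g (f k) * f k x)" for g x
      by (simp add: f'_def)
    moreover have "z i x = (\<Sum>k<D. ip (z i) (f k) * f k x) + ip (z i) e * e x" if "x \<in> S" for x
      using e_rep[OF that] by (simp add: h_def p_def)
    ultimately have rep': "\<forall>i'\<in>insert i I. \<forall>x\<in>S. z i' x = (\<Sum>k<card (insert i I). ip (z i') (f' k) * f' k x)"
      using rep z_orth by (auto simp: f' D_def[symmetric])
    have orth': "\<forall>j<Suc D. \<forall>k<Suc D. j \<noteq> k \<longrightarrow> ip (f' j) (f' k) = 0"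
      using orth e_orth by (auto simp: f' less_Suc_eq D_def[symmetric])
    have unit': "\<forall>k<Suc D. ip (f' k) (f' k) = 1 \<or> (\<forall>x. f' k x = 0)"
      using unit e_unit by (auto simp: f' less_Suc_eq D_def[symmetric])
    show ?case
      using orth' unit' rep' \<open>card (insert i I) = Suc D\<close> by (intro exI[of _ f']) simp
  qed simp
  then obtain f :: "nat \<Rightarrow> 'x \<Rightarrow> real" where
      f: "(\<forall>j<card I. \<forall>k<card I. j \<noteq> k \<longrightarrow> ip (f j) (f k) = 0) \<and>
       (\<forall>k<card I. ip (f k) (f k) = 1 \<or> (\<forall>x. f k x = 0)) \<and>
       (\<forall>i\<in>I. \<forall>x\<in>S. z i x = (\<Sum>k<card I. ip (z i) (f k) * f k x))" ..
  have unit: "\<And>k. k < card I \<Longrightarrow> ip (f k) (f k) = 1 \<or> (\<forall>x. f k x = 0)"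
    and rep: "\<And>i x. \<lbrakk>i \<in> I; x \<in> S\<rbrakk> \<Longrightarrow> z i x = (\<Sum>k<card I. ip (z i) (f k) * f k x)"
    using f by blast+
  have "\<bar>f k x\<bar> \<le> 1" if "k < card I" "x \<in> S" for k x
  proof -
    have "(f k x)\<^sup>2 \<le> ip (f k) (f k)"
      unfolding ip_def power2_eq_square using assms(1) that(2) by (intro member_le_sum) auto
    also have "\<dots> \<le> 1" using unit[OF that(1)] by (auto simp: ip_def)
    finally show ?thesis using abs_square_le_1 by blast
  qed
  moreover have "\<forall>i\<in>I. \<forall>x\<in>S. z i x = (\<Sum>k<card I. (\<Sum>y\<in>S. z i y * f k y) * f k x)"
    using rep unfolding ip_def by blast
  ultimately show ?thesis by blast
qed

section \<open>Rounding a lift to a bounded integer table\<close>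

type_synonym row_index = "nat option + nat \<times> nat"

definition row_indices :: "nat \<Rightarrow> nat \<Rightarrow> row_index set" where
  "row_indices k s = Inl ` insert None (Some ` {..<k}) \<union> Inr ` ({..<s} \<times> {..<s})"

definition lift_row :: "(nat set \<Rightarrow> nat \<Rightarrow> nat \<Rightarrow> real) \<Rightarrow> row_index \<Rightarrow> nat set \<Rightarrow> real" where
  "lift_row M i A = (case i of Inl None \<Rightarrow> 1 | Inl (Some j) \<Rightarrow> of_bool (j \<in> A) | Inr (a, b) \<Rightarrow> M A a b)"

lemma finite_row_indices: "finite (row_indices k s)"
  by (simp add: row_indices_def)

lemma card_row_indices: "card (row_indices k s) = Suc k + s * s"
proof -
  have "card (row_indices k s) = card (Inl ` insert None (Some ` {..<k}) :: row_index set)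
      + card (Inr ` ({..<s} \<times> {..<s}) :: row_index set)"
    unfolding row_indices_def by (intro card_Un_disjoint) auto
  then show ?thesis by (simp add: card_image card_insert_if inj_on_def image_iff)
qed

text \<open>The table \<open>g / K\<close> stands for the rounded Gram-Schmidt coefficients of the rows, which are the
  constant 1, the coordinates and the entries of the lift. A tolerance \<open>\<delta>\<close> below the distance
  between 0/1 points (scaled by the number of members) makes decoding exact.\<close>

definition decode :: "nat \<Rightarrow> nat \<Rightarrow> nat \<Rightarrow> real \<Rightarrow> (row_index \<times> nat \<Rightarrow> int) \<Rightarrow> nat set set" where
  "decode k s K \<delta> g = {A. A \<subseteq> {..<k} \<and>
     (\<exists>c. (\<forall>q<Suc k + s * s. \<bar>c q\<bar> \<le> 1) \<and>
       (let v = (\<lambda>i. \<Sum>q<Suc k + s * s. of_int (g (i, q)) / K * c q) in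
         \<bar>v (Inl None) - 1\<bar> \<le> \<delta> \<and>
         (\<forall>j<k. \<bar>v (Inl (Some j)) - of_bool (j \<in> A)\<bar> \<le> \<delta>) \<and>
         (\<forall>t. - \<delta> * (\<Sum>a<s. (t a)\<^sup>2) \<le> quad s (\<lambda>a b. v (Inr (a, b))) t)))}"

text \<open>The weights l are signed; the cone property trades them for nonnegative ones with the
  same mass and moments. If these nearly agree with those of C, little mass lies on members that
  differ from C in any given coordinate. If C were not a member, every member would differ from it
  somewhere, so the total mass would be small, although it is close to 1.\<close>

lemma psd_lift_separates:
  assumes M: "is_psd_lift s S M" and S: "S \<subseteq> Pow {..<k}" and C: "C \<subseteq> {..<k}"
    and \<delta>: "\<delta> = 1 / (9 * (real k + 1) * 2 ^ k)"
    and l1: "\<bar>sum l S - 1\<bar> \<le> 2 * \<delta>"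
    and lj: "\<And>j. j < k \<Longrightarrow> \<bar>(\<Sum>A\<in>S. of_bool (j \<in> A) * l A) - of_bool (j \<in> C)\<bar> \<le> 2 * \<delta>"
    and lq: "\<And>t. - 2 * \<delta> * (\<Sum>a<s. (t a)\<^sup>2) \<le> (\<Sum>A\<in>S. l A * quad s (M A) t)"
  shows "C \<in> S"
proof (rule ccontr)
  assume nC: "C \<notin> S"
  have finS: "finite S" using S finite_subset by blast
  have N: "real (card S) \<le> 2 ^ k"
  proof -
    have "card S \<le> 2 ^ k" using card_mono[OF _ S] by (simp add: card_Pow)
    then show ?thesis by (metis of_nat_le_iff of_nat_numeral of_nat_power)
  qed
  have \<delta>0: "\<delta> > 0" by (simp add: \<delta>)
  \<comment> \<open>The matrices sum to the identity, so this shift adds 3 \<delta> to the form and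
    turns the lower bound -2 \<delta> into \<delta>, as the cone property requires. Mass and moments
    grow by at most 3 \<delta> per member.\<close>
  define l' where "l' = (\<lambda>A. l A + 3 * \<delta>)"
  have id: "(\<Sum>A\<in>S. quad s (M A) t) = (\<Sum>a<s. (t a)\<^sup>2)" for t
  proof -
    have "(\<Sum>A\<in>S. quad s (M A) t) = quad s (\<lambda>a b. \<Sum>A\<in>S. M A a b) t"
      using quad_sum[of s "\<lambda>_. 1" M S t] by simp
    also have "\<dots> = quad s (\<lambda>a b. of_bool (a = b)) t"
      using M by (intro quad_cong) (simp add: is_psd_lift_def)
    finally show ?thesis by (simp add: quad_of_bool)
  qed
  have "\<delta> * (\<Sum>a<s. (t a)\<^sup>2) \<le> (\<Sum>A\<in>S. l' A * quad s (M A) t)" for t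
    using lq[of t] by (simp add: l'_def algebra_simps sum.distrib sum_distrib_left[symmetric] id)
  from psd_lift_cone[OF M \<delta>0 this]
  obtain m where m0: "\<And>A. A \<in> S \<Longrightarrow> 0 \<le> m A" and m1: "sum m S = sum l' S"
    and mj: "\<And>j. (\<Sum>A\<in>S. of_bool (j \<in> A) * m A) = (\<Sum>A\<in>S. of_bool (j \<in> A) * l' A)"
    by blast
  have l'1: "sum l' S = sum l S + 3 * \<delta> * card S"
    by (simp add: l'_def sum.distrib)
  have l'j: "(\<Sum>A\<in>S. of_bool (j \<in> A) * l' A) =
      (\<Sum>A\<in>S. of_bool (j \<in> A) * l A) + 3 * \<delta> * (\<Sum>A\<in>S. of_bool (j \<in> A))" for j
    by (simp add: l'_def distrib_left sum.distrib sum_distrib_left mult.commute)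
  have Nj: "0 \<le> (\<Sum>A\<in>S. of_bool (j \<in> A) :: real)" "(\<Sum>A\<in>S. of_bool (j \<in> A) :: real) \<le> card S" for j
    using sum_mono[of S "\<lambda>A. of_bool (j \<in> A) :: real" "\<lambda>_. 1"] by (auto intro: sum_nonneg)
  \<comment> \<open>For j in C the members that differ are those without j, whose weight is the mass
    minus the j-th moment, and both tolerances of 2 \<delta> enter. Otherwise it is the j-th moment
    itself.\<close>
  have T: "(\<Sum>A\<in>S. of_bool ((j \<in> A) \<noteq> (j \<in> C)) * m A) \<le> 4 * \<delta> + 3 * \<delta> * card S" if j: "j < k" for j
  proof (cases "j \<in> C")
    case True
    then have "(\<Sum>A\<in>S. of_bool ((j \<in> A) \<noteq> (j \<in> C)) * m A) = sum m S - (\<Sum>A\<in>S. of_bool (j \<in> A) * m A)"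
      by (auto simp: sum_subtractf[symmetric] intro!: sum.cong)
    moreover have "0 \<le> \<delta> * (\<Sum>A\<in>S. of_bool (j \<in> A))" using \<delta>0 Nj by simp
    ultimately show ?thesis
      using lj[OF j] l1 True unfolding m1 mj l'1 l'j by (simp add: abs_le_iff)
  next
    case False
    then have "(\<Sum>A\<in>S. of_bool ((j \<in> A) \<noteq> (j \<in> C)) * m A) = (\<Sum>A\<in>S. of_bool (j \<in> A) * m A)"
      by simp
    moreover have "\<delta> * (\<Sum>A\<in>S. of_bool (j \<in> A)) \<le> \<delta> * card S"
      using \<delta>0 Nj by (intro mult_left_mono) auto
    moreover have "(\<Sum>A\<in>S. of_bool (j \<in> A) * l A) \<le> 2 * \<delta>"
      using lj[OF j] False by (simp add: abs_le_iff)
    ultimately show ?thesis using \<delta>0 unfolding mj l'j by linarith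
  qed
  have "1 - 2 * \<delta> \<le> sum m S"
  proof -
    have "0 \<le> \<delta> * card S" using \<delta>0 by simp
    then show ?thesis using l1 unfolding m1 l'1 abs_le_iff by linarith
  qed
  also have "\<dots> \<le> (\<Sum>A\<in>S. \<Sum>j<k. of_bool ((j \<in> A) \<noteq> (j \<in> C)) * m A)"
  proof (rule sum_mono)
    fix A assume A: "A \<in> S"
    then have "A \<noteq> C" using nC by blast
    then obtain j where j: "(j \<in> A) \<noteq> (j \<in> C)" by blast
    with A S C have "j < k" by auto
    have "of_bool ((j \<in> A) \<noteq> (j \<in> C)) * m A \<le> (\<Sum>j<k. of_bool ((j \<in> A) \<noteq> (j \<in> C)) * m A)"
      using \<open>j < k\<close> m0[OF A]
      by (intro member_le_sum[of j "{..<k}" "\<lambda>j. of_bool ((j \<in> A) \<noteq> (j \<in> C)) * m A"]) auto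
    then show "m A \<le> (\<Sum>j<k. of_bool ((j \<in> A) \<noteq> (j \<in> C)) * m A)" using j by simp
  qed
  also have "\<dots> = (\<Sum>j<k. \<Sum>A\<in>S. of_bool ((j \<in> A) \<noteq> (j \<in> C)) * m A)" by (rule sum.swap)
  also have "\<dots> \<le> (\<Sum>j<k. 4 * \<delta> + 3 * \<delta> * card S)" by (intro sum_mono T) simp
  also have "\<dots> = \<delta> * (k * (4 + 3 * card S))" by (simp add: algebra_simps)
  finally have "1 \<le> \<delta> * (k * (4 + 3 * card S) + 2)" by (simp add: algebra_simps)
  \<comment> \<open>With at most 2^k members, 4 + 3 \<open>card S\<close> is at most 7 * 2^k; the 9
    in \<delta> is 7 + 2.\<close>
  also have "\<dots> \<le> \<delta> * (k * (7 * 2 ^ k) + 2 * 2 ^ k)"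
  proof -
    have "(1::real) \<le> 2 ^ k" by simp
    then have "4 + 3 * real (card S) \<le> 7 * 2 ^ k" using N by linarith
    then have "real k * (4 + 3 * real (card S)) \<le> real k * (7 * 2 ^ k)" by (intro mult_left_mono) auto
    with \<open>1 \<le> 2 ^ k\<close> have "real k * (4 + 3 * real (card S)) + 2 \<le> real k * (7 * 2 ^ k) + 2 * 2 ^ k"
      by linarith
    with \<delta>0 show ?thesis by (intro mult_left_mono) auto
  qed
  also have "\<dots> < \<delta> * (9 * (real k + 1) * 2 ^ k)"
    using \<delta>0 by (intro mult_strict_left_mono) (auto simp: algebra_simps add_pos_nonneg)
  also have "\<dots> = 1" by (simp add: \<delta>)
  finally show False by simp
qed

text \<open>An exchange of summation. A vector c applied to the coefficients acts on the rows like
  the weights \<open>\<Sum>q<D. c q * f q A\<close> on the members of S; this is how the vector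
  found in \<open>decode\<close> is interpreted.\<close>

lemma lift_row_sum_combination:
  assumes "\<And>i A. \<lbrakk>i \<in> I; A \<in> S\<rbrakk> \<Longrightarrow> z i A = (\<Sum>q<D. G i q * f q A)" "i \<in> I"
    "\<And>i q. G i q = (\<Sum>A\<in>S. z i A * f q A)"
  shows "(\<Sum>q<(D::nat). G i q * c q) = (\<Sum>A\<in>S. z i A * (\<Sum>q<D. c q * (f q A :: real)))"
  unfolding sum_distrib_left assms(3) sum_distrib_right
  by (subst sum.swap) (simp add: mult_ac)

text \<open>Rounding to multiples of 1 / K moves a combination with coefficients in [-1, 1] by at
  most D / K in each row, and thereby the quadratic form by at most s D / K times the squared
  length. The factor D (s + 1) in K brings both below the tolerance. The range of the table comes
  from the bound \<open>card S\<close>, at most 2^k, on the coefficients.\<close>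

lemma psd_lift_decode:
  assumes M: "is_psd_lift s S M" and S: "S \<subseteq> Pow {..<k}"
  defines "D \<equiv> Suc k + s * s"
  defines "K \<equiv> D * (s + 1) * (9 * (k + 1) * 2 ^ k)"
  shows "\<exists>g \<in> row_indices k s \<times> {..<D} \<rightarrow>\<^sub>E {- int (K * 2 ^ k)..int (K * 2 ^ k)}.
    decode k s K (1 / (9 * (real k + 1) * 2 ^ k)) g = S"
proof -
  let ?\<delta> = "1 / (9 * (real k + 1) * 2 ^ k) :: real"
  let ?I = "row_indices k s"
  have finS: "finite S" using S finite_subset by blast
  have N: "card S \<le> 2 ^ k"
    using card_mono[OF _ S] by (simp add: card_Pow)
  have cardI: "card ?I = D" by (simp add: card_row_indices D_def)
  obtain f where f1: "\<And>q A. \<lbrakk>q < D; A \<in> S\<rbrakk> \<Longrightarrow> \<bar>f q A\<bar> \<le> 1"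
    and f: "\<And>i A. \<lbrakk>i \<in> ?I; A \<in> S\<rbrakk> \<Longrightarrow>
      lift_row M i A = (\<Sum>q<D. (\<Sum>y\<in>S. lift_row M i y * f q y) * f q A)"
    using gram_schmidt_factorization[OF finS finite_row_indices[of k s], of "lift_row M"]
    unfolding cardI by blast
  define G where "G = (\<lambda>i q. \<Sum>A\<in>S. lift_row M i A * f q A)"
  have row1: "\<bar>lift_row M i A\<bar> \<le> 1" if "i \<in> ?I" "A \<in> S" for i A
    using that psd_lift_entry[OF M finS] by (auto simp: row_indices_def lift_row_def)
  have G1: "\<bar>G i q\<bar> \<le> 2 ^ k" if "i \<in> ?I" "q < D" for i q
  proof -
    have "\<bar>G i q\<bar> \<le> (\<Sum>A\<in>S. 1)"
      unfolding G_def using row1[OF that(1)] f1[OF that(2)]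
      by (intro order_trans[OF sum_abs] sum_mono) (auto simp: abs_mult intro: mult_le_one)
    also have "\<dots> \<le> 2 ^ k"
      using of_nat_le_iff[where 'a = real, THEN iffD2, OF N] by simp
    finally show ?thesis .
  qed
  have K0: "K > 0" by (simp add: K_def D_def)
  define g where "g = (\<lambda>(i, q) \<in> ?I \<times> {..<D}. \<lfloor>K * G i q\<rfloor>)"
  have g: "g (i, q) = \<lfloor>K * G i q\<rfloor>" if "i \<in> ?I" "q < D" for i q
    using that by (simp add: g_def)
  have "g \<in> ?I \<times> {..<D} \<rightarrow>\<^sub>E {- int (K * 2 ^ k)..int (K * 2 ^ k)}"
  proof -
    have "\<lfloor>K * G i q\<rfloor> \<in> {- int (K * 2 ^ k)..int (K * 2 ^ k)}" if "i \<in> ?I" "q < D" for i q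
    proof -
      have "\<bar>K * G i q\<bar> \<le> real K * 2 ^ k"
        using G1[OF that] by (simp add: abs_mult mult_left_mono)
      then have "- real_of_int (int (K * 2 ^ k)) \<le> K * G i q" "K * G i q \<le> real_of_int (int (K * 2 ^ k))"
        by (auto simp: abs_le_iff)
      then show ?thesis by (simp add: le_floor_iff floor_le_iff)
    qed
    then show ?thesis by (auto simp: g_def)
  qed
  moreover have "decode k s K ?\<delta> g = S"
  proof -
    have round: "\<bar>of_int (g (i, q)) / K - G i q\<bar> \<le> 1 / K" if "i \<in> ?I" "q < D" for i q
    proof -
      have "\<bar>of_int (g (i, q)) - K * G i q\<bar> \<le> 1" unfolding g[OF that] by linarith
      then have "\<bar>of_int (g (i, q)) - K * G i q\<bar> / K \<le> 1 / K" using K0 by (intro divide_right_mono) auto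
      moreover have "\<bar>of_int (g (i, q)) - K * G i q\<bar> / K = \<bar>of_int (g (i, q)) / K - G i q\<bar>"
        using K0 by (simp add: abs_div_pos diff_divide_distrib)
      ultimately show ?thesis by simp
    qed
    have DK: "real D / K * (s + 1) = ?\<delta>"
    proof -
      have "real K = real D * (real s + 1) * (9 * (real k + 1) * 2 ^ k)" by (simp add: K_def algebra_simps)
      moreover have "real D > 0" by (simp add: D_def del: of_nat_add of_nat_Suc)
      ultimately show ?thesis by (simp add: add.commute)
    qed
    have DK': "real D / K \<le> ?\<delta>" "real D / K * s \<le> ?\<delta>"
      unfolding DK[symmetric] by (auto simp: distrib_left intro!: divide_right_mono)
    have err: "\<bar>(\<Sum>q<D. of_int (g (i, q)) / K * c q) - (\<Sum>A\<in>S. lift_row M i A * (\<Sum>q<D. c q * f q A))\<bar> \<le> real D / K"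
      if c: "\<forall>q<D. \<bar>c q\<bar> \<le> 1" and i: "i \<in> ?I" for c i
    proof -
      have "(\<Sum>q<D. of_int (g (i, q)) / K * c q) - (\<Sum>A\<in>S. lift_row M i A * (\<Sum>q<D. c q * f q A))
          = (\<Sum>q<D. (of_int (g (i, q)) / K - G i q) * c q)"
        using lift_row_sum_combination[of ?I S "lift_row M" G f D i c] f i
        by (simp add: G_def algebra_simps sum_subtractf)
      also have "\<bar>\<dots>\<bar> \<le> (\<Sum>q<D. 1 / K * 1)"
        using round[OF i] c
        by (intro order_trans[OF sum_abs] sum_mono) (auto simp only: abs_mult lessThan_iff abs_ge_zero
              intro!: mult_mono divide_nonneg_nonneg of_nat_0_le_iff zero_le_one)
      finally show ?thesis by simp
    qed
    have qerr: "\<bar>quad s (\<lambda>a b. \<Sum>q<D. of_int (g (Inr (a, b), q)) / K * c q) t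
        - (\<Sum>A\<in>S. (\<Sum>q<D. c q * f q A) * quad s (M A) t)\<bar> \<le> ?\<delta> * (\<Sum>a<s. (t a)\<^sup>2)"
      if c: "\<forall>q<D. \<bar>c q\<bar> \<le> 1" for c t
    proof -
      let ?v = "\<lambda>a b. \<Sum>q<D. of_int (g (Inr (a, b), q)) / K * c q"
      let ?w = "\<lambda>a b. \<Sum>A\<in>S. (\<Sum>q<D. c q * f q A) * M A a b"
      have "quad s ?v t = quad s (\<lambda>a b. ?w a b + (?v a b - ?w a b)) t" by (intro quad_cong) simp
      then have "quad s ?v t - quad s ?w t = quad s (\<lambda>a b. ?v a b - ?w a b) t" unfolding quad_add by simp
      also have "\<bar>\<dots>\<bar> \<le> real D / K * s * (\<Sum>a<s. (t a)\<^sup>2)"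
      proof (rule quad_abs_le)
        fix a b assume "a < s" "b < s"
        then show "\<bar>?v a b - ?w a b\<bar> \<le> real D / K"
          using err[of c "Inr (a, b)"] c by (simp add: lift_row_def row_indices_def mult.commute)
      qed
      also have "\<dots> \<le> ?\<delta> * (\<Sum>a<s. (t a)\<^sup>2)"
        using DK' by (intro mult_right_mono sum_nonneg) auto
      finally show ?thesis by (simp add: quad_sum)
    qed
    show ?thesis
    proof (intro equalityI subsetI)
      fix C assume "C \<in> decode k s K ?\<delta> g"
      then obtain c where C: "C \<subseteq> {..<k}" and c: "\<forall>q<D. \<bar>c q\<bar> \<le> 1"
        and c1: "\<bar>(\<Sum>q<D. of_int (g (Inl None, q)) / K * c q) - 1\<bar> \<le> ?\<delta>"
        and cj: "\<And>j. j < k \<Longrightarrow> \<bar>(\<Sum>q<D. of_int (g (Inl (Some j), q)) / K * c q) - of_bool (j \<in> C)\<bar> \<le> ?\<delta>"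
        and cq: "\<And>t. - ?\<delta> * (\<Sum>a<s. (t a)\<^sup>2) \<le> quad s (\<lambda>a b. \<Sum>q<D. of_int (g (Inr (a, b), q)) / K * c q) t"
        unfolding decode_def Let_def D_def[symmetric] by blast
      \<comment> \<open>The weights on S induced by c. The tolerance of \<open>decode\<close> and
        the rounding error add up to the 2 \<delta> accepted by
        \<open>psd_lift_separates\<close>.\<close>
      define l where "l = (\<lambda>A. \<Sum>q<D. c q * f q A)"
      show "C \<in> S"
      proof (rule psd_lift_separates[OF M S C refl])
        show "\<bar>sum l S - 1\<bar> \<le> 2 * ?\<delta>"
        proof -
          have "\<bar>(\<Sum>q<D. of_int (g (Inl None, q)) / K * c q) - sum l S\<bar> \<le> real D / K"
            using err[OF c, of "Inl None"] by (simp add: lift_row_def row_indices_def l_def)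
          then show ?thesis using c1 DK'(1) by linarith
        qed
        show "\<bar>(\<Sum>A\<in>S. of_bool (j \<in> A) * l A) - of_bool (j \<in> C)\<bar> \<le> 2 * ?\<delta>" if "j < k" for j
        proof -
          have "\<bar>(\<Sum>q<D. of_int (g (Inl (Some j), q)) / K * c q) - (\<Sum>A\<in>S. of_bool (j \<in> A) * l A)\<bar> \<le> real D / K"
            using err[OF c, of "Inl (Some j)"] that by (simp add: lift_row_def row_indices_def l_def)
          then show ?thesis using cj[OF that] DK'(1) by linarith
        qed
        show "- 2 * ?\<delta> * (\<Sum>a<s. (t a)\<^sup>2) \<le> (\<Sum>A\<in>S. l A * quad s (M A) t)" for t
          
        proof -
          have "\<bar>quad s (\<lambda>a b. \<Sum>q<D. of_int (g (Inr (a, b), q)) / K * c q) t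
              - (\<Sum>A\<in>S. l A * quad s (M A) t)\<bar> \<le> ?\<delta> * (\<Sum>a<s. (t a)\<^sup>2)"
            unfolding l_def using c by (intro qerr) auto
          then show ?thesis using cq[of t] by linarith
        qed
      qed
    next
      fix C assume C: "C \<in> S"
      \<comment> \<open>The column of the factorisation at C: applied to the unrounded coefficients
        it returns the exact column of C in every row.\<close>
      define c where "c = (\<lambda>q. f q C)"
      have c: "\<forall>q<D. \<bar>c q\<bar> \<le> 1" using f1[OF _ C] by (simp add: c_def)
      have exact: "(\<Sum>A\<in>S. lift_row M i A * (\<Sum>q<D. c q * f q A)) = lift_row M i C" if "i \<in> ?I" for i
        using lift_row_sum_combination[of ?I S "lift_row M" G f D i c] f[OF that C] f that
        by (simp add: G_def c_def)
      have v: "\<bar>(\<Sum>q<D. of_int (g (i, q)) / K * c q) - lift_row M i C\<bar> \<le> ?\<delta>" if "i \<in> ?I" for i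
        using err[OF c that] DK'(1) unfolding exact[OF that] by linarith
      have "(\<Sum>A\<in>S. (\<Sum>q<D. c q * f q A) * quad s (M A) t) = quad s (M C) t" for t
        unfolding quad_sum[symmetric]
      proof (rule quad_cong)
        fix a b assume "a < s" "b < s"
        then show "(\<Sum>A\<in>S. (\<Sum>q<D. c q * f q A) * M A a b) = M C a b"
          using exact[of "Inr (a, b)"] by (simp add: lift_row_def row_indices_def mult.commute)
      qed
      then have "- ?\<delta> * (\<Sum>a<s. (t a)\<^sup>2) \<le> quad s (\<lambda>a b. \<Sum>q<D. of_int (g (Inr (a, b), q)) / K * c q) t" for t
      proof -
        have "0 \<le> quad s (M C) t" using M C by (simp add: is_psd_lift_def)
        with qerr[OF c, of t] \<open>\<And>t. (\<Sum>A\<in>S. (\<Sum>q<D. c q * f q A) * quad s (M A) t) = quad s (M C) t\<close>[of t]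
        show ?thesis by linarith
      qed
      moreover have "\<bar>(\<Sum>q<D. of_int (g (Inl None, q)) / K * c q) - 1\<bar> \<le> ?\<delta>"
        using v[of "Inl None"] by (simp add: lift_row_def row_indices_def)
      moreover have "\<bar>(\<Sum>q<D. of_int (g (Inl (Some j), q)) / K * c q) - of_bool (j \<in> C)\<bar> \<le> ?\<delta>" if "j < k" for j
        using v[of "Inl (Some j)"] that by (simp add: lift_row_def row_indices_def)
      ultimately show "C \<in> decode k s K ?\<delta> g"
        using C S c unfolding decode_def Let_def D_def[symmetric] by blast
    qed
  qed
  ultimately show ?thesis by blast
qed

section \<open>Counting: a family without small lifts and with an isolated nonmember\<close>

definition flip :: "nat \<Rightarrow> nat set \<Rightarrow> nat set" where
  "flip j A = (if j \<in> A then A - {j} else insert j A)"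

lemma odd_card_flip: "finite A \<Longrightarrow> odd (card (flip j A)) \<longleftrightarrow> even (card A)"
  by (cases "j \<in> A") (auto simp: flip_def card_gt_0_iff dest: card_gt_0_iff[THEN iffD2, of A])

definition odd_sets :: "nat \<Rightarrow> nat set set" where
  "odd_sets k = {A. A \<subseteq> {..<k} \<and> odd (card A)}"

lemma even_sets_family:
  obtains \<E> where "\<And>C. C \<in> \<E> \<Longrightarrow> C \<subseteq> {..<Suc k} \<and> even (card C)" "finite \<E>" "card \<E> = 2 ^ k"
proof -
  \<comment> \<open>The element k repairs the parity, so that arbitrary subsets of the first k
    elements yield distinct even sets.\<close>
  define ev where "ev = (\<lambda>B. if even (card B) then B else insert k B)"
  have "inj_on ev (Pow {..<k})"
  proof (rule inj_onI)
    fix A B assume "A \<in> Pow {..<k}" "B \<in> Pow {..<k}" "ev A = ev B"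
    moreover have "ev X - {k} = X" if "X \<in> Pow {..<k}" for X using that by (auto simp: ev_def)
    ultimately show "A = B" by metis
  qed
  then have "card (ev ` Pow {..<k}) = 2 ^ k" by (simp add: card_image card_Pow)
  moreover have "C \<subseteq> {..<Suc k} \<and> even (card C)" if C: "C \<in> ev ` Pow {..<k}" for C
  proof -
    obtain A where A: "A \<subseteq> {..<k}" "C = ev A" using C by (metis (no_types) PowD imageE)
    moreover have "finite A" "k \<notin> A" using A finite_subset by auto
    ultimately show ?thesis by (auto simp: ev_def less_Suc_eq)
  qed
  ultimately show thesis using that[of "ev ` Pow {..<k}"] by blast
qed

text \<open>Under \<open>small\<close> an entry takes at most 2^(7 (k + 1)) values and D^2 is at
  most 4 (k + 1)^2 s^4, so the tables need at most 28 (k + 1)^3 s^4 bits, that is at most 0.56 *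
  2^(k-1). The constant 100 leaves room for k + 1 further bits: k for the choice of the size s and
  one for a strict inequality.\<close>

lemma table_count_bound:
  fixes k s :: nat
  assumes s: "s \<ge> 1" and small: "s ^ 4 * (100 * (k + 1) ^ 3) \<le> 2 ^ k"
  defines "D \<equiv> Suc k + s * s"
  defines "K \<equiv> D * (s + 1) * (9 * (k + 1) * 2 ^ k)"
  shows "(2 * (K * 2 ^ k) + 1) ^ (D * D) \<le> 2 ^ (2 ^ (k - 1) - k - 1)"
    and "k + 1 < 2 ^ (k - 1)"
proof -
  have s4: "s ^ 4 \<ge> 1" using s by simp
  have k0: "k > 0" using small s4 by (cases k) auto
  have pk: "k + 1 \<le> 2 ^ k" using less_exp[of k] by linarith
  have s2: "s * s \<ge> 1" using s by simp
  have D: "D \<le> 2 * (k + 1) * (s * s)"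
  proof -
    have "(k + 1) * 1 \<le> (k + 1) * (s * s)" using s2 by (rule mult_le_mono2)
    moreover have "1 * (s * s) \<le> (k + 1) * (s * s)" by (rule mult_le_mono1) simp
    ultimately show ?thesis by (simp add: D_def algebra_simps)
  qed
  have s3: "s ^ 3 \<le> 2 ^ k"
  proof -
    have "s ^ 3 * 1 \<le> s ^ 3 * (s * (100 * (k + 1) ^ 3))" using s by (intro mult_le_mono2) simp
    also have "\<dots> = s ^ 4 * (100 * (k + 1) ^ 3)"
      by (simp only: power3_eq_cube[of s] power4_eq_xxxx mult.assoc)
    finally show ?thesis using small by linarith
  qed
  have "K * 2 ^ k > 0" by (simp add: K_def D_def del: add_Suc)
  then have "2 * (K * 2 ^ k) + 1 \<le> 3 * (K * 2 ^ k)" by linarith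
  also have "\<dots> = 27 * (D * (s + 1)) * (k + 1) * 2 ^ k * 2 ^ k" by (simp add: K_def algebra_simps)
  also have "\<dots> \<le> 27 * (2 * (k + 1) * (s * s) * (2 * s)) * (k + 1) * 2 ^ k * 2 ^ k"
    using D s by (intro mult_le_mono) auto
  also have "\<dots> = 108 * (s ^ 3) * (k + 1) * (k + 1) * 2 ^ k * 2 ^ k"
    by (simp add: power3_eq_cube algebra_simps)
  also have "\<dots> \<le> 2 ^ 7 * 2 ^ k * 2 ^ k * 2 ^ k * 2 ^ k * 2 ^ k"
    using s3 pk by (intro mult_le_mono) auto
  also have "\<dots> = 2 ^ (7 + 5 * k)"
    by (simp only: power_add[symmetric] add.assoc) (simp add: numeral_eq_Suc)
  also have "\<dots> \<le> 2 ^ (7 * (k + 1))" by (intro power_increasing) auto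
  finally have base: "2 * (K * 2 ^ k) + 1 \<le> 2 ^ (7 * (k + 1))" .
  define x :: nat where "x = 2 ^ (k - 1)"
  have two: "2 ^ k = 2 * x" using k0 by (cases k) (auto simp: x_def)
  have DD: "D * D \<le> 4 * (k + 1)\<^sup>2 * s ^ 4"
    using mult_le_mono[OF D D] by (simp add: power2_eq_square power4_eq_xxxx algebra_simps)
  have "100 * (7 * (k + 1) * (D * D)) \<le> 100 * (7 * (k + 1) * (4 * (k + 1)\<^sup>2 * s ^ 4))"
    using DD by (intro mult_le_mono2) auto
  also have "\<dots> = 28 * (s ^ 4 * (100 * (k + 1) ^ 3))"
    by (simp add: power2_eq_square power3_eq_cube algebra_simps)
  also have "\<dots> \<le> 28 * 2 ^ k" using small by simp
  finally have e1: "100 * (7 * (k + 1) * (D * D)) \<le> 28 * 2 ^ k" .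
  have "1 * (100 * (k + 1)) \<le> s ^ 4 * (100 * (k + 1) ^ 3)"
    using s4 by (intro mult_le_mono) (auto simp: self_le_power)
  then have e2: "100 * (k + 1) \<le> 2 ^ k" using small by linarith
  show "k + 1 < 2 ^ (k - 1)" using e2 unfolding two x_def[symmetric] by presburger
  have "7 * (k + 1) * (D * D) \<le> 2 ^ (k - 1) - k - 1"
  proof -
    have "y \<le> x - k - 1" if "100 * y \<le> 28 * (2 * x)" for y
    proof -
      have "100 * (y + (k + 1)) \<le> 100 * x"
        using that e2[unfolded two] by (simp add: distrib_left)
      then have "y + (k + 1) \<le> x" by (simp only: mult_le_cancel1)
      then show ?thesis by simp
    qed
    from this[OF e1[unfolded two]] show ?thesis by (simp only: x_def)
  qed
  then have "(2::nat) ^ (7 * (k + 1) * (D * D)) \<le> 2 ^ (2 ^ (k - 1) - k - 1)"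
    by (intro power_increasing) auto
  moreover have "(2 * (K * 2 ^ k) + 1) ^ (D * D) \<le> (2 ^ (7 * (k + 1))) ^ (D * D)"
    using base by (rule power_mono) simp
  ultimately show "(2 * (K * 2 ^ k) + 1) ^ (D * D) \<le> 2 ^ (2 ^ (k - 1) - k - 1)"
    by (simp add: power_mult)
qed

text \<open>Each such family is decoded from some table, and \<open>decode\<close> refers to neither
  the family nor its lift, so counting tables suffices.\<close>

lemma card_psd_lift_sets:
  fixes k s :: nat
  defines "D \<equiv> Suc k + s * s"
  defines "K \<equiv> D * (s + 1) * (9 * (k + 1) * 2 ^ k)"
  shows "card {S. S \<subseteq> Pow {..<k} \<and> (\<exists>M. is_psd_lift s S M)} \<le> (2 * (K * 2 ^ k) + 1) ^ (D * D)"
proof -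
  let ?T = "row_indices k s \<times> {..<D} \<rightarrow>\<^sub>E {- int (K * 2 ^ k)..int (K * 2 ^ k)}"
  have fin: "finite ?T" by (intro finite_PiE) (auto simp: finite_row_indices)
  have "{S. S \<subseteq> Pow {..<k} \<and> (\<exists>M. is_psd_lift s S M)}
      \<subseteq> decode k s K (1 / (9 * (real k + 1) * 2 ^ k)) ` ?T"
  proof
    fix S assume "S \<in> {S. S \<subseteq> Pow {..<k} \<and> (\<exists>M. is_psd_lift s S M)}"
    then obtain M where "is_psd_lift s S M" "S \<subseteq> Pow {..<k}" by blast
    from psd_lift_decode[OF this] obtain g where g: "g \<in> ?T"
      and dec: "decode k s K (1 / (9 * (real k + 1) * 2 ^ k)) g = S"
      unfolding K_def D_def by (elim bexE)
    show "S \<in> decode k s K (1 / (9 * (real k + 1) * 2 ^ k)) ` ?T"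
      by (subst dec[symmetric]) (rule imageI[OF g])
  qed
  then have "card {S. S \<subseteq> Pow {..<k} \<and> (\<exists>M. is_psd_lift s S M)} \<le> card ?T"
    using fin by (meson card_image_le card_mono finite_imageI order_trans)
  also have "\<dots> = nat (2 * int (K * 2 ^ k) + 1) ^ (D * D)"
    by (simp add: card_PiE finite_row_indices card_cartesian_product card_row_indices D_def)
  also have "nat (2 * int (K * 2 ^ k) + 1) = 2 * (K * 2 ^ k) + 1" by linarith
  finally show ?thesis .
qed

text \<open>For positive k the candidates contain all odd sets and omit at least one even set C;
  every neighbour of C is odd and hence a member. Leaving out only the family of all even sets costs
  a single candidate, and the rest still outnumber all tables of all small sizes.\<close>

lemma exists_hard_set:
  obtains S where "S \<subseteq> Pow {..<k}"
    "k > 0 \<Longrightarrow> \<exists>C. C \<subseteq> {..<k} \<and> C \<notin> S \<and> (\<forall>j<k. flip j C \<in> S)"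
    "\<And>s M. is_psd_lift s S M \<Longrightarrow> 2 ^ k < s ^ 4 * (100 * (k + 1) ^ 3)"
proof (cases k)
  case 0
  have "s > 0" if "is_psd_lift s {{}} M" for s M
    using psd_lift_size_pos[OF that] by simp
  then have "2 ^ k < s ^ 4 * (100 * (k + 1) ^ 3)" if "is_psd_lift s {{}} M" for s M
  proof -
    have "1 \<le> s ^ 4" using \<open>\<And>s M. is_psd_lift s {{}} M \<Longrightarrow> s > 0\<close>[OF that] by (simp add: Suc_le_eq)
    then show ?thesis using 0 by simp
  qed
  with 0 show thesis by (intro that[of "{{}}"]) auto
next
  case (Suc k')
  obtain \<E> where \<E>: "\<And>C. C \<in> \<E> \<Longrightarrow> C \<subseteq> {..<k} \<and> even (card C)" "finite \<E>" "card \<E> = 2 ^ k'"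
    using even_sets_family[of k'] Suc by metis
  define cand where "cand = (\<lambda>T. odd_sets k \<union> T) ` (Pow \<E> - {\<E>})"
  have "inj_on (\<lambda>T. odd_sets k \<union> T) (Pow \<E> - {\<E>})"
  proof (rule inj_onI)
    fix T T' assume "T \<in> Pow \<E> - {\<E>}" "T' \<in> Pow \<E> - {\<E>}" "odd_sets k \<union> T = odd_sets k \<union> T'"
    moreover have "(odd_sets k \<union> T) - odd_sets k = T" "(odd_sets k \<union> T') - odd_sets k = T'"
      using calculation \<E>(1) by (auto simp: odd_sets_def)
    ultimately show "T = T'" by metis
  qed
  then have card_cand: "card cand = 2 ^ (2 ^ k') - 1"
    using \<E> by (simp add: cand_def card_image card_Pow)
  have fin_cand: "finite cand" using \<E> by (simp add: cand_def)
  \<comment> \<open>The union bound treats each small size separately. There are at most 2^k of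
    them, which the \<open>- k\<close> in the exponent of \<open>table_count_bound\<close>
    absorbs.\<close>
  define R where "R = {s. 1 \<le> s \<and> s ^ 4 * (100 * (k + 1) ^ 3) \<le> 2 ^ k}"
  define bad where "bad = (\<lambda>s. {S. S \<subseteq> Pow {..<k} \<and> (\<exists>M. is_psd_lift s S M)})"
  have fin_bad: "finite (bad s)" for s by (simp add: bad_def)
  have R: "R \<subseteq> {1..2 ^ k}"
  proof
    fix s assume s: "s \<in> R"
    have "s * 1 \<le> s * (s ^ 3 * (100 * (k + 1) ^ 3))"
      using s by (intro mult_le_mono2) (simp add: R_def)
    also have "\<dots> = s ^ 4 * (100 * (k + 1) ^ 3)" by (simp add: power3_eq_cube power4_eq_xxxx mult.assoc)
    finally show "s \<in> {1..2 ^ k}" using s by (simp add: R_def)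
  qed
  have "\<exists>S\<in>cand. \<forall>s\<in>R. S \<notin> bad s"
  proof (cases "R = {}")
    case True
    have "(2::nat) ^ 1 \<le> 2 ^ (2 ^ k')" by (intro power_increasing) auto
    then have "cand \<noteq> {}" using card_cand fin_cand by (metis card.empty diff_is_0_eq not_less_eq_eq numeral_2_eq_2 One_nat_def power_one_right)
    with True show ?thesis by blast
  next
    case False
    let ?e = "2 ^ k' - k - 1 :: nat"
    have b: "card (bad s) \<le> 2 ^ ?e" if "s \<in> R" for s
      using that order_trans[OF card_psd_lift_sets[of k s] table_count_bound(1)[of s k]]
      by (simp add: R_def bad_def Suc)
    have k: "k + 1 < 2 ^ k'"
      using False table_count_bound(2)[of _ k] Suc by (auto simp: R_def)
    have "card (\<Union>s\<in>R. bad s) \<le> (\<Sum>s\<in>R. card (bad s))"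
      using R finite_subset by (intro card_UN_le) blast
    also have "\<dots> \<le> (\<Sum>s\<in>R. 2 ^ ?e)" by (intro sum_mono b)
    also have "\<dots> = card R * 2 ^ ?e" by simp
    also have "\<dots> \<le> 2 ^ k * 2 ^ ?e" using card_mono[OF _ R] by (intro mult_le_mono1) simp
    also have "\<dots> = 2 ^ (2 ^ k' - 1)" using k by (simp add: power_add[symmetric])
    also have "\<dots> < 2 ^ (2 ^ k') - 1"
    proof -
      obtain x where "2 ^ k' = Suc (Suc x)" using k by (metis Suc_eq_plus1 add_gr_0 less_imp_Suc_add zero_less_Suc add_Suc_right Suc_less_eq)
      moreover have "(1::nat) \<le> 2 ^ x" by simp
      moreover have "2 * y < 4 * y - 1" if "1 \<le> y" for y :: nat using that by linarith
      ultimately show ?thesis by simp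
    qed
    finally have lt: "card (\<Union>s\<in>R. bad s) < card cand" using card_cand by simp
    have "\<not> cand \<subseteq> (\<Union>s\<in>R. bad s)"
    proof
      assume "cand \<subseteq> (\<Union>s\<in>R. bad s)"
      moreover have "finite (\<Union>s\<in>R. bad s)" using R fin_bad finite_subset by blast
      ultimately show False using lt card_mono leD by blast
    qed
    then show ?thesis by blast
  qed
  then obtain S where S: "S \<in> cand" "\<And>s. s \<in> R \<Longrightarrow> S \<notin> bad s" by blast
  then obtain T where T: "T \<subset> \<E>" "S = odd_sets k \<union> T" by (auto simp: cand_def)
  then obtain C where C: "C \<in> \<E>" "C \<notin> T" by blast
  have sub: "S \<subseteq> Pow {..<k}" using T \<E>(1) by (auto simp: odd_sets_def)
  have flipC: "\<forall>j<k. flip j C \<in> S"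
  proof (intro allI impI)
    fix j assume "j < k"
    then have "flip j C \<subseteq> {..<k}" using \<E>(1)[OF C(1)] by (auto simp: flip_def)
    moreover have "finite C" using \<E>(1)[OF C(1)] finite_subset by blast
    then have "odd (card (flip j C))" using \<E>(1)[OF C(1)] by (simp add: odd_card_flip)
    ultimately
    show "flip j C \<in> S" using T by (simp add: odd_sets_def)
  qed
  have "C \<notin> S" using T C \<E>(1)[OF C(1)] by (simp add: odd_sets_def)
  have ne: "S \<noteq> {}" using flipC Suc by auto
  show thesis
  proof (rule that[OF sub])
    show "\<exists>C. C \<subseteq> {..<k} \<and> C \<notin> S \<and> (\<forall>j<k. flip j C \<in> S)"
      using flipC \<open>C \<notin> S\<close> \<E>(1)[OF C(1)] by blast
    fix s M assume M: "is_psd_lift s S M"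
    have "s > 0" using psd_lift_size_pos[OF M] sub ne finite_subset by blast
    moreover have "s \<notin> R" using S(2) M sub by (auto simp: bad_def)
    ultimately show "2 ^ k < s ^ 4 * (100 * (k + 1) ^ 3)" by (simp add: R_def)
  qed
qed

subsection \<open>Semidefinite extensions of joins\<close>

text \<open>The vectors of norm zero of a semidefinite form are those orthogonal to everything,
  hence closed under addition.\<close>

lemma psd_form_null_space:
  assumes B: "\<And>z. z \<in> Z \<Longrightarrow> psd_form (B z)" and W: "subspace W"
  shows "subspace {w \<in> W. \<forall>z\<in>Z. B z w w = 0}"
proof (rule subspaceI)
  show "0 \<in> {w \<in> W. \<forall>z\<in>Z. B z w w = 0}"
    using W B by (auto simp: subspace_0 bilinear_lzero psd_form_bilinear)
  show "x + y \<in> {w \<in> W. \<forall>z\<in>Z. B z w w = 0}"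
    if "x \<in> {w \<in> W. \<forall>z\<in>Z. B z w w = 0}" "y \<in> {w \<in> W. \<forall>z\<in>Z. B z w w = 0}" for x y
    using that W B by (auto simp: subspace_add psd_form_add_null)
  show "c *\<^sub>R x \<in> {w \<in> W. \<forall>z\<in>Z. B z w w = 0}"
    if "x \<in> {w \<in> W. \<forall>z\<in>Z. B z w w = 0}" for c x
    using that W B by (auto simp: subspace_scale bilinear_lmul bilinear_rmul psd_form_bilinear)
qed

text \<open>\<open>V i\<close> is a maximal orthonormal set among the vectors on which all forms
  outside block i vanish. Every form lies outside at least one of two disjoint blocks, so it
  vanishes on one of the two sets and pairs them to zero. Hence the union of the sets is orthonormal
  for T and is bounded by r as a whole.\<close>

lemma block_bases:
  fixes B :: "'z \<Rightarrow> 'v::real_vector \<Rightarrow> 'v \<Rightarrow> real" and I :: "nat \<Rightarrow> 'z set"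
  assumes Z: "finite Z" and B: "\<And>z. z \<in> Z \<Longrightarrow> psd_form (B z)" and W: "subspace W"
    and r: "\<And>B V. \<lbrakk>psd_form B; V \<subseteq> W; orthonormal_wrt B V\<rbrakk> \<Longrightarrow> card V \<le> r"
    and I: "\<And>i. i < p \<Longrightarrow> I i \<subseteq> Z" "\<And>i j. \<lbrakk>i < p; j < p; i \<noteq> j\<rbrakk> \<Longrightarrow> I i \<inter> I j = {}"
  defines "T \<equiv> \<lambda>u v. \<Sum>z\<in>Z. B z u v"
  obtains V where "\<And>i. i < p \<Longrightarrow> V i \<subseteq> W" "\<And>i. i < p \<Longrightarrow> orthonormal_wrt T (V i)"
    "\<And>i v z. \<lbrakk>i < p; v \<in> V i; z \<in> Z - I i\<rbrakk> \<Longrightarrow> B z v v = 0"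
    "\<And>i w. \<lbrakk>i < p; w \<in> W; \<And>z. z \<in> Z - I i \<Longrightarrow> B z w w = 0\<rbrakk> \<Longrightarrow>
       \<exists>n. w = (\<Sum>v\<in>V i. T w v *\<^sub>R v) + n \<and> T n n = 0"
    "(\<Sum>i<p. card (V i)) \<le> r"
proof -
  have T: "psd_form T" unfolding T_def using B by (rule psd_form_sum)
  define N where "N = (\<lambda>i. {w \<in> W. \<forall>z\<in>Z - I i. B z w w = 0})"
  have N: "subspace (N i)" for i unfolding N_def using B W by (intro psd_form_null_space) auto
  have "\<exists>V. V \<subseteq> N i \<and> orthonormal_wrt T V \<and>
      (\<forall>w\<in>N i. \<exists>n. w = (\<Sum>v\<in>V. T w v *\<^sub>R v) + n \<and> T n n = 0)" for i
  proof -
    have "card V \<le> r" if "V \<subseteq> N i" "orthonormal_wrt T V" for V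
      using r[OF T _ that(2)] that(1) by (auto simp: N_def)
    then show ?thesis
    proof (rule maximal_orthonormal[OF T N])
      fix V assume "V \<subseteq> N i" "orthonormal_wrt T V"
        "\<And>w. w \<in> N i \<Longrightarrow> \<exists>n. w = (\<Sum>v\<in>V. T w v *\<^sub>R v) + n \<and> n \<in> N i \<and> T n n = 0"
      then show ?thesis by (intro exI[of _ V]) blast
    qed
  qed
  then obtain V where V': "\<forall>i. V i \<subseteq> N i \<and> orthonormal_wrt T (V i) \<and>
      (\<forall>w\<in>N i. \<exists>n. w = (\<Sum>v\<in>V i. T w v *\<^sub>R v) + n \<and> T n n = 0)"
    using choice[of "\<lambda>i V. V \<subseteq> N i \<and> orthonormal_wrt T V \<and>
      (\<forall>w\<in>N i. \<exists>n. w = (\<Sum>v\<in>V. T w v *\<^sub>R v) + n \<and> T n n = 0)"] by blast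
  have V: "\<And>i. V i \<subseteq> N i" "\<And>i. orthonormal_wrt T (V i)"
    "\<And>i w. w \<in> N i \<Longrightarrow> \<exists>n. w = (\<Sum>v\<in>V i. T w v *\<^sub>R v) + n \<and> T n n = 0"
    using V' by blast+
  have null: "B z v v = 0" if "v \<in> V i" "z \<in> Z - I i" for i v z
    using V(1)[of i] that by (auto simp: N_def)
  have cross: "T u v = 0" if "i < p" "j < p" "i \<noteq> j" "u \<in> V i" "v \<in> V j" for i j u v
    unfolding T_def
  proof (rule sum.neutral, rule ballI)
    fix z assume z: "z \<in> Z"
    show "B z u v = 0"
    proof (cases "z \<in> I i")
      case True
      then have "z \<in> Z - I j" using I(2)[OF that(1-3)] z by blast
      then have "B z v u = 0" using null[OF that(5), of z] psd_form_null[OF B[OF z]] by blast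
      then show ?thesis using psd_form_sym[OF B[OF z], of u v] by simp
    next
      case False
      then show ?thesis using null[OF that(4), of z] z psd_form_null[OF B[OF z]] by blast
    qed
  qed
  have disj: "V i \<inter> V j = {}" if "i < p" "j < p" "i \<noteq> j" for i j
  proof -
    have False if v: "v \<in> V i" "v \<in> V j" for v
    proof -
      have "T v v = 1" using V(2)[of i] v(1) unfolding orthonormal_wrt_def by simp
      then show False using cross[OF \<open>i < p\<close> \<open>j < p\<close> \<open>i \<noteq> j\<close> v] by simp
    qed
    then show ?thesis by blast
  qed
  have "orthonormal_wrt T (\<Union>i<p. V i)"
    unfolding orthonormal_wrt_def
  proof (intro conjI ballI)
    show "finite (\<Union>i<p. V i)" using V(2) by (auto simp: orthonormal_wrt_def)
    fix u v assume "u \<in> (\<Union>i<p. V i)" "v \<in> (\<Union>i<p. V i)"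
    then obtain i j where ij: "i < p" "j < p" "u \<in> V i" "v \<in> V j" by auto
    show "T u v = of_bool (u = v)"
    proof (cases "i = j")
      case True
      then show ?thesis using V(2)[of i] ij by (auto simp: orthonormal_wrt_def)
    next
      case False
      then have "u \<noteq> v" using disj[OF ij(1,2)] ij by auto
      then show ?thesis using cross[OF ij(1,2) False ij(3,4)] by simp
    qed
  qed
  moreover have "(\<Union>i<p. V i) \<subseteq> W" using V(1) by (auto simp: N_def)
  ultimately have "card (\<Union>i<p. V i) \<le> r" using r[OF T] by blast
  moreover have "card (\<Union>i<p. V i) = (\<Sum>i<p. card (V i))"
    using V(2) disj by (intro card_UN_disjoint) (auto simp: orthonormal_wrt_def)
  ultimately have "(\<Sum>i<p. card (V i)) \<le> r" by simp
  moreover have "V i \<subseteq> W" for i using V(1)[of i] by (auto simp: N_def)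
  ultimately show thesis using V(2,3) null by (intro that) (auto simp: N_def)
qed

text \<open>The Finsler variant yields a constant c such that weight c on each index outside the
  block makes the combination semidefinite on all of W. Once normalised to total weight 1 it falls
  under \<open>ext\<close>, and scaling back gives nonnegative weights for the same vector.\<close>

lemma block_cone:
  fixes B :: "'z \<Rightarrow> 'v::real_vector \<Rightarrow> 'v \<Rightarrow> real" and pt :: "'z \<Rightarrow> 'b::real_vector"
  assumes Z: "finite Z" and B: "\<And>z. z \<in> Z \<Longrightarrow> psd_form (B z)" and W: "subspace W"
    and r: "\<And>B V. \<lbrakk>psd_form B; V \<subseteq> W; orthonormal_wrt B V\<rbrakk> \<Longrightarrow> card V \<le> r"
    and I: "I \<subseteq> Z" "Z - I \<noteq> {}"
    and ext: "\<And>\<nu>. \<lbrakk>sum \<nu> Z = 1; \<And>w. w \<in> W \<Longrightarrow> 0 \<le> (\<Sum>z\<in>Z. \<nu> z * B z w w)\<rbrakk> \<Longrightarrow>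
       \<exists>\<kappa>. (\<forall>z\<in>Z. 0 \<le> \<kappa> z) \<and> (\<Sum>z\<in>Z. \<kappa> z *\<^sub>R pt z) = (\<Sum>z\<in>Z. \<nu> z *\<^sub>R pt z)"
    and V: "orthonormal_wrt (\<lambda>u v. \<Sum>z\<in>Z. B z u v) V"
      "\<And>w. \<lbrakk>w \<in> W; \<And>z. z \<in> Z - I \<Longrightarrow> B z w w = 0\<rbrakk> \<Longrightarrow>
         \<exists>n. w = (\<Sum>v\<in>V. (\<Sum>z\<in>Z. B z w v) *\<^sub>R v) + n \<and> (\<Sum>z\<in>Z. B z n n) = 0"
    and eps: "\<epsilon> > 0"
    and pos: "\<And>t. \<epsilon> * (\<Sum>v\<in>V. (t v)\<^sup>2) \<le>
       (\<Sum>z\<in>I. l z * B z (\<Sum>v\<in>V. t v *\<^sub>R v) (\<Sum>v\<in>V. t v *\<^sub>R v))"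
  shows "\<exists>m c. (\<forall>z\<in>Z. 0 \<le> m z) \<and>
     (\<Sum>z\<in>Z. m z *\<^sub>R pt z) = (\<Sum>z\<in>Z. (if z \<in> I then l z else c) *\<^sub>R pt z)"
proof -
  define T where "T = (\<lambda>u v. \<Sum>z\<in>Z. B z u v)"
  have T: "psd_form T" unfolding T_def using B by (rule psd_form_sum)
  have Bnull: "B z n n = 0" if "T n n = 0" "z \<in> Z" for z n
  proof -
    have "\<forall>z\<in>Z. B z n n = 0"
      using that(1) Z B unfolding T_def
      by (subst (asm) sum_nonneg_eq_0_iff) (auto intro: psd_form_nonneg)
    with that(2) show ?thesis by blast
  qed
  \<comment> \<open>Where the other forms vanish, the forms of the block sum to T, and
    \<open>T w w\<close> is the sum of the squared coordinates along V. So \<open>pos\<close>, a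
    statement about coordinates, becomes one about forms.\<close>
  have Q: "\<epsilon> * (\<Sum>z\<in>I. B z w w) \<le> (\<Sum>z\<in>I. l z * B z w w)"
    if w: "w \<in> W" "\<And>z. z \<in> Z - I \<Longrightarrow> B z w w = 0" for w
  proof -
    define m where "m = (\<Sum>v\<in>V. T w v *\<^sub>R v)"
    obtain n where n: "w = m + n" "T n n = 0"
      using V(2)[OF w] by (auto simp: T_def m_def)
    have Bm: "B z w w = B z m m" if "z \<in> Z" for z
      unfolding n(1) using psd_form_add_null[OF B[OF that] Bnull[OF n(2) that]] .
    have "(\<Sum>z\<in>I. B z w w) = T w w"
      unfolding T_def using Z I w(2) by (intro sum.mono_neutral_left) auto
    also have "\<dots> = T m m" unfolding n(1) by (rule psd_form_add_null[OF T n(2)])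
    also have "\<dots> = (\<Sum>v\<in>V. (T w v)\<^sup>2)"
      unfolding m_def by (rule orthonormal_wrt_norm[OF T V(1)[folded T_def]])
    finally have "\<epsilon> * (\<Sum>z\<in>I. B z w w) \<le> (\<Sum>z\<in>I. l z * B z m m)"
      using pos[of "T w"] by (simp add: m_def)
    also have "\<dots> = (\<Sum>z\<in>I. l z * B z w w)" using Bm I by (intro sum.cong) auto
    finally show ?thesis .
  qed
  have r': "card V \<le> r" if "V \<subseteq> W" "orthonormal_wrt (\<lambda>u v. \<Sum>z\<in>Z - I. B z u v) V" for V
    using that B by (intro r[OF psd_form_sum]) auto
  obtain C where C: "\<And>w c. \<lbrakk>w \<in> W; c \<ge> C\<rbrakk> \<Longrightarrow>
     0 \<le> (\<Sum>z\<in>I. l z * B z w w) + c * (\<Sum>z\<in>Z-I. B z w w)"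
    using weighted_form_bounded_below[OF Z I(1) B W r' eps Q] by blast
  \<comment> \<open>At least C for semidefiniteness, and larger than the absolute value of
    \<open>sum l I\<close>, so that a single index outside I already makes the total weight
    positive.\<close>
  define c where "c = \<bar>C\<bar> + \<bar>sum l I\<bar> + 1"
  define \<nu> where "\<nu> = (\<lambda>z. if z \<in> I then l z else c)"
  have split: "(\<Sum>z\<in>Z. \<nu> z * f z) = (\<Sum>z\<in>I. l z * f z) + c * (\<Sum>z\<in>Z-I. f z)" for f
  proof -
    have "(\<Sum>z\<in>Z. \<nu> z * f z) = (\<Sum>z\<in>Z-I. \<nu> z * f z) + (\<Sum>z\<in>I. \<nu> z * f z)"
      by (rule sum.subset_diff[OF I(1) Z])
    moreover have "(\<Sum>z\<in>Z-I. \<nu> z * f z) = c * (\<Sum>z\<in>Z-I. f z)"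
      unfolding sum_distrib_left by (intro sum.cong) (auto simp: \<nu>_def)
    ultimately show ?thesis by (simp add: \<nu>_def)
  qed
  define t where "t = sum \<nu> Z"
  have "card (Z - I) \<ge> 1" using I Z by (metis One_nat_def Suc_leI card_gt_0_iff finite_Diff)
  then have "c * 1 \<le> c * real (card (Z - I))" by (intro mult_left_mono) (auto simp: c_def)
  moreover have "t = sum l I + c * card (Z - I)" using split[of "\<lambda>_. 1"] by (simp add: t_def)
  ultimately have t: "t > 0" by (simp add: c_def)
  have "\<exists>\<kappa>. (\<forall>z\<in>Z. 0 \<le> \<kappa> z) \<and> (\<Sum>z\<in>Z. \<kappa> z *\<^sub>R pt z) = (\<Sum>z\<in>Z. (\<nu> z / t) *\<^sub>R pt z)"
  proof (rule ext)
    show "(\<Sum>z\<in>Z. \<nu> z / t) = 1" using t by (simp add: t_def[symmetric] sum_divide_distrib[symmetric])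
    fix w assume "w \<in> W"
    then have "0 \<le> (\<Sum>z\<in>Z. \<nu> z * B z w w) / t"
      unfolding split using C[of w c] t by (simp add: c_def)
    then show "0 \<le> (\<Sum>z\<in>Z. \<nu> z / t * B z w w)" by (simp add: sum_divide_distrib)
  qed
  then obtain \<kappa> where \<kappa>: "\<forall>z\<in>Z. 0 \<le> \<kappa> z"
    "(\<Sum>z\<in>Z. \<kappa> z *\<^sub>R pt z) = (\<Sum>z\<in>Z. (\<nu> z / t) *\<^sub>R pt z)" by blast
  have "(\<Sum>z\<in>Z. (t * \<kappa> z) *\<^sub>R pt z) = t *\<^sub>R (\<Sum>z\<in>Z. \<kappa> z *\<^sub>R pt z)"
    by (simp add: scaleR_sum_right)
  also have "\<dots> = (\<Sum>z\<in>Z. \<nu> z *\<^sub>R pt z)"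
    unfolding \<kappa>(2) using t by (simp add: scaleR_sum_right)
  finally have "(\<Sum>z\<in>Z. (t * \<kappa> z) *\<^sub>R pt z) = (\<Sum>z\<in>Z. (if z \<in> I then l z else c) *\<^sub>R pt z)"
    by (simp add: \<nu>_def)
  then show ?thesis using \<kappa>(1) t by (intro exI[of _ "\<lambda>z. t * \<kappa> z"] exI[of _ c]) auto
qed

section \<open>From matrices and linear systems to forms on the finitely supported functions\<close>

lemma lookup_scaleR [simp]: "Poly_Mapping.lookup (c *\<^sub>R x) i = c * Poly_Mapping.lookup (x :: 'a \<Rightarrow>\<^sub>0 real) i"
proof -
  have "finite {i. c * Poly_Mapping.lookup x i \<noteq> 0}"
    by (rule finite_subset[OF _ finite_lookup[of x]]) auto
  then show ?thesis by (simp add: scaleR_poly_mapping_def)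
qed

lemma lookup_sum_scaleR:
  "Poly_Mapping.lookup (\<Sum>z\<in>Z. c z *\<^sub>R f z) i = (\<Sum>z\<in>Z. c z * Poly_Mapping.lookup (f z :: 'a \<Rightarrow>\<^sub>0 real) i)"
  by (simp add: lookup_sum)

lemma Rspace_iff: "x \<in> Rspace d \<longleftrightarrow> (\<forall>i\<ge>d. Poly_Mapping.lookup x i = 0)"
  by (auto simp: Rspace_def in_keys_iff subset_iff) (meson leD leI)+

lemma subspace_Rspace: "subspace (Rspace d)"
  by (rule subspaceI) (auto simp: Rspace_iff lookup_add)

definition vec_of_fun :: "nat \<Rightarrow> (nat \<Rightarrow> real) \<Rightarrow> nat \<Rightarrow>\<^sub>0 real" where
  "vec_of_fun r f = (\<Sum>i<r. f i *\<^sub>R Poly_Mapping.single i 1)"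

lemma lookup_vec_of_fun: "Poly_Mapping.lookup (vec_of_fun r f) i = (if i < r then f i else 0)"
proof -
  have "Poly_Mapping.lookup (vec_of_fun r f) i = (\<Sum>j<r. if j = i then f i else 0)"
    unfolding vec_of_fun_def lookup_sum_scaleR by (intro sum.cong) (auto simp: lookup_single when_def)
  then show ?thesis by simp
qed

lemma vec_of_fun_in_Rspace: "vec_of_fun r f \<in> Rspace r"
  by (simp add: Rspace_iff lookup_vec_of_fun)

lemma orthonormal_card_le:
  assumes "psd_form B" "V \<subseteq> Rspace r" "orthonormal_wrt B V"
  shows "card V \<le> r"
proof -
  let ?b = "\<lambda>i::nat. Poly_Mapping.single i (1::real)"
  have "w \<in> span (?b ` {..<r})" if "w \<in> Rspace r" for w
  proof -
    have "w = vec_of_fun r (Poly_Mapping.lookup w)"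
      using that by (intro poly_mapping_eqI) (auto simp: lookup_vec_of_fun Rspace_iff)
    also have "\<dots> \<in> span (?b ` {..<r})"
      unfolding vec_of_fun_def by (intro span_sum span_scale span_base) auto
    finally show ?thesis .
  qed
  then have "V \<subseteq> span (?b ` {..<r})" using assms(2) by blast
  with orthonormal_wrt_independent[OF assms(1,3)] have "card V \<le> card (?b ` {..<r})"
    using independent_span_bound[of "?b ` {..<r}" V] by simp
  also have "\<dots> \<le> r" using card_image_le[of "{..<r}" ?b] by simp
  finally show ?thesis .
qed

text \<open>Coordinates from r on are ignored, which makes this a bilinear form on the whole type
  and semidefinite there, not just on \<open>Rspace r\<close>.\<close>

definition mat_form :: "nat \<Rightarrow> real mat \<Rightarrow> (nat \<Rightarrow>\<^sub>0 real) \<Rightarrow> (nat \<Rightarrow>\<^sub>0 real) \<Rightarrow> real" where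
  "mat_form r Y u v = (\<Sum>i<r. \<Sum>j<r. Y $$ (i, j) * Poly_Mapping.lookup u i * Poly_Mapping.lookup v j)"

lemma scalar_prod_mult_mat_vec:
  assumes "Y \<in> carrier_mat r r" "v \<in> carrier_vec r"
  shows "scalar_prod v (Y *\<^sub>v v) = (\<Sum>i<r. \<Sum>j<r. (Y $$ (i, j) :: real) * vec_index v i * vec_index v j)"
  using assms by (simp add: scalar_prod_def mult_mat_vec_def row_def sum_distrib_left atLeast0LessThan mult_ac)

lemma psd_mats_iff:
  assumes "Y \<in> carrier_mat r r"
  shows "Y \<in> psd_mats r \<longleftrightarrow> (\<forall>i<r. \<forall>j<r. Y $$ (i, j) = Y $$ (j, i)) \<and>
    (\<forall>w\<in>Rspace r. 0 \<le> mat_form r Y w w)"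
proof -
  have sym: "transpose_mat Y = Y \<longleftrightarrow> (\<forall>i<r. \<forall>j<r. Y $$ (i, j) = Y $$ (j, i))"
    using assms by (auto simp: mat_eq_iff)
  have "(\<forall>v \<in> carrier_vec r. scalar_prod v (Y *\<^sub>v v) \<ge> 0) \<longleftrightarrow> (\<forall>w\<in>Rspace r. 0 \<le> mat_form r Y w w)"
  proof (intro iffI ballI)
    fix w assume H: "\<forall>v \<in> carrier_vec r. scalar_prod v (Y *\<^sub>v v) \<ge> 0"
    have "scalar_prod (vec r (Poly_Mapping.lookup w)) (Y *\<^sub>v vec r (Poly_Mapping.lookup w)) = mat_form r Y w w"
      using scalar_prod_mult_mat_vec[OF assms, of "vec r (Poly_Mapping.lookup w)"] by (simp add: mat_form_def)
    then show "0 \<le> mat_form r Y w w" using H by (metis vec_carrier)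
  next
    fix v :: "real vec" assume H: "\<forall>w\<in>Rspace r. 0 \<le> mat_form r Y w w" and v: "v \<in> carrier_vec r"
    define w where "w = vec_of_fun r (vec_index v)"
    have w: "Poly_Mapping.lookup w i = (if i < r then vec_index v i else 0)" for i
      by (simp add: w_def lookup_vec_of_fun)
    have "w \<in> Rspace r" by (simp add: w_def vec_of_fun_in_Rspace)
    moreover have "mat_form r Y w w = scalar_prod v (Y *\<^sub>v v)"
      unfolding scalar_prod_mult_mat_vec[OF assms v] mat_form_def by (simp add: w)
    ultimately show "0 \<le> scalar_prod v (Y *\<^sub>v v)" using H by metis
  qed
  then show ?thesis using assms sym by (simp add: psd_mats_def)
qed

lemma psd_mats_diag_nonneg:
  assumes "Y \<in> psd_mats r" "i < r"
  shows "0 \<le> Y $$ (i, i)"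
proof -
  have Y: "Y \<in> carrier_mat r r" using assms by (simp add: psd_mats_def)
  let ?w = "Poly_Mapping.single i (1::real)"
  have "?w \<in> Rspace r" using assms(2) by (simp add: Rspace_def)
  then have "0 \<le> mat_form r Y ?w ?w" using psd_mats_iff[OF Y] assms(1) by blast
  also have "mat_form r Y ?w ?w = (\<Sum>j<r. if j = i then Y $$ (i, i) else 0)"
  proof -
    have "(\<Sum>l<r. Y $$ (j, l) * Poly_Mapping.lookup ?w j * Poly_Mapping.lookup ?w l) = (if j = i then Y $$ (i, i) else 0)" for j
    proof -
      have "(\<Sum>l<r. Y $$ (j, l) * Poly_Mapping.lookup ?w j * Poly_Mapping.lookup ?w l)
         = (\<Sum>l<r. if l = i then Y $$ (j, i) * Poly_Mapping.lookup ?w j else 0)"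
        by (intro sum.cong) (auto simp: lookup_single when_def)
      then show ?thesis using assms(2) by (simp add: lookup_single when_def)
    qed
    then show ?thesis by (simp add: mat_form_def)
  qed
  finally show ?thesis using assms(2) by simp
qed

lemma psd_form_mat_form:
  assumes "Y \<in> psd_mats r"
  shows "psd_form (\<lambda>u v. mat_form r Y u v)"
proof -
  have Y: "Y \<in> carrier_mat r r" using assms by (simp add: psd_mats_def)
  have sym: "\<And>i j. i < r \<Longrightarrow> j < r \<Longrightarrow> Y $$ (i, j) = Y $$ (j, i)"
    and nn: "\<And>w. w \<in> Rspace r \<Longrightarrow> 0 \<le> mat_form r Y w w"
    using psd_mats_iff[OF Y] assms by blast+
  have "bilinear (mat_form r Y)"
    unfolding bilinear_def mat_form_def
    by (auto intro!: linearI simp: lookup_add algebra_simps sum.distrib sum_distrib_left)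
  moreover have "mat_form r Y u v = mat_form r Y v u" for u v
    unfolding mat_form_def by (subst sum.swap) (intro sum.cong refl, simp add: sym mult_ac)
  moreover have "0 \<le> mat_form r Y u u" for u
  proof -
    define w where "w = vec_of_fun r (Poly_Mapping.lookup u)"
    have w: "Poly_Mapping.lookup w i = (if i < r then Poly_Mapping.lookup u i else 0)" for i
      by (simp add: w_def lookup_vec_of_fun)
    have "w \<in> Rspace r" by (simp add: w_def vec_of_fun_in_Rspace)
    moreover have "mat_form r Y w w = mat_form r Y u u" by (simp add: mat_form_def w)
    ultimately show ?thesis using nn by metis
  qed
  ultimately show ?thesis by (simp add: psd_form_def)
qed

text \<open>Fix a feasible matrix for each vertex. The equations are affine, so an affine
  combination of vertices satisfies them together with the same combination of matrices. If the
  latter is semidefinite it certifies membership in the hull, hence a representation with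
  nonnegative weights.\<close>

lemma sdp_extension_forms:
  fixes pt :: "'z \<Rightarrow> nat \<Rightarrow>\<^sub>0 real"
  assumes L: "is_sdp_extension d (convex hull (pt ` Z)) r L" and Z: "finite Z" and pt: "pt ` Z \<subseteq> Rspace d"
  obtains B where "\<And>z. z \<in> Z \<Longrightarrow> psd_form (B z)"
    "\<And>\<nu>. \<lbrakk>sum \<nu> Z = 1; \<And>w. w \<in> Rspace r \<Longrightarrow> 0 \<le> (\<Sum>z\<in>Z. \<nu> z * B z w w)\<rbrakk> \<Longrightarrow>
       \<exists>\<kappa>. (\<forall>z\<in>Z. 0 \<le> \<kappa> z) \<and> (\<Sum>z\<in>Z. \<kappa> z *\<^sub>R pt z) = (\<Sum>z\<in>Z. \<nu> z *\<^sub>R pt z)"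
proof -
  define lhs where "lhs = (\<lambda>a U x Y. (\<Sum>j<d. Poly_Mapping.lookup a j * Poly_Mapping.lookup (x :: nat \<Rightarrow>\<^sub>0 real) j) +
           (\<Sum>i<r. \<Sum>j<r. U $$ (i, j) * (Y :: real mat) $$ (i, j)))"
  have ext: "x \<in> convex hull (pt ` Z) \<longleftrightarrow> (\<exists>Y \<in> psd_mats r. \<forall>(a, U, b) \<in> L. lhs a U x Y = b)"
    if "x \<in> Rspace d" for x
    using L that unfolding is_sdp_extension_def lhs_def by blast
  have "\<forall>z\<in>Z. \<exists>Y. Y \<in> psd_mats r \<and> (\<forall>(a, U, b) \<in> L. lhs a U (pt z) Y = b)"
  proof
    fix z assume "z \<in> Z"
    then have "pt z \<in> Rspace d" "pt z \<in> convex hull (pt ` Z)" using pt by (auto intro: hull_inc)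
    then show "\<exists>Y. Y \<in> psd_mats r \<and> (\<forall>(a, U, b) \<in> L. lhs a U (pt z) Y = b)" using ext by blast
  qed
  then obtain Y where Y': "\<forall>z\<in>Z. Y z \<in> psd_mats r \<and> (\<forall>(a, U, b) \<in> L. lhs a U (pt z) (Y z) = b)"
    unfolding bchoice_iff by (elim exE)
  have Y: "\<And>z. z \<in> Z \<Longrightarrow> Y z \<in> psd_mats r"
    "\<And>z a U b. \<lbrakk>z \<in> Z; (a, U, b) \<in> L\<rbrakk> \<Longrightarrow> lhs a U (pt z) (Y z) = b"
    using Y' by fast+
  show thesis
  proof (rule that[of "\<lambda>z. mat_form r (Y z)"])
    show "psd_form (mat_form r (Y z))" if "z \<in> Z" for z
      using psd_form_mat_form[OF Y(1)[OF that]] .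
    fix \<nu> :: "'z \<Rightarrow> real"
    assume one: "sum \<nu> Z = 1" and psd: "\<And>w. w \<in> Rspace r \<Longrightarrow> 0 \<le> (\<Sum>z\<in>Z. \<nu> z * mat_form r (Y z) w w)"
    define x where "x = (\<Sum>z\<in>Z. \<nu> z *\<^sub>R pt z)"
    define X where "X = mat r r (\<lambda>(i, j). \<Sum>z\<in>Z. \<nu> z * Y z $$ (i, j))"
    have X: "X \<in> carrier_mat r r" "\<And>i j. i < r \<Longrightarrow> j < r \<Longrightarrow> X $$ (i, j) = (\<Sum>z\<in>Z. \<nu> z * Y z $$ (i, j))"
      by (simp_all add: X_def)
    have x: "x \<in> Rspace d" unfolding x_def
      using pt by (intro subspace_sum[OF subspace_Rspace] subspace_scale[OF subspace_Rspace]) auto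
    have "mat_form r X w w = (\<Sum>z\<in>Z. \<nu> z * mat_form r (Y z) w w)" for w
    proof -
      have "mat_form r X w w = (\<Sum>i<r. \<Sum>j<r. \<Sum>z\<in>Z. \<nu> z * (Y z $$ (i, j) * Poly_Mapping.lookup w i * Poly_Mapping.lookup w j))"
        unfolding mat_form_def by (intro sum.cong refl) (simp add: X(2) sum_distrib_right mult.assoc)
      also have "\<dots> = (\<Sum>i<r. \<Sum>z\<in>Z. \<Sum>j<r. \<nu> z * (Y z $$ (i, j) * Poly_Mapping.lookup w i * Poly_Mapping.lookup w j))"
        by (intro sum.cong refl sum.swap)
      also have "\<dots> = (\<Sum>z\<in>Z. \<Sum>i<r. \<Sum>j<r. \<nu> z * (Y z $$ (i, j) * Poly_Mapping.lookup w i * Poly_Mapping.lookup w j))"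
        by (rule sum.swap)
      finally show ?thesis by (simp add: mat_form_def sum_distrib_left)
    qed
    moreover have "Y z $$ (i, j) = Y z $$ (j, i)" if "z \<in> Z" "i < r" "j < r" for z i j
      using Y(1)[OF that(1)] that psd_mats_iff[of "Y z" r] by (auto simp: psd_mats_def)
    ultimately have "X \<in> psd_mats r"
      using psd psd_mats_iff[OF X(1)] by (auto simp: X(2) intro!: sum.cong)
    moreover have "lhs a U x X = b" if "(a, U, b) \<in> L" for a U b
    proof -
      have "(\<Sum>j<d. Poly_Mapping.lookup a j * Poly_Mapping.lookup x j) =
          (\<Sum>z\<in>Z. \<nu> z * (\<Sum>j<d. Poly_Mapping.lookup a j * Poly_Mapping.lookup (pt z) j))"
        unfolding x_def lookup_sum_scaleR sum_distrib_left by (subst sum.swap) (simp add: mult_ac)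
      moreover have "(\<Sum>i<r. \<Sum>j<r. U $$ (i, j) * X $$ (i, j)) =
          (\<Sum>z\<in>Z. \<nu> z * (\<Sum>i<r. \<Sum>j<r. U $$ (i, j) * Y z $$ (i, j)))"
      proof -
        have "(\<Sum>i<r. \<Sum>j<r. U $$ (i, j) * X $$ (i, j)) = (\<Sum>i<r. \<Sum>j<r. \<Sum>z\<in>Z. \<nu> z * (U $$ (i, j) * Y z $$ (i, j)))"
          by (intro sum.cong refl) (simp add: X(2) sum_distrib_left mult_ac)
        also have "\<dots> = (\<Sum>i<r. \<Sum>z\<in>Z. \<Sum>j<r. \<nu> z * (U $$ (i, j) * Y z $$ (i, j)))"
          by (intro sum.cong refl sum.swap)
        also have "\<dots> = (\<Sum>z\<in>Z. \<Sum>i<r. \<Sum>j<r. \<nu> z * (U $$ (i, j) * Y z $$ (i, j)))"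
          by (rule sum.swap)
        finally show ?thesis by (simp add: sum_distrib_left)
      qed
      ultimately have "lhs a U x X = (\<Sum>z\<in>Z. \<nu> z * lhs a U (pt z) (Y z))"
        by (simp add: lhs_def distrib_left sum.distrib)
      also have "\<dots> = (\<Sum>z\<in>Z. \<nu> z * b)" using Y(2)[OF _ that] by (intro sum.cong) auto
      also have "\<dots> = b" using one by (simp add: sum_distrib_right[symmetric])
      finally show ?thesis .
    qed
    ultimately have "x \<in> convex hull (pt ` Z)" using ext[OF x] by blast
    \<comment> \<open>\<open>pt\<close> may identify indices, so the weights on points are pulled
      back to one representative of each.\<close>
    obtain Z0 where Z0: "Z0 \<subseteq> Z" "inj_on pt Z0" "pt ` Z = pt ` Z0" using subset_image_inj[of "pt ` Z" pt Z] by auto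
    have "finite (pt ` Z0)" using Z Z0(1) finite_subset by blast
    with \<open>x \<in> convex hull (pt ` Z)\<close> obtain u where u: "\<forall>y\<in>pt ` Z0. 0 \<le> u y" "(\<Sum>y\<in>pt ` Z0. u y *\<^sub>R y) = x"
      unfolding Z0(3) by (auto simp: convex_hull_finite)
    have "(\<Sum>z\<in>Z. (if z \<in> Z0 then u (pt z) else 0) *\<^sub>R pt z) = (\<Sum>z\<in>Z0. u (pt z) *\<^sub>R pt z)"
      using Z Z0(1) by (intro sum.mono_neutral_cong_right) auto
    also have "\<dots> = x" using u(2) by (simp add: sum.reindex[OF Z0(2)])
    finally show "\<exists>\<kappa>. (\<forall>z\<in>Z. 0 \<le> \<kappa> z) \<and> (\<Sum>z\<in>Z. \<kappa> z *\<^sub>R pt z) = (\<Sum>z\<in>Z. \<nu> z *\<^sub>R pt z)"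
      unfolding x_def using u(1) by (intro exI[of _ "\<lambda>z. if z \<in> Z0 then u (pt z) else 0"]) auto
  qed
qed

section \<open>The free join and its blocks\<close>

text \<open>The coordinates come in \<open>p\<close> blocks of \<open>k + 1\<close>. The last coordinates of the blocks form a
  monotone 0/1 chain whose jump marks the unique block, if any, carrying a member of \<open>S\<close>; hence the
  convex hull is the free join of \<open>p\<close> copies of the one of \<open>S\<close> and of the origin, while the chain
  keeps the intersection graph a path of cliques.\<close>

type_synonym join_index = "(nat \<times> nat set) option"

definition join_bit :: "nat \<Rightarrow> join_index \<Rightarrow> nat \<Rightarrow> bool" where
  "join_bit k z q = (case z of None \<Rightarrow> False | Some (i, A) \<Rightarrow>
     if q mod (k + 1) < k then q div (k + 1) = i \<and> q mod (k + 1) \<in> A else i \<le> q div (k + 1))"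

definition join_point :: "nat \<Rightarrow> nat \<Rightarrow> join_index \<Rightarrow> nat \<Rightarrow>\<^sub>0 real" where
  "join_point k p z = vec_of_fun (p * (k + 1)) (\<lambda>q. of_bool (join_bit k z q))"

definition join_indices :: "nat \<Rightarrow> nat set set \<Rightarrow> join_index set" where
  "join_indices p S = insert None (Some ` ({..<p} \<times> S))"

definition join_set :: "nat \<Rightarrow> nat \<Rightarrow> nat set set \<Rightarrow> (nat \<Rightarrow>\<^sub>0 real) set" where
  "join_set k p S = join_point k p ` join_indices p S"

lemma block_index:
  assumes "j \<le> (k::nat)"
  shows "(l * (k + 1) + j) div (k + 1) = l" "(l * (k + 1) + j) mod (k + 1) = j"
proof -
  have "j < k + 1" using assms by simp
  then show "(l * (k + 1) + j) div (k + 1) = l" "(l * (k + 1) + j) mod (k + 1) = j"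
    by (metis add.right_neutral div_less div_mult_self3 add_eq_0_iff_both_eq_0 zero_neq_one)
       (metis \<open>j < k + 1\<close> mod_less mod_mult_self3)
qed

lemma block_index_less:
  assumes "j \<le> (k::nat)" "l < p"
  shows "l * (k + 1) + j < p * (k + 1)"
proof -
  have "l * (k + 1) + j < (l + 1) * (k + 1)" using assms(1) by simp
  also have "\<dots> \<le> p * (k + 1)" using assms(2) by (intro mult_le_mono1) simp
  finally show ?thesis .
qed

lemma lookup_join_point:
  "Poly_Mapping.lookup (join_point k p z) q = of_bool (q < p * (k + 1) \<and> join_bit k z q)"
  by (simp add: join_point_def lookup_vec_of_fun)

lemma lookup_join_point_block:
  assumes "l < p"
  shows "j < k \<Longrightarrow> Poly_Mapping.lookup (join_point k p z) (l * (k + 1) + j) = of_bool (\<exists>A. z = Some (l, A) \<and> j \<in> A)"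
    and "Poly_Mapping.lookup (join_point k p z) (l * (k + 1) + k) = of_bool (\<exists>i A. z = Some (i, A) \<and> i \<le> l)"
  using block_index[of j k l] block_index_less[of j k l p] block_index[of k k l] block_index_less[of k k l p] assms
  by (auto simp: lookup_join_point join_bit_def split: option.splits)

lemma sum_join_block:
  assumes "finite S" "i < p"
  shows "(\<Sum>z\<in>join_indices p S. g z * of_bool (\<exists>A. z = Some (i, A) \<and> P A)) =
    (\<Sum>A\<in>S. of_bool (P A) * (g (Some (i, A)) :: real))"
proof -
  let ?I = "(\<lambda>A. Some (i, A)) ` S"
  have "(\<Sum>z\<in>join_indices p S. g z * of_bool (\<exists>A. z = Some (i, A) \<and> P A)) =
      (\<Sum>z\<in>?I. g z * of_bool (\<exists>A. z = Some (i, A) \<and> P A))"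
    using assms by (intro sum.mono_neutral_right) (auto simp: join_indices_def)
  also have "\<dots> = (\<Sum>A\<in>S. of_bool (P A) * g (Some (i, A)))"
    by (subst sum.reindex) (auto simp: inj_on_def mult.commute)
  finally show ?thesis .
qed

text \<open>The points of the other blocks vanish on the inner coordinates of block i, and the
  difference of two consecutive last coordinates is the indicator of block i. So weights outside the
  block leave no trace in its moments or its mass.\<close>

lemma join_moments:
  assumes S: "finite S" "S \<subseteq> Pow {..<k}" and i: "i < p"
    and eq: "(\<Sum>z\<in>join_indices p S. m z *\<^sub>R join_point k p z) = (\<Sum>z\<in>join_indices p S. l z *\<^sub>R join_point k p z)"
  shows "(\<Sum>A\<in>S. of_bool (j \<in> A) * m (Some (i, A))) = (\<Sum>A\<in>S. of_bool (j \<in> A) * l (Some (i, A)))"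
    and "(\<Sum>A\<in>S. m (Some (i, A))) = (\<Sum>A\<in>S. l (Some (i, A)))"
proof -
  let ?Z = "join_indices p S"
  have look: "(\<Sum>z\<in>?Z. m z * Poly_Mapping.lookup (join_point k p z) q) = (\<Sum>z\<in>?Z. l z * Poly_Mapping.lookup (join_point k p z) q)" for q
    using arg_cong[OF eq, of "\<lambda>x. Poly_Mapping.lookup x q"] by (simp only: lookup_sum_scaleR)
  show "(\<Sum>A\<in>S. of_bool (j \<in> A) * m (Some (i, A))) = (\<Sum>A\<in>S. of_bool (j \<in> A) * l (Some (i, A)))"
  proof (cases "j < k")
    case True
    then show ?thesis
      using look[of "i * (k + 1) + j"] unfolding lookup_join_point_block(1)[OF i True] sum_join_block[OF S(1) i] by simp
  next
    case False
    then have "(\<Sum>A\<in>S. of_bool (j \<in> A) * g A) = 0" for g :: "nat set \<Rightarrow> real"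
      using S(2) by (intro sum.neutral) auto
    then show ?thesis by simp
  qed
  \<comment> \<open>Block 0 has no predecessor; there the last coordinate alone is the
    indicator.\<close>
  define u where "u = (\<lambda>z. Poly_Mapping.lookup (join_point k p z) (i * (k + 1) + k)
      - (if i = 0 then 0 else Poly_Mapping.lookup (join_point k p z) ((i - 1) * (k + 1) + k)))"
  have "u z = of_bool (\<exists>A. z = Some (i, A) \<and> True)" for z
  proof (cases "i = 0")
    case False
    then have "i - 1 < p" using i by simp
    with False show ?thesis
      unfolding u_def lookup_join_point_block(2)[OF i] lookup_join_point_block(2)[OF \<open>i - 1 < p\<close>]
      by (cases z) auto
  qed (use lookup_join_point_block(2)[OF i] in \<open>auto simp: u_def\<close>)
  moreover have "(\<Sum>z\<in>?Z. m z * u z) = (\<Sum>z\<in>?Z. l z * u z)"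
  proof (cases "i = 0")
    case True
    then show ?thesis unfolding u_def using look[of "i * (k + 1) + k"] by simp
  next
    case False
    then show ?thesis
      unfolding u_def using look[of "i * (k + 1) + k"] look[of "(i - 1) * (k + 1) + k"]
      by (simp add: right_diff_distrib sum_subtractf)
  qed
  ultimately show "(\<Sum>A\<in>S. m (Some (i, A))) = (\<Sum>A\<in>S. l (Some (i, A)))"
    using sum_join_block[OF S(1) i, of m "\<lambda>_. True"] sum_join_block[OF S(1) i, of l "\<lambda>_. True"]
    by simp
qed

text \<open>The lift consists of the Gram matrices on V of the forms of the block. The remaining
  forms vanish on V, so these matrices sum to that of the total form, the identity. The cone
  condition is \<open>block_cone\<close> seen through \<open>join_moments\<close>; the apex
  \<open>None\<close> always lies outside the block.\<close>

lemma block_psd_lift: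
  fixes B :: "join_index \<Rightarrow> 'v::real_vector \<Rightarrow> 'v \<Rightarrow> real"
  assumes S: "finite S" "S \<subseteq> Pow {..<k}" and i: "i < p"
  defines "Z \<equiv> join_indices p S" and "I \<equiv> (\<lambda>A. Some (i, A)) ` S"
  assumes B: "\<And>z. z \<in> Z \<Longrightarrow> psd_form (B z)" and W: "subspace W"
    and r: "\<And>B V. \<lbrakk>psd_form B; V \<subseteq> W; orthonormal_wrt B V\<rbrakk> \<Longrightarrow> card V \<le> r"
    and ext: "\<And>\<nu>. \<lbrakk>sum \<nu> Z = 1; \<And>w. w \<in> W \<Longrightarrow> 0 \<le> (\<Sum>z\<in>Z. \<nu> z * B z w w)\<rbrakk> \<Longrightarrow>
       \<exists>\<kappa>. (\<forall>z\<in>Z. 0 \<le> \<kappa> z) \<and> (\<Sum>z\<in>Z. \<kappa> z *\<^sub>R join_point k p z) = (\<Sum>z\<in>Z. \<nu> z *\<^sub>R join_point k p z)"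
    and V: "orthonormal_wrt (\<lambda>u v. \<Sum>z\<in>Z. B z u v) V"
      "\<And>v z. \<lbrakk>v \<in> V; z \<in> Z - I\<rbrakk> \<Longrightarrow> B z v v = 0"
      "\<And>w. \<lbrakk>w \<in> W; \<And>z. z \<in> Z - I \<Longrightarrow> B z w w = 0\<rbrakk> \<Longrightarrow>
         \<exists>n. w = (\<Sum>v\<in>V. (\<Sum>z\<in>Z. B z w v) *\<^sub>R v) + n \<and> (\<Sum>z\<in>Z. B z n n) = 0"
  shows "\<exists>M. is_psd_lift (card V) S M"
proof -
  have Z: "finite Z" using S by (simp add: Z_def join_indices_def)
  have I: "I \<subseteq> Z" "Z - I \<noteq> {}" using i by (auto simp: I_def Z_def join_indices_def)
  have inj: "inj_on (\<lambda>A. Some (i, A)) S" by (auto simp: inj_on_def)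
  have BS: "psd_form (B (Some (i, A)))" if "A \<in> S" for A
    using that I B by (auto simp: I_def)
  define s where "s = card V"
  have "finite V" using V(1) by (simp add: orthonormal_wrt_def)
  then obtain e where e: "bij_betw e {..<s} V"
    using ex_bij_betw_nat_finite[of V] by (auto simp: s_def atLeast0LessThan)
  define M where "M = (\<lambda>A a b. B (Some (i, A)) (e a) (e b))"
  have quad: "quad s (M A) t = B (Some (i, A)) (\<Sum>a<s. t a *\<^sub>R e a) (\<Sum>a<s. t a *\<^sub>R e a)" if "A \<in> S" for A t
    unfolding bilinear_linear_combination[OF psd_form_bilinear[OF BS[OF that]]]
    by (simp add: quad_def M_def mult_ac)
  have "is_psd_lift s S M"
    unfolding is_psd_lift_def
  proof (intro conjI ballI allI impI)
    show "0 \<le> quad s (M A) t" if "A \<in> S" for A t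
      unfolding quad[OF that] by (rule psd_form_nonneg[OF BS[OF that]])
    show "M A a b = M A b a" if "A \<in> S" for A a b
      unfolding M_def by (rule psd_form_sym[OF BS[OF that]])
    show "(\<Sum>A\<in>S. M A a b) = of_bool (a = b)" if "a < s" "b < s" for a b
    proof -
      have ea: "e a \<in> V" "e b \<in> V" using e that by (auto simp: bij_betw_def)
      have "(\<Sum>A\<in>S. M A a b) = (\<Sum>z\<in>I. B z (e a) (e b))"
        unfolding I_def M_def by (simp add: sum.reindex[OF inj])
      also have "\<dots> = (\<Sum>z\<in>Z. B z (e a) (e b))"
        using Z I V(2)[OF ea(1)] B by (intro sum.mono_neutral_left) (auto intro: psd_form_null)
      also have "\<dots> = of_bool (e a = e b)" using V(1) ea by (simp add: orthonormal_wrt_def)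
      also have "e a = e b \<longleftrightarrow> a = b" using e that by (auto simp: bij_betw_def inj_on_def)
      finally show ?thesis .
    qed
    fix l :: "nat set \<Rightarrow> real" and \<epsilon> :: real
    assume eps: "\<epsilon> > 0" and pos: "\<forall>t. \<epsilon> * (\<Sum>a<s. (t a)\<^sup>2) \<le> (\<Sum>A\<in>S. l A * quad s (M A) t)"
    define l' where "l' = (\<lambda>z :: join_index. l (snd (the z)))"
    have pos': "\<epsilon> * (\<Sum>v\<in>V. (t v)\<^sup>2) \<le>
       (\<Sum>z\<in>I. l' z * B z (\<Sum>v\<in>V. t v *\<^sub>R v) (\<Sum>v\<in>V. t v *\<^sub>R v))" for t
    proof -
      have "(\<Sum>v\<in>V. t v *\<^sub>R v) = (\<Sum>a<s. t (e a) *\<^sub>R e a)" "(\<Sum>v\<in>V. (t v)\<^sup>2) = (\<Sum>a<s. (t (e a))\<^sup>2)"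
        by (simp_all add: sum.reindex_bij_betw[OF e, symmetric])
      moreover have "(\<Sum>z\<in>I. l' z * B z v v) = (\<Sum>A\<in>S. l A * B (Some (i, A)) v v)" for v
        unfolding I_def by (simp add: sum.reindex[OF inj] l'_def)
      ultimately show ?thesis using pos[rule_format, of "\<lambda>a. t (e a)"] by (simp add: quad)
    qed
    have "\<exists>m c. (\<forall>z\<in>Z. 0 \<le> m z) \<and>
      (\<Sum>z\<in>Z. m z *\<^sub>R join_point k p z) = (\<Sum>z\<in>Z. (if z \<in> I then l' z else c) *\<^sub>R join_point k p z)"
      by (rule block_cone[OF Z B W r I ext V(1,3) eps pos'])
    then obtain m c where m: "\<forall>z\<in>Z. 0 \<le> m z"
      "(\<Sum>z\<in>Z. m z *\<^sub>R join_point k p z) = (\<Sum>z\<in>Z. (if z \<in> I then l' z else c) *\<^sub>R join_point k p z)"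
      by (elim exE conjE)
    have "(if Some (i, A) \<in> I then l' (Some (i, A)) else c) = l A" if "A \<in> S" for A
      using that by (simp add: I_def l'_def)
    then have "(\<Sum>A\<in>S. m (Some (i, A))) = sum l S"
      "\<And>j. (\<Sum>A\<in>S. of_bool (j \<in> A) * m (Some (i, A))) = (\<Sum>A\<in>S. of_bool (j \<in> A) * l A)"
      using join_moments[OF S i m(2)[unfolded Z_def]] by (simp_all cong: sum.cong)
    moreover have "0 \<le> m (Some (i, A))" if "A \<in> S" for A using m(1) I that by (auto simp: I_def)
    ultimately show "\<exists>m. (\<forall>A\<in>S. 0 \<le> m A) \<and> sum m S = sum l S \<and>
           (\<forall>j. (\<Sum>A\<in>S. of_bool (j \<in> A) * m A) = (\<Sum>A\<in>S. of_bool (j \<in> A) * l A))"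
      by (intro exI[of _ "\<lambda>A. m (Some (i, A))"]) auto
  qed
  then show ?thesis by (auto simp: s_def)
qed

lemma join_point_in_cube: "join_point k p z \<in> cube (p * (k + 1))"
  by (auto simp: cube_def join_point_def vec_of_fun_in_Rspace lookup_vec_of_fun)

lemma sdp_extension_join:
  assumes S: "S \<subseteq> Pow {..<k}"
    and L: "is_sdp_extension (p * (k + 1)) (convex hull (join_set k p S)) r L"
  obtains s where "(\<Sum>i<p. s i) \<le> r" "\<And>i. i < p \<Longrightarrow> \<exists>M. is_psd_lift (s i) S M"
proof -
  have finS: "finite S" using S finite_subset by blast
  let ?Z = "join_indices p S"
  define I where "I = (\<lambda>i. (\<lambda>A. Some (i, A)) ` S :: join_index set)"
  have Z: "finite ?Z" using finS by (simp add: join_indices_def)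
  have pt: "join_point k p ` ?Z \<subseteq> Rspace (p * (k + 1))" using join_point_in_cube by (auto simp: cube_def)
  have I: "\<And>i. i < p \<Longrightarrow> I i \<subseteq> ?Z" "\<And>i j. \<lbrakk>i < p; j < p; i \<noteq> j\<rbrakk> \<Longrightarrow> I i \<inter> I j = {}"
    by (auto simp: I_def join_indices_def)
  show thesis
  proof (rule sdp_extension_forms[OF L[unfolded join_set_def] Z pt])
    fix B assume B: "\<And>z. z \<in> ?Z \<Longrightarrow> psd_form (B z)"
      and ext: "\<And>\<nu>. \<lbrakk>sum \<nu> ?Z = 1; \<And>w. w \<in> Rspace r \<Longrightarrow> 0 \<le> (\<Sum>z\<in>?Z. \<nu> z * B z w w)\<rbrakk> \<Longrightarrow>
       \<exists>\<kappa>. (\<forall>z\<in>?Z. 0 \<le> \<kappa> z) \<and> (\<Sum>z\<in>?Z. \<kappa> z *\<^sub>R join_point k p z) = (\<Sum>z\<in>?Z. \<nu> z *\<^sub>R join_point k p z)"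
    show thesis
    proof (rule block_bases[OF Z B subspace_Rspace orthonormal_card_le I])
      fix V
      assume V: "\<And>i. i < p \<Longrightarrow> orthonormal_wrt (\<lambda>u v. \<Sum>z\<in>?Z. B z u v) (V i)"
        "\<And>i v z. \<lbrakk>i < p; v \<in> V i; z \<in> ?Z - I i\<rbrakk> \<Longrightarrow> B z v v = 0"
        "\<And>i w. \<lbrakk>i < p; w \<in> Rspace r; \<And>z. z \<in> ?Z - I i \<Longrightarrow> B z w w = 0\<rbrakk> \<Longrightarrow>
           \<exists>n. w = (\<Sum>v\<in>V i. (\<Sum>z\<in>?Z. B z w v) *\<^sub>R v) + n \<and> (\<Sum>z\<in>?Z. B z n n) = 0"
        "(\<Sum>i<p. card (V i)) \<le> r"
      show thesis
      proof (rule that[OF V(4)])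
        fix i assume i: "i < p"
        show "\<exists>M. is_psd_lift (card (V i)) S M"
          by (rule block_psd_lift[OF finS S i B subspace_Rspace orthonormal_card_le ext V(1)[OF i]
              V(2)[OF i, unfolded I_def] V(3)[OF i, unfolded I_def]])
      qed
    qed
  qed
qed

subsection \<open>Treewidth of the join\<close>

text \<open>The order is a perfect elimination order: both neighbours of the least vertex of a cycle
  are larger, hence adjacent to each other, and from length 4 on their edge is a chord.\<close>

lemma chordal_elimination_order:
  fixes V :: "'a::linorder set"
  assumes elim: "\<And>m a b. \<lbrakk>{m, a} \<in> E; {m, b} \<in> E; m < a; m < b; a \<noteq> b\<rbrakk> \<Longrightarrow> {a, b} \<in> E"
  shows "chordal V E"
  unfolding chordal_def
proof (intro allI impI)
  fix c assume c: "is_cycle V E c \<and> 4 \<le> length c"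
  define n where "n = length c"
  have n: "n \<ge> 4" and dist: "distinct c" and edge: "\<And>i. i < n \<Longrightarrow> {c ! i, c ! (Suc i mod n)} \<in> E"
    using c by (auto simp: is_cycle_def n_def)
  have "Min (set c) \<in> set c" using n by (intro Min_in) (auto simp: n_def)
  then obtain i where i: "i < n" "c ! i = Min (set c)" by (auto simp: in_set_conv_nth n_def)
  have less: "c ! i < c ! j" if "j < n" "j \<noteq> i" for j
  proof -
    have "c ! i \<le> c ! j" using that by (simp add: i(2) n_def)
    moreover have "c ! i \<noteq> c ! j" using that i(1) dist by (simp add: nth_eq_iff_index_eq n_def)
    ultimately show ?thesis by simp
  qed
  define j where "j = (if Suc i = n then 0 else Suc i)"
  define h where "h = (if i = 0 then n - 1 else i - 1)"
  have j: "j = Suc i mod n" "j < n" "j \<noteq> i" using n i(1) by (auto simp: j_def)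
  have h: "h < n" "h \<noteq> i" "Suc h mod n = i" using n i(1) by (auto simp: h_def)
  have "h \<noteq> j" "h \<noteq> Suc j mod n" using n i(1) by (auto simp: h_def j_def split: if_splits) (cases "Suc (Suc i) = n"; simp)+
  moreover have "{c ! i, c ! j} \<in> E" using edge[OF i(1)] j(1) by simp
  moreover have "{c ! i, c ! h} \<in> E" using edge[OF h(1)] h(3) by (simp add: insert_commute)
  moreover have "c ! h \<noteq> c ! j" using \<open>h \<noteq> j\<close> h(1) j(2) dist by (simp add: nth_eq_iff_index_eq n_def)
  ultimately have "{c ! h, c ! j} \<in> E" using elim less h j by blast
  then show "has_chord E c"
    unfolding has_chord_def n_def[symmetric]
    using h j \<open>h \<noteq> j\<close> \<open>h \<noteq> Suc j mod n\<close> by (intro exI[of _ h] conjI exI[of _ j]) auto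
qed

text \<open>The complete graph is an admissible chordal supergraph, so the \<open>LEAST\<close> in
  \<open>treewidth\<close> is attained.\<close>

lemma chordal_complete: "chordal V ([V]\<^bsup>2\<^esup>)"
  unfolding chordal_def
proof (intro allI impI)
  fix c assume c: "is_cycle V ([V]\<^bsup>2\<^esup>) c \<and> 4 \<le> length c"
  then have "0 < length c" "2 < length c" by linarith+
  then have "c ! 0 \<in> V" "c ! 2 \<in> V" "c ! 0 \<noteq> c ! 2"
    using c nth_mem[of 0 c] nth_mem[of 2 c] nth_eq_iff_index_eq[of c 0 2]
    by (auto simp: is_cycle_def)
  then have "{c ! 0, c ! 2} \<in> [V]\<^bsup>2\<^esup>" by (simp add: nsets_def)
  moreover have "2 \<noteq> Suc 0 mod length c" "0 \<noteq> Suc 2 mod length c"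
    using c by (auto simp: mod_less)
  ultimately show "has_chord ([V]\<^bsup>2\<^esup>) c"
    unfolding has_chord_def using c
    by (intro exI[of _ 0] conjI exI[of _ 2]) auto
qed

lemma card_clique_le_clique_number:
  assumes "finite V" "K \<subseteq> V" "clique K E"
  shows "card K \<le> clique_number V E"
  unfolding clique_number_def using assms by (intro Max_ge) auto

lemma clique_number_le:
  assumes "finite V" "\<And>K. \<lbrakk>K \<subseteq> V; clique K E\<rbrakk> \<Longrightarrow> card K \<le> b"
  shows "clique_number V E \<le> b"
  unfolding clique_number_def
proof (rule Max.boundedI)
  show "finite (card ` {K. K \<subseteq> V \<and> clique K E})" using assms(1) by simp
  have "{} \<in> {K. K \<subseteq> V \<and> clique K E}" by simp
  then show "card ` {K. K \<subseteq> V \<and> clique K E} \<noteq> {}" by blast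
qed (use assms(2) in auto)

lemma treewidth_ge_clique:
  assumes V: "finite V" and E: "E \<subseteq> [V]\<^bsup>2\<^esup>" and K: "K \<subseteq> V" "clique K E"
  shows "card K \<le> treewidth V E + 1"
proof -
  let ?P = "\<lambda>k. \<exists>E'. E \<subseteq> E' \<and> E' \<subseteq> [V]\<^bsup>2\<^esup> \<and> chordal V E' \<and> clique_number V E' \<le> k + 1"
  have "?P (clique_number V ([V]\<^bsup>2\<^esup>))"
    using E chordal_complete by (intro exI[of _ "[V]\<^bsup>2\<^esup>"]) auto
  then have "?P (treewidth V E)" unfolding treewidth_def by (rule LeastI)
  then obtain E' where E': "E \<subseteq> E'" "clique_number V E' \<le> treewidth V E + 1" by blast
  have "clique K E'" using K(2) E'(1) by (auto simp: clique_def)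
  then show ?thesis using card_clique_le_clique_number[OF V K(1)] E'(2) by (meson order_trans)
qed

lemma treewidth_le:
  assumes "E \<subseteq> E'" "E' \<subseteq> [V]\<^bsup>2\<^esup>" "chordal V E'" "clique_number V E' \<le> k + 1"
  shows "treewidth V E \<le> k"
  unfolding treewidth_def using assms by (intro Least_le exI[of _ E'] conjI)

lemma is_formulation_scope:
  assumes "is_formulation d S F" "(X, \<phi>) \<in> set F"
  shows "X \<subseteq> {..<d}"
    and "\<lbrakk>x \<in> cube d; y \<in> cube d; \<And>i. i \<in> X \<Longrightarrow> Poly_Mapping.lookup x i = Poly_Mapping.lookup y i\<rbrakk> \<Longrightarrow> \<phi> x = \<phi> y"
proof -
  have H: "X \<subseteq> {..<d} \<and> (\<forall>x\<in>cube d. \<forall>y\<in>cube d.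
      (\<forall>i\<in>X. Poly_Mapping.lookup x i = Poly_Mapping.lookup y i) \<longrightarrow> \<phi> x = \<phi> y)"
    using assms(1)[unfolded is_formulation_def, THEN conjunct1, THEN bspec, OF assms(2)]
    unfolding prod.case by assumption
  show "X \<subseteq> {..<d}" by (rule H[THEN conjunct1])
  show "\<phi> x = \<phi> y" if "x \<in> cube d" "y \<in> cube d"
    "\<And>i. i \<in> X \<Longrightarrow> Poly_Mapping.lookup x i = Poly_Mapping.lookup y i"
    using H[THEN conjunct2, THEN bspec, OF that(1), THEN bspec, OF that(2)] that(3) by blast
qed

lemma intersection_edges_subset:
  assumes "is_formulation d S F"
  shows "intersection_edges F \<subseteq> [{..<d}]\<^bsup>2\<^esup>"
proof
  fix e assume "e \<in> intersection_edges F"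
  then obtain j l P where e: "e = {j, l}" "j \<noteq> l" "P \<in> set F" "case P of (X, \<phi>) \<Rightarrow> j \<in> X \<and> l \<in> X"
    unfolding intersection_edges_def by (elim CollectE exE conjE bexE)
  obtain X \<phi> where P: "P = (X, \<phi>)" by (cases P)
  have e: "e = {j, l}" "j \<noteq> l" "(X, \<phi>) \<in> set F" "j \<in> X" "l \<in> X" using e by (simp_all add: P)
  have "X \<subseteq> {..<d}" using is_formulation_scope(1)[OF assms e(3)] .
  then have "e \<subseteq> {..<d}" "finite e" "card e = 2" using e by auto
  then show "e \<in> [{..<d}]\<^bsup>2\<^esup>" by (simp add: nsets_def)
qed

text \<open>A non-member all of whose neighbours along the coordinates in \<open>K\<close> are members can only be
  excluded by a function in which all of these coordinates appear.\<close>

lemma tw_ge_isolated_nonmember: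
  assumes "is_formulation d S F" and K: "K \<subseteq> {..<d}"
    and x: "x \<in> cube d" "x \<notin> S"
    and nb: "\<And>j. j \<in> K \<Longrightarrow> \<exists>y\<in>S. \<forall>i. i \<noteq> j \<longrightarrow> Poly_Mapping.lookup y i = Poly_Mapping.lookup x i"
  shows "card K \<le> tw d S + 1"
proof -
  let ?P = "\<lambda>k. \<exists>F. is_formulation d S F \<and> k = treewidth {..<d} (intersection_edges F)"
  have "?P (treewidth {..<d} (intersection_edges F))" using assms(1) by (intro exI[of _ F]) simp
  then have "?P (tw d S)" unfolding tw_def by (rule LeastI)
  then obtain F where F: "is_formulation d S F" and tw: "tw d S = treewidth {..<d} (intersection_edges F)"
    by blast
  have S: "S = {x \<in> cube d. \<forall>(X, \<phi>) \<in> set F. \<phi> x = False}" using F by (simp add: is_formulation_def)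
  obtain X \<phi> where X: "(X, \<phi>) \<in> set F" "\<phi> x" using x S by blast
  have dep: "\<phi> u = \<phi> v" if "u \<in> cube d" "v \<in> cube d"
      "\<forall>i\<in>X. Poly_Mapping.lookup u i = Poly_Mapping.lookup v i" for u v
    using is_formulation_scope(2)[OF F X(1) that(1,2)] that(3) by simp
  have "K \<subseteq> X"
  proof
    fix j assume "j \<in> K"
    from nb[OF this] obtain y where y: "y \<in> S" "\<And>i. i \<noteq> j \<Longrightarrow> Poly_Mapping.lookup y i = Poly_Mapping.lookup x i"
      by blast
    have "y \<in> cube d" "\<not> \<phi> y" using y(1) X(1) S by auto
    then show "j \<in> X" using dep[OF _ x(1), of y] X(2) y(2) by metis
  qed
  then have "clique K (intersection_edges F)"
    using X(1) unfolding clique_def intersection_edges_def by blast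
  then show ?thesis
    unfolding tw using treewidth_ge_clique[OF _ intersection_edges_subset[OF F] K] by simp
qed

text \<open>\<open>prev\<close> and \<open>cur\<close> are the last coordinates of the preceding
  block and of block l, with \<open>prev\<close> false for l = 0. The else branch also forbids
  \<open>prev\<close> without \<open>cur\<close>, so the conditions for all blocks together make the
  chain monotone.\<close>

definition block_ok :: "nat \<Rightarrow> nat set set \<Rightarrow> (nat \<Rightarrow> bool) \<Rightarrow> nat \<Rightarrow> bool" where
  "block_ok k S b l \<longleftrightarrow>
     (let prev = (0 < l \<and> b (l * (k + 1) - 1)); cur = b (l * (k + 1) + k); A = {j. j < k \<and> b (l * (k + 1) + j)}
      in if \<not> prev \<and> cur then A \<in> S else prev = cur \<and> A = {})"

text \<open>The coordinates of block l and the last one of the preceding block. Bounding q + 1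
  avoids a truncated subtraction; for l = 0 nothing is added.\<close>

definition block_scope :: "nat \<Rightarrow> nat \<Rightarrow> nat set" where
  "block_scope k l = {q. l * (k + 1) \<le> q + 1 \<and> q \<le> l * (k + 1) + k}"

definition join_formulation :: "nat \<Rightarrow> nat \<Rightarrow> nat set set \<Rightarrow> formulation" where
  "join_formulation k p S =
     map (\<lambda>l. (block_scope k l, \<lambda>x. \<not> block_ok k S (\<lambda>q. Poly_Mapping.lookup x q = 1) l)) [0..<p]"

lemma block_ok_cong:
  assumes "\<And>q. q \<in> block_scope k l \<Longrightarrow> b q = b' q"
  shows "block_ok k S b l = block_ok k S b' l"
proof -
  have "0 < l \<Longrightarrow> b (l * (k + 1) - 1) = b' (l * (k + 1) - 1)" "b (l * (k + 1) + k) = b' (l * (k + 1) + k)"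
    "\<And>j. j < k \<Longrightarrow> b (l * (k + 1) + j) = b' (l * (k + 1) + j)"
    by (intro assms; simp add: block_scope_def)+
  then show ?thesis unfolding block_ok_def by (simp cong: conj_cong)
qed

lemma block_ok_join_bit:
  assumes "z \<in> join_indices p S" "S \<subseteq> Pow {..<k}"
  shows "block_ok k S (join_bit k z) l"
proof -
  have last: "join_bit k z (l' * (k + 1) + k) \<longleftrightarrow> (\<exists>i A. z = Some (i, A) \<and> i \<le> l')" for l'
    using block_index[of k k l'] by (auto simp: join_bit_def split: option.splits)
  have inner: "join_bit k z (l * (k + 1) + j) \<longleftrightarrow> (\<exists>A. z = Some (l, A) \<and> j \<in> A)" if "j < k" for j
    using block_index[of j k l] that by (auto simp: join_bit_def split: option.splits)
  have prev: "0 < l \<and> join_bit k z (l * (k + 1) - 1) \<longleftrightarrow> (\<exists>i A. z = Some (i, A) \<and> i < l)"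
  proof (cases l)
    case (Suc l')
    then have "l * (k + 1) - 1 = l' * (k + 1) + k" by simp
    then have "join_bit k z (l * (k + 1) - 1) \<longleftrightarrow> (\<exists>i A. z = Some (i, A) \<and> i \<le> l')"
      using last[of l'] by metis
    then show ?thesis unfolding Suc by (simp only: zero_less_Suc less_Suc_eq_le simp_thms le0)
  qed simp
  have A: "{j. j < k \<and> join_bit k z (l * (k + 1) + j)} = {j. j < k \<and> (\<exists>A. z = Some (l, A) \<and> j \<in> A)}"
    using inner by auto
  show ?thesis
    unfolding block_ok_def Let_def prev last A
  proof (cases "\<exists>A. z = Some (l, A)")
    case True
    then obtain A where z: "z = Some (l, A)" by blast
    then have "A \<in> S" using assms(1) by (auto simp: join_indices_def)
    moreover have "{j. j < k \<and> j \<in> A} = A" using \<open>A \<in> S\<close> assms(2) by auto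
    ultimately show "if \<not> (\<exists>i A. z = Some (i, A) \<and> i < l) \<and> (\<exists>i A. z = Some (i, A) \<and> i \<le> l)
      then {j. j < k \<and> (\<exists>A. z = Some (l, A) \<and> j \<in> A)} \<in> S
      else (\<exists>i A. z = Some (i, A) \<and> i < l) = (\<exists>i A. z = Some (i, A) \<and> i \<le> l) \<and>
        {j. j < k \<and> (\<exists>A. z = Some (l, A) \<and> j \<in> A)} = {}"
      using z by simp
  next
    case False
    then have "(\<exists>i A. z = Some (i, A) \<and> i < l) = (\<exists>i A. z = Some (i, A) \<and> i \<le> l)"
      by (metis le_eq_less_or_eq)
    with False show "if \<not> (\<exists>i A. z = Some (i, A) \<and> i < l) \<and> (\<exists>i A. z = Some (i, A) \<and> i \<le> l)
      then {j. j < k \<and> (\<exists>A. z = Some (l, A) \<and> j \<in> A)} \<in> S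
      else (\<exists>i A. z = Some (i, A) \<and> i < l) = (\<exists>i A. z = Some (i, A) \<and> i \<le> l) \<and>
        {j. j < k \<and> (\<exists>A. z = Some (l, A) \<and> j \<in> A)} = {}"
      by (subst if_not_P) (blast, simp)
  qed
qed

text \<open>The first block whose last coordinate is set carries the member. From there on the chain
  stays set, so all other blocks must be empty; if no last coordinate is set, the point is the
  origin.\<close>

lemma block_ok_imp_join_bit:
  assumes ok: "\<And>l. l < p \<Longrightarrow> block_ok k S b l"
  obtains z where "z \<in> join_indices p S" "\<And>q. q < p * (k + 1) \<Longrightarrow> b q = join_bit k z q"
proof -
  define u where "u = (\<lambda>l. b (l * (k + 1) + k))"
  define A where "A = (\<lambda>l. {j. j < k \<and> b (l * (k + 1) + j)})"
  have ok': "if \<not> (0 < l \<and> u (l - 1)) \<and> u l then A l \<in> S else (0 < l \<and> u (l - 1)) = u l \<and> A l = {}"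
    if "l < p" for l
  proof -
    have "0 < l \<Longrightarrow> l * (k + 1) - 1 = (l - 1) * (k + 1) + k" by (cases l) auto
    then show ?thesis using ok[OF that] by (simp add: block_ok_def Let_def u_def A_def cong: conj_cong)
  qed
  have bits: "b q = (if q mod (k + 1) < k then q mod (k + 1) \<in> A (q div (k + 1)) else u (q div (k + 1)))" for q
  proof -
    have q: "q = q div (k + 1) * (k + 1) + q mod (k + 1)" by (rule div_mult_mod_eq[symmetric])
    have "q mod (k + 1) < k + 1" by simp
    then show ?thesis using q unfolding A_def u_def
      by (smt (verit, best) less_Suc_eq mem_Collect_eq Suc_eq_plus1)
  qed
  have div: "q div (k + 1) < p" if "q < p * (k + 1)" for q
    using that by (simp add: less_mult_imp_div_less)
  show thesis
  proof (cases "\<exists>l<p. u l")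
    case False
    then have "A l = {}" if "l < p" for l using ok'[OF that] that by (auto split: if_splits)
    then have "b q = join_bit k None q" if "q < p * (k + 1)" for q
      unfolding bits join_bit_def using div[OF that] False by auto
    then show thesis by (intro that[of None]) (auto simp: join_indices_def)
  next
    case True
    define i where "i = (LEAST l. l < p \<and> u l)"
    have i: "i < p" "u i" using LeastI_ex[OF True] by (auto simp: i_def)
    have below: "\<not> u l" if "l < i" for l
      using not_less_Least[of l "\<lambda>l. l < p \<and> u l"] that i(1) by (auto simp: i_def)
    have "l < p \<longrightarrow> u l" if "i \<le> l" for l
      using that
    proof (induction l rule: dec_induct)
      case (step l)
      then show ?case using ok'[of "Suc l"] by (auto split: if_splits)
    qed (use i in simp)
    then have u: "u l \<longleftrightarrow> i \<le> l" if "l < p" for l using below that by (meson leI)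
    have Ai: "A i \<in> S" using ok'[OF i(1)] i below[of "i - 1"] by (auto split: if_splits)
    have A: "A l = {}" if "l < p" "l \<noteq> i" for l
    proof -
      have "l - 1 < p" using that by simp
      then show ?thesis using ok'[OF that(1)] u[OF that(1)] u[of "l - 1"] that by (auto split: if_splits)
    qed
    have "b q = join_bit k (Some (i, A i)) q" if "q < p * (k + 1)" for q
      unfolding bits join_bit_def using div[OF that] u A by auto
    then show thesis using i Ai by (intro that[of "Some (i, A i)"]) (auto simp: join_indices_def)
  qed
qed

lemma is_formulation_join:
  assumes S: "S \<subseteq> Pow {..<k}"
  shows "is_formulation (p * (k + 1)) (join_set k p S) (join_formulation k p S)"
proof -
  have scope: "block_scope k l \<subseteq> {..<p * (k + 1)}" if "l < p" for l
  proof
    fix q assume "q \<in> block_scope k l"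
    then have "q \<le> l * (k + 1) + k" by (simp add: block_scope_def)
    then show "q \<in> {..<p * (k + 1)}" using block_index_less[OF order_refl that, of k] by simp
  qed
  have eq: "join_set k p S = {x \<in> cube (p * (k + 1)). \<forall>l<p. block_ok k S (\<lambda>q. Poly_Mapping.lookup x q = 1) l}"
    (is "_ = ?R")
  proof (intro equalityI subsetI)
    fix x assume "x \<in> join_set k p S"
    then obtain z where z: "z \<in> join_indices p S" "x = join_point k p z" by (auto simp: join_set_def)
    have "block_ok k S (\<lambda>q. Poly_Mapping.lookup x q = 1) l" if "l < p" for l
    proof -
      have "block_ok k S (\<lambda>q. Poly_Mapping.lookup x q = 1) l = block_ok k S (join_bit k z) l"
        using scope[OF that] by (intro block_ok_cong) (auto simp: z(2) lookup_join_point)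
      then show ?thesis using block_ok_join_bit[OF z(1) S] by simp
    qed
    then show "x \<in> ?R" using z(2) join_point_in_cube by auto
  next
    fix x assume x: "x \<in> ?R"
    then obtain z where z: "z \<in> join_indices p S"
      "\<And>q. q < p * (k + 1) \<Longrightarrow> (Poly_Mapping.lookup x q = 1) = join_bit k z q"
      using block_ok_imp_join_bit[of p k S "\<lambda>q. Poly_Mapping.lookup x q = 1"] by blast
    have "x = join_point k p z"
    proof (rule poly_mapping_eqI)
      fix q
      show "Poly_Mapping.lookup x q = Poly_Mapping.lookup (join_point k p z) q"
        using x z(2)[of q] by (cases "q < p * (k + 1)") (auto simp: lookup_join_point cube_def Rspace_iff)
    qed
    then show "x \<in> join_set k p S" using z(1) by (simp add: join_set_def)
  qed
  show ?thesis
    unfolding is_formulation_def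
  proof (intro conjI ballI)
    fix P assume "P \<in> set (join_formulation k p S)"
    then obtain l where l: "l < p"
      and P: "P = (block_scope k l, \<lambda>x. \<not> block_ok k S (\<lambda>q. Poly_Mapping.lookup x q = 1) l)"
      by (auto simp: join_formulation_def)
    have "block_ok k S (\<lambda>q. Poly_Mapping.lookup x q = 1) l = block_ok k S (\<lambda>q. Poly_Mapping.lookup y q = 1) l"
      if "\<forall>i\<in>block_scope k l. Poly_Mapping.lookup x i = Poly_Mapping.lookup y i" for x y :: "nat \<Rightarrow>\<^sub>0 real"
      using that by (intro block_ok_cong) simp
    then show "case P of (X, \<phi>) \<Rightarrow> X \<subseteq> {..<p * (k + 1)} \<and>
        (\<forall>x\<in>cube (p * (k + 1)). \<forall>y\<in>cube (p * (k + 1)).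
           (\<forall>i\<in>X. Poly_Mapping.lookup x i = Poly_Mapping.lookup y i) \<longrightarrow> \<phi> x = \<phi> y)"
      unfolding P prod.case using scope[OF l] by blast
  next
    show "join_set k p S = {x \<in> cube (p * (k + 1)). \<forall>(X, \<phi>)\<in>set (join_formulation k p S). \<phi> x = False}"
      unfolding eq join_formulation_def by auto
  qed
qed

text \<open>Consecutive scopes share one coordinate, the greatest of the earlier scope. An element
  that is not greatest in its scope thus determines the block, and the shift by 1 counts the shared
  coordinate with the later one.\<close>

lemma block_scope_unique:
  assumes "m \<in> block_scope k l" "a \<in> block_scope k l" "m < a"
  shows "l = (m + 1) div (k + 1)"
proof -
  have "m + 1 = l * (k + 1) + (m + 1 - l * (k + 1))" "m + 1 - l * (k + 1) \<le> k"
    using assms by (auto simp: block_scope_def)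
  then show ?thesis using block_index(1)[of "m + 1 - l * (k + 1)" k l] by metis
qed

lemma card_block_scope: "card (block_scope k l) \<le> k + 2"
proof -
  have "block_scope k l \<subseteq> {l * (k + 1) - 1..l * (k + 1) + k}" by (auto simp: block_scope_def)
  then have "card (block_scope k l) \<le> card {l * (k + 1) - 1..l * (k + 1) + k}" by (intro card_mono) auto
  then show ?thesis by simp
qed

text \<open>The intersection graph is itself chordal: in the natural order the larger neighbours of
  a vertex lie in a single scope. For the same reason a clique is contained in the scope determined
  by its least element, which has at most k + 2 elements.\<close>

lemma tw_join_le:
  assumes S: "S \<subseteq> Pow {..<k}"
  shows "tw (p * (k + 1)) (join_set k p S) \<le> k + 1"
proof -
  let ?V = "{..<p * (k + 1)}"
  define E where "E = intersection_edges (join_formulation k p S)"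
  have F: "is_formulation (p * (k + 1)) (join_set k p S) (join_formulation k p S)"
    by (rule is_formulation_join[OF S])
  have E: "{a, b} \<in> E \<longleftrightarrow> a \<noteq> b \<and> (\<exists>l<p. a \<in> block_scope k l \<and> b \<in> block_scope k l)" for a b
  proof
    show "{a, b} \<in> E \<Longrightarrow> a \<noteq> b \<and> (\<exists>l<p. a \<in> block_scope k l \<and> b \<in> block_scope k l)"
      unfolding E_def intersection_edges_def join_formulation_def by (auto simp: doubleton_eq_iff)
    show "a \<noteq> b \<and> (\<exists>l<p. a \<in> block_scope k l \<and> b \<in> block_scope k l) \<Longrightarrow> {a, b} \<in> E"
      unfolding E_def intersection_edges_def join_formulation_def mem_Collect_eq
      by (intro exI[of _ a] exI[of _ b]) auto
  qed
  have "chordal ?V E"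
  proof (rule chordal_elimination_order)
    fix m a b assume "{m, a} \<in> E" "{m, b} \<in> E" "m < a" "m < b" "a \<noteq> b"
    then obtain l l' where "l < p" "m \<in> block_scope k l" "a \<in> block_scope k l"
      "m \<in> block_scope k l'" "b \<in> block_scope k l'" by (auto simp: E)
    moreover from this have "l = l'" using block_scope_unique \<open>m < a\<close> \<open>m < b\<close> by metis
    ultimately show "{a, b} \<in> E" using \<open>a \<noteq> b\<close> by (auto simp: E)
  qed
  moreover have "clique_number ?V E \<le> (k + 1) + 1"
  proof (rule clique_number_le)
    fix K assume K: "K \<subseteq> ?V" "clique K E"
    have finK: "finite K" using K(1) finite_subset by blast
    show "card K \<le> (k + 1) + 1"
    proof (cases "K = {}")
      case False
      define m where "m = Min K"
      have m: "m \<in> K" "\<And>a. a \<in> K \<Longrightarrow> m \<le> a" using False finK by (auto simp: m_def)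
      have in_block: "m \<in> block_scope k ((m + 1) div (k + 1)) \<and> a \<in> block_scope k ((m + 1) div (k + 1))"
        if "a \<in> K" "a \<noteq> m" for a
      proof -
        have "{m, a} \<in> E" using K(2) m(1) that by (auto simp: clique_def)
        then obtain l where "m \<in> block_scope k l" "a \<in> block_scope k l" by (auto simp: E)
        moreover have "m < a" using m(2)[OF that(1)] that(2) by simp
        ultimately show ?thesis using block_scope_unique by metis
      qed
      show ?thesis
      proof (cases "K = {m}")
        case False
        then obtain a where "a \<in> K" "a \<noteq> m" using m(1) by blast
        then have "K \<subseteq> block_scope k ((m + 1) div (k + 1))" using in_block by blast
        moreover have "finite (block_scope k ((m + 1) div (k + 1)))"
          by (rule finite_subset[of _ "{..(m + 1) div (k + 1) * (k + 1) + k}"]) (auto simp: block_scope_def)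
        ultimately have "card K \<le> card (block_scope k ((m + 1) div (k + 1)))" by (intro card_mono)
        also have "\<dots> \<le> k + 2" by (rule card_block_scope)
        finally show ?thesis by simp
      qed simp
    qed simp
  qed simp
  ultimately have "treewidth ?V E \<le> k + 1"
    using intersection_edges_subset[OF F] unfolding E_def by (intro treewidth_le[OF order_refl]) auto
  moreover have "tw (p * (k + 1)) (join_set k p S) \<le> treewidth ?V E"
    unfolding tw_def E_def using F by (intro Least_le exI[of _ "join_formulation k p S"]) simp
  ultimately show ?thesis by simp
qed

text \<open>The isolated nonmember carries C in block 0. Its neighbours along the k inner
  coordinates of that block carry the sets \<open>flip j C\<close>, which belong to S.\<close>

lemma tw_join_ge:
  assumes S: "S \<subseteq> Pow {..<k}" and p: "p > 0"
    and C: "C \<subseteq> {..<k}" "C \<notin> S" "\<And>j. j < k \<Longrightarrow> flip j C \<in> S"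
  shows "k \<le> tw (p * (k + 1)) (join_set k p S) + 1"
proof -
  let ?x = "join_point k p (Some (0, C))"
  have sub: "{..<k} \<subseteq> {..<p * (k + 1)}"
  proof -
    have "1 * (k + 1) \<le> p * (k + 1)" using p by (intro mult_le_mono1) simp
    then show ?thesis by auto
  qed
  have "?x \<notin> join_set k p S"
  proof
    assume "?x \<in> join_set k p S"
    then obtain z where z: "z \<in> join_indices p S" "?x = join_point k p z" by (auto simp: join_set_def)
    have look: "Poly_Mapping.lookup ?x q = Poly_Mapping.lookup (join_point k p z) q" for q using z(2) by simp
    from look[of "0 * (k + 1) + k"] obtain A where A: "z = Some (0, A)"
      unfolding lookup_join_point_block(2)[OF p] by (auto split: if_splits)
    have "A \<in> S" using z(1) A by (auto simp: join_indices_def)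
    have "j \<in> A \<longleftrightarrow> j \<in> C" if "j < k" for j
      using look[of "0 * (k + 1) + j"] unfolding lookup_join_point_block(1)[OF p that] A by (auto split: if_splits)
    then have "A = C" using \<open>A \<in> S\<close> S C(1) by blast
    with \<open>A \<in> S\<close> C(2) show False by simp
  qed
  moreover have "\<exists>y\<in>join_set k p S. \<forall>i. i \<noteq> j \<longrightarrow> Poly_Mapping.lookup y i = Poly_Mapping.lookup ?x i"
    if "j \<in> {..<k}" for j
  proof -
    have "Some (0, flip j C) \<in> join_indices p S" using C(3) that p by (auto simp: join_indices_def)
    moreover have "join_bit k (Some (0, flip j C)) i = join_bit k (Some (0, C)) i" if "i \<noteq> j" for i
    proof -
      have "i mod (k + 1) \<noteq> j \<or> i div (k + 1) \<noteq> 0"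
        using that div_mult_mod_eq[of i "k + 1"] by (metis add_0 mult_0)
      then show ?thesis by (auto simp: join_bit_def flip_def)
    qed
    ultimately show ?thesis
      unfolding join_set_def by (intro bexI[of _ "join_point k p (Some (0, flip j C))"]) (auto simp: lookup_join_point)
  qed
  ultimately have "card {..<k} \<le> tw (p * (k + 1)) (join_set k p S) + 1"
    using tw_ge_isolated_nonmember[OF is_formulation_join[OF S] sub join_point_in_cube] by blast
  then show ?thesis by simp
qed

text \<open>The last coordinate of the last block is 1 at every vertex but the origin, so the
  hyperplane where it equals 1 contains the base and misses the apex.\<close>

lemma is_pyramid_join:
  assumes "p > 0" "finite S"
  shows "is_pyramid (convex hull (join_set k p S))"
proof -
  define A where "A = join_point k p ` Some ` ({..<p} \<times> S)"
  have "finite A" using assms(2) by (simp add: A_def)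
  then have "polytope (convex hull A)" unfolding polytope_def by blast
  moreover have "join_set k p S = A \<union> {join_point k p None}" by (auto simp: join_set_def join_indices_def A_def)
  then have "convex hull (join_set k p S) = convex hull (convex hull A \<union> {join_point k p None})"
    by (simp only: hull_Un_left[symmetric])
  moreover have "join_point k p None \<notin> affine hull (convex hull A)"
  proof -
    let ?q = "(p - 1) * (k + 1) + k"
    have p1: "p - 1 < p" using assms(1) by simp
    have "affine {x :: nat \<Rightarrow>\<^sub>0 real. Poly_Mapping.lookup x ?q = 1}"
      by (auto simp: affine_def lookup_add distrib_right[symmetric])
    moreover have "A \<subseteq> {x. Poly_Mapping.lookup x ?q = 1}"
      using lookup_join_point_block(2)[OF p1, of k] by (auto simp: A_def)
    ultimately have "affine hull A \<subseteq> {x. Poly_Mapping.lookup x ?q = 1}" by (rule hull_minimal[rotated])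
    moreover have "Poly_Mapping.lookup (join_point k p None) ?q = 0"
      using lookup_join_point_block(2)[OF p1, of k None] by simp
    ultimately show ?thesis by (auto simp del: One_nat_def)
  qed
  ultimately show ?thesis unfolding is_pyramid_def by blast
qed

subsection \<open>Extension complexity of the join\<close>

definition diag_of :: "nat \<Rightarrow> (nat \<Rightarrow> real) \<Rightarrow> real mat" where
  "diag_of r f = mat r r (\<lambda>(i, j). if i = j then f i else 0)"

lemma sum_diag_of:
  "(\<Sum>i<r. \<Sum>j<r. diag_of r f $$ (i, j) * Y $$ (i, j)) = (\<Sum>i<r. f i * Y $$ (i, i))"
proof -
  have "(\<Sum>j<r. diag_of r f $$ (i, j) * Y $$ (i, j)) = (\<Sum>j<r. if j = i then f i * Y $$ (i, i) else 0)"
    if "i < r" for i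
    using that by (intro sum.cong) (auto simp: diag_of_def)
  then show ?thesis by simp
qed

lemma diag_of_psd:
  assumes "\<And>i. i < r \<Longrightarrow> 0 \<le> f i"
  shows "diag_of r f \<in> psd_mats r"
proof -
  have car: "diag_of r f \<in> carrier_mat r r" by (simp add: diag_of_def)
  have "mat_form r (diag_of r f) w w = (\<Sum>i<r. f i * (Poly_Mapping.lookup w i)\<^sup>2)" for w
  proof -
    have "(\<Sum>j<r. diag_of r f $$ (i, j) * Poly_Mapping.lookup w i * Poly_Mapping.lookup w j) =
        (\<Sum>j<r. if j = i then f i * (Poly_Mapping.lookup w i)\<^sup>2 else 0)" if "i < r" for i
      using that by (intro sum.cong) (auto simp: diag_of_def power2_eq_square)
    then show ?thesis by (simp add: mat_form_def)
  qed
  moreover have "diag_of r f $$ (i, j) = diag_of r f $$ (j, i)" if "i < r" "j < r" for i j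
    using that by (simp add: diag_of_def)
  moreover have "0 \<le> (\<Sum>i<r. f i * (Poly_Mapping.lookup w i)\<^sup>2)" for w :: "nat \<Rightarrow>\<^sub>0 real"
    using assms by (intro sum_nonneg mult_nonneg_nonneg) auto
  ultimately show ?thesis by (simp add: psd_mats_iff[OF car])
qed

text \<open>The vertex weights of a convex combination are the diagonal of the matrix variable; the system
  is admissible because 0/1 coordinates make all coefficient matrices semidefinite.\<close>

lemma sdp_extension_exists:
  assumes P: "finite P" "P \<subseteq> cube d"
  shows "\<exists>L. is_sdp_extension d (convex hull P) (card P) L"
proof -
  define r where "r = card P"
  obtain f where f: "bij_betw f {..<r} P"
    using ex_bij_betw_nat_finite[OF P(1)] by (auto simp: r_def atLeast0LessThan)
  have fP: "f i \<in> P" if "i < r" for i using f that by (auto simp: bij_betw_def)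
  \<comment> \<open>One equation normalises the weights, the others express each coordinate of x by
    them. The minus sign goes to the vector part, whose sign is free, since the matrices have to be
    semidefinite.\<close>
  define L where "L = insert (0, diag_of r (\<lambda>_. 1), 1::real)
    ((\<lambda>q. (- Poly_Mapping.single q (1::real), diag_of r (\<lambda>i. Poly_Mapping.lookup (f i) q), 0)) ` {..<d})"
  have mem: "(\<forall>(a, U, b) \<in> L. (\<Sum>j<d. Poly_Mapping.lookup a j * Poly_Mapping.lookup x j) +
           (\<Sum>i<r. \<Sum>j<r. U $$ (i, j) * Y $$ (i, j)) = b) \<longleftrightarrow>
      (\<Sum>i<r. Y $$ (i, i)) = 1 \<and>
      (\<forall>q<d. Poly_Mapping.lookup x q = (\<Sum>i<r. Poly_Mapping.lookup (f i) q * Y $$ (i, i)))" for x Y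
  proof -
    have ball: "(\<forall>t\<in>L. Q t) \<longleftrightarrow> Q (0, diag_of r (\<lambda>_. 1), 1) \<and>
        (\<forall>q<d. Q (- Poly_Mapping.single q 1, diag_of r (\<lambda>i. Poly_Mapping.lookup (f i) q), 0))" for Q
      by (auto simp: L_def)
    have eq: "(\<Sum>j<d. Poly_Mapping.lookup (- Poly_Mapping.single q 1) j * Poly_Mapping.lookup x j) + y = 0 \<longleftrightarrow>
        Poly_Mapping.lookup x q = y"
      if "q < d" for q y
    proof -
      have "(\<Sum>j<d. Poly_Mapping.lookup (- Poly_Mapping.single q 1) j * Poly_Mapping.lookup x j)
          = (\<Sum>j<d. if j = q then - Poly_Mapping.lookup x q else 0)"
        by (intro sum.cong) (auto simp: lookup_single when_def)
      also have "\<dots> = - Poly_Mapping.lookup x q" using that by simp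
      finally show ?thesis by linarith
    qed
    show ?thesis
      unfolding ball prod.case sum_diag_of
      by (simp only: lookup_zero mult_zero_left mult_1 sum.neutral_const add_0)
         (intro conj_cong refl iff_allI imp_cong eq)
  qed
  have cubeP: "Poly_Mapping.lookup (f i) q \<in> {0, 1}" if "i < r" "q < d" for i q
    using P(2) fP[OF that(1)] that(2) by (auto simp: cube_def)
  have "is_sdp_extension d (convex hull P) r L"
    unfolding is_sdp_extension_def mem
  proof (intro conjI ballI iffI)
    fix t assume t: "t \<in> L"
    have "0 \<le> Poly_Mapping.lookup (f i) q" if "i < r" "q < d" for i q using cubeP[OF that] by auto
    with t show "case t of (a, U, b) \<Rightarrow> a \<in> Rspace d \<and> U \<in> psd_mats r"
      by (auto simp: L_def Rspace_iff lookup_single when_def intro!: diag_of_psd)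
  next
    fix x assume x: "x \<in> Rspace d" "x \<in> convex hull P"
    then obtain u where u: "\<forall>y\<in>P. 0 \<le> u y" "sum u P = 1" "(\<Sum>y\<in>P. u y *\<^sub>R y) = x"
      using P(1) by (auto simp: convex_hull_finite)
    let ?Y = "diag_of r (\<lambda>i. u (f i))"
    have diag: "?Y $$ (i, i) = u (f i)" if "i < r" for i using that by (simp add: diag_of_def)
    have "?Y \<in> psd_mats r" using u(1) fP by (intro diag_of_psd) auto
    moreover have "(\<Sum>i<r. ?Y $$ (i, i)) = 1"
      using u(2) by (simp add: diag sum.reindex_bij_betw[OF f])
    moreover have "Poly_Mapping.lookup x q = (\<Sum>i<r. Poly_Mapping.lookup (f i) q * ?Y $$ (i, i))" for q
    proof -
      have "(\<Sum>i<r. u (f i) *\<^sub>R f i) = x"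
        using u(3) by (simp add: sum.reindex_bij_betw[OF f, of "\<lambda>y. u y *\<^sub>R y"])
      from arg_cong[OF this, of "\<lambda>x. Poly_Mapping.lookup x q"]
      show ?thesis by (simp add: diag lookup_sum_scaleR mult.commute)
    qed
    ultimately show "\<exists>Y\<in>psd_mats r. (\<Sum>i<r. Y $$ (i, i)) = 1 \<and>
      (\<forall>q<d. Poly_Mapping.lookup x q = (\<Sum>i<r. Poly_Mapping.lookup (f i) q * Y $$ (i, i)))" by blast
  next
    fix x assume x: "x \<in> Rspace d" and "\<exists>Y\<in>psd_mats r. (\<Sum>i<r. Y $$ (i, i)) = 1 \<and>
      (\<forall>q<d. Poly_Mapping.lookup x q = (\<Sum>i<r. Poly_Mapping.lookup (f i) q * Y $$ (i, i)))"
    then obtain Y where Y: "Y \<in> psd_mats r" "(\<Sum>i<r. Y $$ (i, i)) = 1"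
      "\<And>q. q < d \<Longrightarrow> Poly_Mapping.lookup x q = (\<Sum>i<r. Poly_Mapping.lookup (f i) q * Y $$ (i, i))" by blast
    have "x = (\<Sum>i<r. Y $$ (i, i) *\<^sub>R f i)"
    proof (rule poly_mapping_eqI)
      fix q
      show "Poly_Mapping.lookup x q = Poly_Mapping.lookup (\<Sum>i<r. Y $$ (i, i) *\<^sub>R f i) q"
      proof (cases "q < d")
        case False
        then have "Poly_Mapping.lookup (f i) q = 0" if "i < r" for i
          using fP[OF that] P(2) by (auto simp: cube_def Rspace_iff)
        then show ?thesis using x False by (simp add: lookup_sum_scaleR Rspace_iff)
      qed (simp add: lookup_sum_scaleR Y(3) mult.commute)
    qed
    also have "\<dots> \<in> convex hull P"
      using Y(2) psd_mats_diag_nonneg[OF Y(1)] fP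
      by (intro convex_sum[OF _ convex_convex_hull]) (auto intro: hull_inc)
    finally show "x \<in> convex hull P" .
  qed
  then show ?thesis by (auto simp: r_def)
qed

text \<open>A property of \<open>LEAST\<close> can be derived only for a satisfiable predicate; the
  extension by vertex weights provides the witness.\<close>

lemma xc_SDP_attained:
  assumes "finite P" "P \<subseteq> cube d"
  obtains L where "is_sdp_extension d (convex hull P) (xc_SDP d P) L"
proof -
  let ?Q = "\<lambda>r. \<exists>L. is_sdp_extension d (convex hull P) r L"
  have "?Q (card P)" by (rule sdp_extension_exists[OF assms])
  then have "?Q (xc_SDP d P)" unfolding xc_SDP_def by (rule LeastI)
  with that show thesis by blast
qed

text \<open>The fourth root of the counting bound, its polynomial factor moved into the exponent,
  where \<epsilon> is of order log k / k.\<close>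

lemma psd_lift_size_ge:
  assumes "2 ^ k < s ^ 4 * (100 * (k + 1) ^ 3)"
  defines "\<epsilon> \<equiv> log 2 (100 * (real k + 1) ^ 3) / real k"
  shows "2 powr (real k / 4 * (1 - \<epsilon>)) \<le> real s"
proof (cases "k = 0")
  case True
  \<comment> \<open>The exponent is 0 here, so the claim amounts to 1 <= s.\<close>
  with assms(1) have "s > 0" by (cases s) auto
  with True show ?thesis by simp
next
  case False
  let ?c = "100 * (real k + 1) ^ 3"
  have c: "?c > 0" by simp
  have "real k / 4 * (1 - \<epsilon>) = (real k - log 2 ?c) / 4"
    using False by (simp add: \<epsilon>_def field_simps)
  moreover have "(2 powr (x / 4)) ^ 4 = 2 powr x" for x :: real by (simp add: powr_power)
  ultimately have "(2 powr (real k / 4 * (1 - \<epsilon>))) ^ 4 = 2 powr (real k - log 2 ?c)" by simp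
  also have "\<dots> = 2 ^ k / ?c" using c by (simp add: powr_diff powr_realpow)
  also have "\<dots> \<le> real s ^ 4"
  proof -
    have "real (2 ^ k) < real (s ^ 4 * (100 * (k + 1) ^ 3))" using assms(1) by (simp only: of_nat_less_iff)
    then have "2 ^ k < real s ^ 4 * ?c" by (simp add: add.commute)
    then show ?thesis using c by (simp add: divide_le_eq)
  qed
  finally show ?thesis by (simp only: power_mono_iff powr_ge_zero of_nat_0_le_iff zero_less_numeral)
qed

lemma xc_SDP_join_ge:
  assumes S: "S \<subseteq> Pow {..<k}" and hard: "\<And>s M. is_psd_lift s S M \<Longrightarrow> 2 ^ k < s ^ 4 * (100 * (k + 1) ^ 3)"
  shows "real p * 2 powr (real k / 4 * (1 - log 2 (100 * (real k + 1) ^ 3) / real k))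
    \<le> real (xc_SDP (p * (k + 1)) (join_set k p S))"
proof -
  let ?b = "2 powr (real k / 4 * (1 - log 2 (100 * (real k + 1) ^ 3) / real k))"
  have "finite S" using S finite_subset by blast
  then have fin: "finite (join_set k p S)" by (simp add: join_set_def join_indices_def)
  have cube: "join_set k p S \<subseteq> cube (p * (k + 1))" using join_point_in_cube by (auto simp: join_set_def)
  obtain L where L: "is_sdp_extension (p * (k + 1)) (convex hull (join_set k p S)) (xc_SDP (p * (k + 1)) (join_set k p S)) L"
    using xc_SDP_attained[OF fin cube] by blast
  obtain s where s: "(\<Sum>i<p. s i) \<le> xc_SDP (p * (k + 1)) (join_set k p S)"
    "\<And>i. i < p \<Longrightarrow> \<exists>M. is_psd_lift (s i) S M"
    using sdp_extension_join[OF S L] by blast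
  have "real p * ?b = (\<Sum>i<p. ?b)" by simp
  also have "\<dots> \<le> (\<Sum>i<p. real (s i))"
    using s(2) hard by (intro sum_mono psd_lift_size_ge) auto
  also have "\<dots> = real (\<Sum>i<p. s i)" by simp
  also have "\<dots> \<le> real (xc_SDP (p * (k + 1)) (join_set k p S))" using s(1) by (simp only: of_nat_le_iff)
  finally show ?thesis .
qed

text \<open>The quotient is at least 1, so rounding it down loses at most a factor 2. Thus the
  incomplete last block costs only a constant.\<close>

lemma div_ge_half:
  fixes a n :: nat
  assumes "0 < a" "a \<le> n"
  shows "1 / 2 * (real n / real a) \<le> real (n div a)"
proof -
  have "n div a \<ge> 1" using assms by (simp add: Suc_le_eq div_greater_zero_iff)
  then have "a \<le> n div a * a" by simp
  moreover have "n < n div a * a + a" 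
    using dividend_less_div_times[OF assms(1), of n] by simp
  ultimately have "n \<le> 2 * (n div a * a)" by linarith
  then have "real n \<le> 2 * (real (n div a) * real a)" by (metis of_nat_le_iff of_nat_mult of_nat_numeral)
  then show ?thesis using assms(1) by (simp add: field_simps)
qed

theorem theorem2:
  fixes \<omega> :: "nat \<Rightarrow> nat"
  assumes "\<And>n. n \<ge> 1 \<Longrightarrow> \<omega> n \<le> n - 1"
  shows "\<exists>(d :: nat \<Rightarrow> nat) (S :: nat \<Rightarrow> (nat \<Rightarrow>\<^sub>0 real) set).
    (\<forall>n\<ge>1. d n \<le> n \<and> S n \<subseteq> cube (d n)) \<and>
    (\<forall>n\<ge>1. tw (d n) (S n) \<le> \<omega> n + 1) \<and>
    (\<exists>\<epsilon> :: nat \<Rightarrow> real. \<epsilon> \<in> o(\<lambda>_. 1) \<and>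
       (\<lambda>n. real (xc_SDP (d n) (S n))) \<in>
         \<Omega>(\<lambda>n. real n / (real (\<omega> n) + 1) * 2 powr (real (\<omega> n) / 4 * (1 - \<epsilon> (\<omega> n))))) \<and>
    (\<exists>\<delta> :: nat \<Rightarrow> real. \<delta> \<in> o(\<lambda>_. 1) \<and>
       (\<lambda>n. real (tw (d n) (S n))) \<in> \<Omega>(\<lambda>n. real (\<omega> n) / 4 * (1 - \<delta> (\<omega> n)))) \<and>
    (\<forall>n\<ge>1. is_pyramid (convex hull (S n)))"
proof -
  have "\<forall>k. \<exists>S. S \<subseteq> Pow {..<k} \<and>
     (k > 0 \<longrightarrow> (\<exists>C. C \<subseteq> {..<k} \<and> C \<notin> S \<and> (\<forall>j<k. flip j C \<in> S))) \<and>
     (\<forall>s M. is_psd_lift s S M \<longrightarrow> 2 ^ k < s ^ 4 * (100 * (k + 1) ^ 3))"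
  proof (intro allI, rule exists_hard_set)
    fix k S assume "S \<subseteq> Pow {..<k}"
      and C: "k > 0 \<Longrightarrow> \<exists>C. C \<subseteq> {..<k} \<and> C \<notin> S \<and> (\<forall>j<k. flip j C \<in> S)"
      and M: "\<And>s M. is_psd_lift s S M \<Longrightarrow> 2 ^ k < s ^ 4 * (100 * (k + 1) ^ 3)"
    then show "\<exists>S. S \<subseteq> Pow {..<k} \<and>
       (k > 0 \<longrightarrow> (\<exists>C. C \<subseteq> {..<k} \<and> C \<notin> S \<and> (\<forall>j<k. flip j C \<in> S))) \<and>
       (\<forall>s M. is_psd_lift s S M \<longrightarrow> 2 ^ k < s ^ 4 * (100 * (k + 1) ^ 3))"
      by (intro exI[of _ S] conjI impI allI)
  qed
  then obtain H where H: "\<forall>k. H k \<subseteq> Pow {..<k} \<and>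
     (k > 0 \<longrightarrow> (\<exists>C. C \<subseteq> {..<k} \<and> C \<notin> H k \<and> (\<forall>j<k. flip j C \<in> H k))) \<and>
     (\<forall>s M. is_psd_lift s (H k) M \<longrightarrow> 2 ^ k < s ^ 4 * (100 * (k + 1) ^ 3))"
    by (elim exE[OF choice])
  have Hsub: "H k \<subseteq> Pow {..<k}" for k by (rule H[THEN spec, THEN conjunct1])
  have Hmiss: "\<exists>C. C \<subseteq> {..<k} \<and> C \<notin> H k \<and> (\<forall>j<k. flip j C \<in> H k)" if "k > 0" for k
    by (rule H[THEN spec, THEN conjunct2, THEN conjunct1, THEN mp, OF that])
  have Hhard: "2 ^ k < s ^ 4 * (100 * (k + 1) ^ 3)" if "is_psd_lift s (H k) M" for k s M
    by (rule H[THEN spec, THEN conjunct2, THEN conjunct2, THEN spec, THEN spec, THEN mp, OF that])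
  have Hfin: "finite (H k)" for k using Hsub finite_subset by blast
  \<comment> \<open>As many blocks of \<omega> n + 1 coordinates as fit into n variables.\<close>
  define p where "p = (\<lambda>n. n div (\<omega> n + 1))"
  define d where "d = (\<lambda>n. p n * (\<omega> n + 1))"
  define S where "S = (\<lambda>n. join_set (\<omega> n) (p n) (H (\<omega> n)))"
  \<comment> \<open>The o(1) terms are functions of \<omega> n rather than of n, because \<omega>
    may stay bounded as n grows.\<close>
  define \<epsilon> where "\<epsilon> = (\<lambda>k. log 2 (100 * (real k + 1) ^ 3) / real k)"
  \<comment> \<open>The isolated nonmember gives treewidth at least \<omega> n - 1, which is at
    least \<omega> n / 4 once \<omega> n >= 2. For smaller values the factor 1 - \<delta> turns the
    required bound into 0.\<close>
  define \<delta> :: "nat \<Rightarrow> real" where "\<delta> = (\<lambda>k. of_bool (k \<le> 1))"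
  have le: "\<omega> n + 1 \<le> n" if "n \<ge> 1" for n using assms[OF that] that by simp
  have p: "p n > 0" if "n \<ge> 1" for n using le[OF that] by (simp add: p_def div_greater_zero_iff)
  have "d n \<le> n \<and> S n \<subseteq> cube (d n)" for n
  proof
    show "d n \<le> n" unfolding d_def p_def by (rule div_times_less_eq_dividend)
    show "S n \<subseteq> cube (d n)" using join_point_in_cube unfolding S_def d_def join_set_def by blast
  qed
  moreover have "tw (d n) (S n) \<le> \<omega> n + 1" for n
    unfolding d_def S_def by (rule tw_join_le[OF Hsub])
  moreover have "\<epsilon> \<in> o(\<lambda>_. 1)" unfolding \<epsilon>_def by real_asymp
  moreover have "(\<lambda>n. real (xc_SDP (d n) (S n))) \<in>
      \<Omega>(\<lambda>n. real n / (real (\<omega> n) + 1) * 2 powr (real (\<omega> n) / 4 * (1 - \<epsilon> (\<omega> n))))"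
  proof (rule landau_omega.bigI[of "1 / 2"])
    show "eventually (\<lambda>n. norm (real (xc_SDP (d n) (S n))) \<ge> 1 / 2 *
      norm (real n / (real (\<omega> n) + 1) * 2 powr (real (\<omega> n) / 4 * (1 - \<epsilon> (\<omega> n))))) at_top"
      using eventually_ge_at_top[of 1]
    proof eventually_elim
      case (elim n)
      let ?b = "2 powr (real (\<omega> n) / 4 * (1 - \<epsilon> (\<omega> n)))"
      have "1 / 2 * (real n / (real (\<omega> n) + 1)) * ?b \<le> real (p n) * ?b"
        using div_ge_half[OF _ le[OF elim]] by (intro mult_right_mono) (auto simp: p_def add.commute)
      also have "\<dots> \<le> real (xc_SDP (d n) (S n))"
        unfolding d_def S_def \<epsilon>_def by (rule xc_SDP_join_ge[OF Hsub Hhard])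
      finally show ?case by simp
    qed
  qed simp
  moreover have "\<delta> \<in> o(\<lambda>_. 1)"
  proof (rule smalloI_tendsto)
    have "eventually (\<lambda>k. \<delta> k / 1 = 0) at_top"
      using eventually_gt_at_top[of 1] by eventually_elim (simp add: \<delta>_def)
    then show "((\<lambda>k. \<delta> k / 1) \<longlongrightarrow> 0) at_top" by (rule tendsto_eventually)
  qed simp
  moreover have "(\<lambda>n. real (tw (d n) (S n))) \<in> \<Omega>(\<lambda>n. real (\<omega> n) / 4 * (1 - \<delta> (\<omega> n)))"
  proof (rule landau_omega.bigI[of 1])
    show "eventually (\<lambda>n. norm (real (tw (d n) (S n))) \<ge> 1 *
      norm (real (\<omega> n) / 4 * (1 - \<delta> (\<omega> n)))) at_top"
      using eventually_ge_at_top[of 1]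
    proof eventually_elim
      case (elim n)
      show ?case
      proof (cases "\<omega> n \<le> 1")
        case False
        then have "\<omega> n > 0" by simp
        from Hmiss[OF this] obtain C where "C \<subseteq> {..<\<omega> n}" "C \<notin> H (\<omega> n)" "\<forall>j<\<omega> n. flip j C \<in> H (\<omega> n)" by blast
        then have "\<omega> n \<le> tw (d n) (S n) + 1"
          unfolding d_def S_def by (intro tw_join_ge[OF Hsub p[OF elim]]) auto
        with False show ?thesis by (simp add: \<delta>_def)
      qed (simp add: \<delta>_def)
    qed
  qed simp
  moreover have "is_pyramid (convex hull (S n))" if "n \<ge> 1" for n
    unfolding S_def by (rule is_pyramid_join[OF p[OF that] Hfin])
  ultimately show ?thesis by (intro exI[of _ d] exI[of _ S]) blast
qed

end
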